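(* Let $\mathbf{X}\in\mathbb{R}^{n\times p}$ have i.i.d. $\mathcal{N}_p(0,\Sigma)$ rows, with $\Sigma$ positive definite with bounded eigenvalues, and let $\rho_\lambda=\rho_\lambda(\cdot;\gamma)$ be the minimax concave penalty. There exist constants $C_j=C_j(\Sigma)>0$ ($j=1,2,3$) and positive constants $c_1,c_2$ such that if $n>C_1\,d\log p$, $\lambda\ge C_2\sqrt{(d+1)\log p/n}$ (with $d=d(\Sigma)$) and $\beta_{\min}(\Sigma)>(1+\gamma)\lambda$ for some $\gamma>C_3>0$, then for any choice of restricted minimizers $\hat B(\pi)$, with probability at least $1-c_1\exp(-c_2\min\{n,(d+1)\log p\})$: (1) for every permutation $\pi$, the DAG of $\hat B(\pi)$ is a minimal I-map of $\mathcal{N}_p(0,\Sigma)$; (2) $\bigcup_\pi\mathcal{I}(\hat B(\pi))=\mathcal{I}(\Sigma)$, the union being over all permutations of $[p]$.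
   Context: Setup. $\mathbb{D}$: real $p\times p$ matrices whose directed graph $G(B)$ (edge $i\to j$ iff $b_{ij}\ne0$) is acyclic. For a permutation $\pi$, $(P_\pi A)_{ij}=a_{\pi(i)\pi(j)}$; write uniquely $P_\pi\Sigma^{-1}=(I-L)D^{-1}(I-L)^T$ ($L$ strictly lower triangular, $D$ positive diagonal) and set $\tilde B(\pi)=P_{\pi^{-1}}L$, $\tilde\beta_j(\pi)$ its columns. $\mathbb{D}[\pi]=\{B\in\mathbb{D}:P_\pi B\text{ lower triangular}\}$. $Q(B)=\frac{1}{2n}\|\mathbf{X}-\mathbf{X}B\|_F^2+\sum_{i,j}\rho_\lambda(|b_{ij}|)$; a restricted minimizer is any $\hat B(\pi)\in\arg\min_{B\in\mathbb{D}[\pi]}Q(B)$. $\beta_{\min}(v)=\min\{|v_i|:v_i\ne0\}$; $d(\Sigma)=\max_{\pi,j}\|\tilde\beta_j(\pi)\|_0$; $\beta_{\min}(\Sigma)=\min_{\pi,j}\beta_{\min}(\tilde\beta_j(\pi))$. MCP: $\rho_\lambda(x;\gamma)=\lambda\big(x-\frac{x^2}{2\lambda\gamma}\big)1(x<\lambda\gamma)+\frac{\lambda^2\gamma}{2}1(x\ge\lambda\gamma)$. For a DAG $G$ on $[p]$, $\mathcal{I}(G)$ is the set of triples $(i,j,S)$ ($S\subset[p]\setminus\{i,j\}$) such that $i$ and $j$ are d-separated by $S$ in $G$; for a matrix $B\in\mathbb{D}$, $\mathcal{I}(B)=\mathcal{I}(G(B))$. $\mathcal{I}(\Sigma)$ is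 the set of triples $(i,j,S)$ with $X_i\perp X_j\mid X_S$ for $X\sim\mathcal{N}_p(0,\Sigma)$. $G$ is an I-map if $\mathcal{I}(G)\subset\mathcal{I}(\Sigma)$, and a minimal I-map if moreover removing any edge destroys this inclusion. *)

theory Defs
  imports "HOL-Probability.Probability" "HOL-Combinatorics.Permutations"
begin

text \<open>Conventions. The dimension p is an explicit natural number; the index set [p] is
  rendered as the set of naturals below p. Real p x p matrices are functions
  nat to nat to real, only the entries with both indices below p being relevant.
  The data matrix is a function from the sample space: the entry X w i k is the
  (i,k) entry of the data matrix in outcome w (row i below n, column k below p).\<close>

definition supported :: "nat \<Rightarrow> (nat \<Rightarrow> nat \<Rightarrow> real) \<Rightarrow> bool" where
  "supported p B \<longleftrightarrow> (\<forall>i j. (p \<le> i \<or> p \<le> j) \<longrightarrow> B i j = 0)"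

definition graph_of :: "nat \<Rightarrow> (nat \<Rightarrow> nat \<Rightarrow> real) \<Rightarrow> (nat \<times> nat) set" where
  "graph_of p B = {(i, j). i < p \<and> j < p \<and> B i j \<noteq> 0}"

definition dag_mats :: "nat \<Rightarrow> (nat \<Rightarrow> nat \<Rightarrow> real) set" where
  "dag_mats p = {B. supported p B \<and> acyclic (graph_of p B)}"

definition permute_mat :: "(nat \<Rightarrow> nat) \<Rightarrow> (nat \<Rightarrow> nat \<Rightarrow> real) \<Rightarrow> (nat \<Rightarrow> nat \<Rightarrow> real)" where
  "permute_mat \<pi> A = (\<lambda>i j. A (\<pi> i) (\<pi> j))"

definition lower_triangular :: "nat \<Rightarrow> (nat \<Rightarrow> nat \<Rightarrow> real) \<Rightarrow> bool" where
  "lower_triangular p A \<longleftrightarrow> (\<forall>i<p. \<forall>j<p. i < j \<longrightarrow> A i j = 0)"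

definition dag_mats_pi :: "nat \<Rightarrow> (nat \<Rightarrow> nat) \<Rightarrow> (nat \<Rightarrow> nat \<Rightarrow> real) set" where
  "dag_mats_pi p \<pi> = {B \<in> dag_mats p. lower_triangular p (permute_mat \<pi> B)}"

definition mcp :: "real \<Rightarrow> real \<Rightarrow> real \<Rightarrow> real" where
  "mcp lam \<gamma> x =
     (if x < lam * \<gamma> then lam * (x - x\<^sup>2 / (2 * lam * \<gamma>)) else lam\<^sup>2 * \<gamma> / 2)"

definition Qobj :: "nat \<Rightarrow> nat \<Rightarrow> (nat \<Rightarrow> nat \<Rightarrow> real) \<Rightarrow> real \<Rightarrow> real
                     \<Rightarrow> (nat \<Rightarrow> nat \<Rightarrow> real) \<Rightarrow> real" where
  "Qobj n p Xd lam \<gamma> B =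
     1 / (2 * real n) * (\<Sum>i<n. \<Sum>j<p. (Xd i j - (\<Sum>k<p. Xd i k * B k j))\<^sup>2)
     + (\<Sum>i<p. \<Sum>j<p. mcp lam \<gamma> \<bar>B i j\<bar>)"

definition restricted_minimizer :: "nat \<Rightarrow> nat \<Rightarrow> (nat \<Rightarrow> nat \<Rightarrow> real) \<Rightarrow> real \<Rightarrow> real
                     \<Rightarrow> (nat \<Rightarrow> nat) \<Rightarrow> (nat \<Rightarrow> nat \<Rightarrow> real) \<Rightarrow> bool" where
  "restricted_minimizer n p Xd lam \<gamma> \<pi> B \<longleftrightarrow>
     B \<in> dag_mats_pi p \<pi> \<and> (\<forall>B' \<in> dag_mats_pi p \<pi>. Qobj n p Xd lam \<gamma> B \<le> Qobj n p Xd lam \<gamma> B')"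

definition pos_def :: "nat \<Rightarrow> (nat \<Rightarrow> nat \<Rightarrow> real) \<Rightarrow> bool" where
  "pos_def p S \<longleftrightarrow> (\<forall>i<p. \<forall>j<p. S i j = S j i) \<and>
     (\<forall>v. (\<exists>i<p. v i \<noteq> 0) \<longrightarrow> (\<Sum>i<p. \<Sum>j<p. v i * S i j * v j) > 0)"

definition mat_inv :: "nat \<Rightarrow> (nat \<Rightarrow> nat \<Rightarrow> real) \<Rightarrow> (nat \<Rightarrow> nat \<Rightarrow> real)" where
  "mat_inv p S = (THE W. supported p W \<and>
       (\<forall>i<p. \<forall>j<p. (\<Sum>k<p. W i k * S k j) = (if i = j then 1 else 0)))"

definition ldl_factor :: "nat \<Rightarrow> (nat \<Rightarrow> nat \<Rightarrow> real) \<Rightarrow> (nat \<Rightarrow> nat) \<Rightarrow> (nat \<Rightarrow> nat \<Rightarrow> real) \<Rightarrow> bool" where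
  "ldl_factor p S \<pi> L \<longleftrightarrow>
     supported p L \<and> (\<forall>i j. i \<le> j \<longrightarrow> L i j = 0) \<and>
     (\<exists>D :: nat \<Rightarrow> real. (\<forall>k<p. D k > 0) \<and>
        (\<forall>i<p. \<forall>j<p. permute_mat \<pi> (mat_inv p S) i j =
           (\<Sum>k<p. ((if i = k then 1 else 0) - L i k) * (1 / D k) * ((if j = k then 1 else 0) - L j k))))"

definition Btilde :: "nat \<Rightarrow> (nat \<Rightarrow> nat \<Rightarrow> real) \<Rightarrow> (nat \<Rightarrow> nat) \<Rightarrow> (nat \<Rightarrow> nat \<Rightarrow> real)" where
  "Btilde p S \<pi> = permute_mat (inv \<pi>) (THE L. ldl_factor p S \<pi> L)"

text \<open>||v||_0 for the j-th column of a matrix, and beta_min of a column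
  (minimum absolute nonzero entry; +infinity for the zero column).\<close>
definition col_l0 :: "nat \<Rightarrow> (nat \<Rightarrow> nat \<Rightarrow> real) \<Rightarrow> nat \<Rightarrow> nat" where
  "col_l0 p B j = card {i. i < p \<and> B i j \<noteq> 0}"

definition col_beta_min :: "nat \<Rightarrow> (nat \<Rightarrow> nat \<Rightarrow> real) \<Rightarrow> nat \<Rightarrow> ereal" where
  "col_beta_min p B j = (INF i \<in> {i. i < p \<and> B i j \<noteq> 0}. ereal \<bar>B i j\<bar>)"

definition d_Sigma :: "nat \<Rightarrow> (nat \<Rightarrow> nat \<Rightarrow> real) \<Rightarrow> nat" where
  "d_Sigma p S = Max (insert 0 {col_l0 p (Btilde p S \<pi>) j | \<pi> j. \<pi> permutes {..<p} \<and> j < p})"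

definition beta_min_Sigma :: "nat \<Rightarrow> (nat \<Rightarrow> nat \<Rightarrow> real) \<Rightarrow> ereal" where
  "beta_min_Sigma p S = (INF \<pi> \<in> {\<pi>. \<pi> permutes {..<p}}. INF j \<in> {..<p}. col_beta_min p (Btilde p S \<pi>) j)"

definition trail :: "(nat \<times> nat) set \<Rightarrow> nat list \<Rightarrow> bool" where
  "trail G vs \<longleftrightarrow> vs \<noteq> [] \<and> distinct vs \<and>
     (\<forall>m. Suc m < length vs \<longrightarrow> (vs ! m, vs ! Suc m) \<in> G \<or> (vs ! Suc m, vs ! m) \<in> G)"

text \<open>Interior position m (0 < m < length - 1) is a collider: v_{m-1} to v_m from v_{m+1}.\<close>
definition collider :: "(nat \<times> nat) set \<Rightarrow> nat list \<Rightarrow> nat \<Rightarrow> bool" where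
  "collider G vs m \<longleftrightarrow> (vs ! (m - 1), vs ! m) \<in> G \<and> (vs ! Suc m, vs ! m) \<in> G"

definition blocked :: "(nat \<times> nat) set \<Rightarrow> nat set \<Rightarrow> nat list \<Rightarrow> bool" where
  "blocked G S vs \<longleftrightarrow> (\<exists>m. 0 < m \<and> Suc m < length vs \<and>
     (if collider G vs m then G\<^sup>* `` {vs ! m} \<inter> S = {} else vs ! m \<in> S))"

definition d_separated :: "(nat \<times> nat) set \<Rightarrow> nat \<Rightarrow> nat \<Rightarrow> nat set \<Rightarrow> bool" where
  "d_separated G i j S \<longleftrightarrow>
     (\<forall>vs. trail G vs \<and> hd vs = i \<and> last vs = j \<longrightarrow> blocked G S vs)"

definition indep_model_graph :: "nat \<Rightarrow> (nat \<times> nat) set \<Rightarrow> (nat \<times> nat \<times> nat set) set" where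
  "indep_model_graph p G = {(i, j, S). i < p \<and> j < p \<and> i \<noteq> j \<and> S \<subseteq> {..<p} - {i, j}
       \<and> d_separated G i j S}"

text \<open>Y is N_p(0,Sigma) on the probability space M (Cramer-Wold definition: every nontrivial
  linear combination a^T Y is normal with mean 0 and variance a^T Sigma a).\<close>
definition mvn :: "'a measure \<Rightarrow> nat \<Rightarrow> (nat \<Rightarrow> nat \<Rightarrow> real) \<Rightarrow> ('a \<Rightarrow> nat \<Rightarrow> real) \<Rightarrow> bool" where
  "mvn M p S Y \<longleftrightarrow> (\<forall>a. (\<exists>j<p. a j \<noteq> 0) \<longrightarrow>
      distributed M lborel (\<lambda>w. \<Sum>j<p. a j * Y w j)
        (normal_density 0 (sqrt (\<Sum>j<p. \<Sum>k<p. a j * S j k * a k))))"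

definition cond_indep :: "'a measure \<Rightarrow> ('a \<Rightarrow> nat \<Rightarrow> real) \<Rightarrow> nat \<Rightarrow> nat \<Rightarrow> nat set \<Rightarrow> bool" where
  "cond_indep M Y i j S \<longleftrightarrow>
     (let F = vimage_algebra (space M) (\<lambda>w. restrict (Y w) S) (PiM S (\<lambda>_. borel)) in
      \<forall>A \<in> sets borel. \<forall>B \<in> sets borel.
        AE w in M. real_cond_exp M F (\<lambda>u. indicator A (Y u i) * indicator B (Y u j)) w
          = real_cond_exp M F (\<lambda>u. indicator A (Y u i)) w * real_cond_exp M F (\<lambda>u. indicator B (Y u j)) w)"

definition indep_model_gauss :: "'a measure \<Rightarrow> nat \<Rightarrow> (nat \<Rightarrow> nat \<Rightarrow> real) \<Rightarrow> (nat \<times> nat \<times> nat set) set" where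
  "indep_model_gauss M p S = {(i, j, T). i < p \<and> j < p \<and> i \<noteq> j \<and> T \<subseteq> {..<p} - {i, j}
       \<and> (\<forall>Y. mvn M p S Y \<longrightarrow> cond_indep M Y i j T)}"

definition I_map :: "'a measure \<Rightarrow> nat \<Rightarrow> (nat \<Rightarrow> nat \<Rightarrow> real) \<Rightarrow> (nat \<times> nat) set \<Rightarrow> bool" where
  "I_map M p S G \<longleftrightarrow> indep_model_graph p G \<subseteq> indep_model_gauss M p S"

definition minimal_I_map :: "'a measure \<Rightarrow> nat \<Rightarrow> (nat \<Rightarrow> nat \<Rightarrow> real) \<Rightarrow> (nat \<times> nat) set \<Rightarrow> bool" where
  "minimal_I_map M p S G \<longleftrightarrow> I_map M p S G \<and> (\<forall>e \<in> G. \<not> I_map M p S (G - {e}))"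

end

(*
  Since the constants C1, C2, C3 may depend on Sigma, Chebyshev's inequality is enough for the
  probabilistic part: with probability at least 1 - eps every one of finitely many sample
  covariances is within t / sqrt n of its mean, where t depends only on Sigma and eps. For n large
  the sample covariance matrix is then uniformly positive definite, and comparing a restricted
  minimizer first with the population coefficients and then with itself after deleting one entry
  shows that its support is exactly that of Btilde. For n small the hypotheses force d = 0, and
  the MCP level lam^2 * gamma / 2 alone exceeds the whole loss, so the minimizer vanishes.

  On the population side, conditional independence of Gaussian variables means that the residual
  of X_i on X_S is uncorrelated with X_j; this is proved by uniqueness of characteristic functions.
  d-separation implies this orthogonality by an energy argument on the factorization
  (I - B) D^{-1} (I - B)^T. Conversely, an ordering that puts S first, then j, then i, turns a
  given independence of i and j given S into a d-separation.
*)
theory Submission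
  imports Defs
begin

section \<open>Gaussian linear algebra and the triangular factorization\<close>

text \<open>The order of quantifiers decides how much must be proved. \<open>c1\<close> and
  \<open>c2\<close> are both 1, and p, the covariance and hence d are fixed before n; so exp(-(d+1)
  log p) is a constant eps, never larger than exp(-min{n, (d+1) log p}), and a deviation of order t
  / sqrt n with t depending on eps is good enough, since C2 absorbs t. The obstacle is d = 0: the
  bound on n then only says n > 0, the sample covariance may be singular, and no curvature is
  available. Two features of the definitions shape the rest. d-separation quantifies over trails,
  which do not repeat vertices, whereas reachability arguments produce walks, so loops have to be
  cut without creating a block. And \<open>indep_model_gauss\<close> ranges over all Gaussian
  vectors on M, so it carries information only if one exists; row 0 of the data is such a
  vector.\<close>

definition cv :: "nat \<Rightarrow> (nat \<Rightarrow> nat \<Rightarrow> real) \<Rightarrow> (nat \<Rightarrow> real) \<Rightarrow> nat \<Rightarrow> real" where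
  "cv p S u k = (\<Sum>i<p. u i * S i k)"

text \<open>Covariance of the linear forms with coefficients u and v. The matrix stays a parameter
  because the sample Gram matrix is inserted later as well.\<close>

definition ip :: "nat \<Rightarrow> (nat \<Rightarrow> nat \<Rightarrow> real) \<Rightarrow> (nat \<Rightarrow> real) \<Rightarrow> (nat \<Rightarrow> real) \<Rightarrow> real" where
  "ip p S u v = (\<Sum>i<p. \<Sum>j<p. u i * S i j * v j)"

definition unit :: "nat \<Rightarrow> nat \<Rightarrow> real" where
  "unit k = (\<lambda>i. if i = k then 1 else 0)"

text \<open>Column k of I - B: the coefficients of the structural residual of variable k.\<close>

definition resid :: "(nat \<Rightarrow> nat \<Rightarrow> real) \<Rightarrow> nat \<Rightarrow> nat \<Rightarrow> real" where
  "resid B k = (\<lambda>a. unit k a - B a k)"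

lemma unit_simps [simp]: "unit k k = 1" "i \<noteq> k \<Longrightarrow> unit k i = 0"
  by (auto simp: unit_def)

lemma cv_add: "cv p S (\<lambda>i. u i + v i) k = cv p S u k + cv p S v k"
  by (simp add: cv_def algebra_simps sum.distrib)

lemma cv_diff: "cv p S (\<lambda>i. u i - v i) k = cv p S u k - cv p S v k"
  by (simp add: cv_def algebra_simps sum_subtractf)

lemma cv_scale: "cv p S (\<lambda>i. c * u i) k = c * cv p S u k"
  by (simp add: cv_def sum_distrib_left mult.assoc)

lemma sum_unit [simp]: "k < p \<Longrightarrow> (\<Sum>i<p. unit k i * f i) = f k"
  by (simp add: unit_def if_distrib[of "\<lambda>x. x * _"] cong: if_cong)

lemma sum_unit' [simp]: "k < p \<Longrightarrow> (\<Sum>i<p. f i * unit k i) = f k"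
  by (simp add: unit_def if_distrib[of "\<lambda>x. _ * x"] cong: if_cong)

lemma cv_unit: "k < p \<Longrightarrow> cv p S (unit k) l = S k l"
  by (simp add: cv_def)

lemma ip_cv: "ip p S u v = (\<Sum>k<p. cv p S u k * v k)"
  unfolding ip_def cv_def by (subst sum.swap) (simp add: sum_distrib_right)

lemma ip_unit: "k < p \<Longrightarrow> ip p S u (unit k) = cv p S u k"
  by (simp add: ip_cv)

lemma ip_add_right: "ip p S u (\<lambda>i. v i + w i) = ip p S u v + ip p S u w"
  by (simp add: ip_cv algebra_simps sum.distrib)

lemma ip_diff_right: "ip p S u (\<lambda>i. v i - w i) = ip p S u v - ip p S u w"
  by (simp add: ip_cv algebra_simps sum_subtractf)

lemma ip_scale_right: "ip p S u (\<lambda>i. c * v i) = c * ip p S u v"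
  by (simp add: ip_cv sum_distrib_left mult_ac)

lemma ip_diff_left: "ip p S (\<lambda>i. v i - w i) u = ip p S v u - ip p S w u"
  by (simp add: ip_cv cv_diff algebra_simps sum_subtractf)

lemma ip_add_left: "ip p S (\<lambda>i. v i + w i) u = ip p S v u + ip p S w u"
  by (simp add: ip_cv cv_add algebra_simps sum.distrib)

lemma ip_scale_left: "ip p S (\<lambda>i. c * v i) u = c * ip p S v u"
  by (simp add: ip_cv cv_scale sum_distrib_left mult_ac)

lemma ip_cong: "(\<And>i. i < p \<Longrightarrow> u i = u' i) \<Longrightarrow> (\<And>i. i < p \<Longrightarrow> v i = v' i) \<Longrightarrow> ip p S u v = ip p S u' v'"
  by (simp add: ip_def)

lemma cv_cong: "(\<And>i. i < p \<Longrightarrow> u i = u' i) \<Longrightarrow> cv p S u k = cv p S u' k"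
  by (simp add: cv_def)

section \<open>Least squares in the inner product given by the covariance matrix\<close>

locale pd_mat =
  fixes p :: nat and S :: "nat \<Rightarrow> nat \<Rightarrow> real"
  assumes pd: "pos_def p S"
begin

lemma S_sym: "i < p \<Longrightarrow> j < p \<Longrightarrow> S i j = S j i"
  using pd by (auto simp: pos_def_def)

lemma ip_pos: "i < p \<Longrightarrow> v i \<noteq> 0 \<Longrightarrow> ip p S v v > 0"
  using pd by (auto simp: pos_def_def ip_def)

lemma ip_zeroD: "ip p S v v = 0 \<Longrightarrow> i < p \<Longrightarrow> v i = 0"
  using ip_pos[of i v] by fastforce

lemma ip_nonneg: "ip p S v v \<ge> 0"
proof (cases "\<exists>i<p. v i \<noteq> 0")
  case True then show ?thesis using ip_pos by (meson less_imp_le)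
next
  case False then show ?thesis by (simp add: ip_def)
qed

lemma ip_commute: "ip p S u v = ip p S v u"
proof -
  have "ip p S u v = (\<Sum>j<p. \<Sum>i<p. u i * S i j * v j)"
    unfolding ip_def by (rule sum.swap)
  also have "\<dots> = ip p S v u"
    unfolding ip_def by (intro sum.cong refl) (simp add: S_sym mult_ac)
  finally show ?thesis .
qed

text \<open>Gram-Schmidt: q, the residual of the new variable t on T, is uncorrelated with T and has
  positive variance. A multiple of q therefore repairs the normal equation at t without disturbing
  those on T.\<close>

lemma regression_exists:
  assumes "finite T" "T \<subseteq> {..<p}"
  shows "\<exists>b. (\<forall>k. k \<notin> T \<longrightarrow> b k = 0) \<and> (\<forall>k\<in>T. cv p S b k = cv p S x k)"
  using assms
proof (induction T arbitrary: x rule: finite_induct)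
  case empty
  then show ?case by (intro exI[of _ "\<lambda>_. 0"]) auto
next
  case (insert t T)
  then have t: "t < p" and T: "T \<subseteq> {..<p}" by auto
  obtain bx where bx: "\<And>k. k \<notin> T \<Longrightarrow> bx k = 0" "\<And>k. k \<in> T \<Longrightarrow> cv p S bx k = cv p S x k"
    using insert.IH[OF T, of x] by auto
  obtain bt where bt: "\<And>k. k \<notin> T \<Longrightarrow> bt k = 0" "\<And>k. k \<in> T \<Longrightarrow> cv p S bt k = cv p S (unit t) k"
    using insert.IH[OF T, of "unit t"] by auto
  define q where "q = (\<lambda>i. unit t i - bt i)"
  have qT: "cv p S q k = 0" if "k \<in> T" for k
    using bt(2)[OF that] by (simp add: q_def cv_diff)
  have "q t = 1" using bt(1) insert.hyps by (simp add: q_def)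
  then have pos: "ip p S q q > 0" using ip_pos[of t q] t by simp
  \<comment> \<open>Only the summand at t survives: on T the covariance with q is zero, and outside
    T and t the entries of q are zero.\<close>
  have "ip p S q q = (\<Sum>k<p. cv p S q k * q k)" by (rule ip_cv)
  also have "\<dots> = (\<Sum>k<p. cv p S q t * unit t k)"
  proof (intro sum.cong refl)
    fix k
    show "cv p S q k * q k = cv p S q t * unit t k"
    proof (cases "k \<in> T \<or> k = t")
      case True
      then show ?thesis using qT \<open>q t = 1\<close> insert.hyps by (auto simp: unit_def)
    next
      case False
      then show ?thesis using bt(1) by (simp add: q_def)
    qed
  qed
  also have "\<dots> = cv p S q t" using t by (simp only: sum_unit')
  finally have qt: "cv p S q t \<noteq> 0" using pos by simp
  define c where "c = (cv p S x t - cv p S bx t) / cv p S q t"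
  define b where "b = (\<lambda>i. bx i + c * q i)"
  have cvb: "cv p S b k = cv p S bx k + c * cv p S q k" for k
    unfolding b_def by (simp add: cv_add cv_scale)
  have "b k = 0" if "k \<notin> insert t T" for k
    using that bx(1) bt(1) by (simp add: b_def q_def)
  moreover have "cv p S b k = cv p S x k" if "k \<in> insert t T" for k
  proof (cases "k \<in> T")
    case True
    then show ?thesis using bx(2) qT by (simp add: cvb)
  next
    case False
    then have "k = t" using that by simp
    then show ?thesis using qt by (simp add: cvb c_def)
  qed
  ultimately show ?case by blast
qed

text \<open>Each summand of the variance of b has a zero factor, so the variance is zero and
  definiteness applies.\<close>

lemma regression_unique:
  assumes "\<And>k. k < p \<Longrightarrow> k \<notin> T \<Longrightarrow> b k = 0" "\<And>k. k \<in> T \<Longrightarrow> k < p \<Longrightarrow> cv p S b k = 0" "k < p"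
  shows "b k = 0"
proof -
  have "ip p S b b = 0"
    unfolding ip_cv using assms(1,2) by (intro sum.neutral) force
  then show ?thesis using assms(3) ip_zeroD by blast
qed

lemma Cauchy_Schwarz: "(ip p S u v)\<^sup>2 \<le> ip p S u u * ip p S v v"
proof (cases "ip p S u u = 0")
  case True
  then have "u i = 0" if "i < p" for i using ip_zeroD that by blast
  then have "ip p S u v = 0" by (simp add: ip_def)
  then show ?thesis using True by simp
next
  case False
  then have pos: "ip p S u u > 0" using ip_nonneg[of u] by simp
  define c where "c = ip p S u v / ip p S u u"
  have "0 \<le> ip p S (\<lambda>i. v i - c * u i) (\<lambda>i. v i - c * u i)" by (rule ip_nonneg)
  also have "\<dots> = ip p S v v - 2 * c * ip p S u v + c\<^sup>2 * ip p S u u"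
    using ip_commute[of u v]
    by (simp add: ip_diff_left ip_diff_right ip_scale_left ip_scale_right algebra_simps power2_eq_square)
  also have "\<dots> = ip p S v v - (ip p S u v)\<^sup>2 / ip p S u u"
    using pos by (simp add: c_def field_simps power2_eq_square)
  finally show ?thesis using pos by (simp add: field_simps)
qed

text \<open>\<open>r\<close> ranks the variables, parents above children; for \<open>Btilde p S \<pi>\<close> it is \<open>inv \<pi>\<close>.
  The last conjunct says that \<open>(I - B) D\<^sup>-\<^sup>1 (I - B)\<^sup>T\<close> is a left inverse of \<open>S\<close>.\<close>

definition sem :: "(nat \<Rightarrow> nat) \<Rightarrow> (nat \<Rightarrow> nat \<Rightarrow> real) \<Rightarrow> (nat \<Rightarrow> real) \<Rightarrow> bool" where
  "sem r B D \<longleftrightarrow> supported p B \<and> (\<forall>a b. B a b \<noteq> 0 \<longrightarrow> r b < r a) \<and> (\<forall>k<p. D k > 0) \<and>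
     (\<forall>b<p. \<forall>a<p. r b < r a \<longrightarrow> cv p S (resid B b) a = 0) \<and>
     (\<forall>a<p. \<forall>c<p. (\<Sum>k<p. resid B k a * (cv p S (resid B k) c / D k)) = unit c a)"

lemma semD:
  assumes "sem r B D"
  shows "supported p B" "B a b \<noteq> 0 \<Longrightarrow> r b < r a" "k < p \<Longrightarrow> D k > 0"
    "b < p \<Longrightarrow> a < p \<Longrightarrow> r b < r a \<Longrightarrow> cv p S (resid B b) a = 0"
    "a < p \<Longrightarrow> c < p \<Longrightarrow> (\<Sum>k<p. resid B k a * (cv p S (resid B k) c / D k)) = unit c a"
  using assms unfolding sem_def by blast+

lemma supportedD: "supported p B \<Longrightarrow> \<not> (a < p \<and> b < p) \<Longrightarrow> B a b = 0"
  by (auto simp: supported_def)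

text \<open>Column b is the regression of variable b on the variables of higher rank, and
  regressions are unique.\<close>

lemma sem_unique:
  assumes "sem r B D" "sem r B' D'"
  shows "B = B'"
proof (intro ext)
  fix a b
  show "B a b = B' a b"
  proof (cases "a < p \<and> b < p")
    case False
    then show ?thesis using assms[THEN semD(1)] supportedD by metis
  next
    case True
    have "B a b - B' a b = 0"
    proof (rule regression_unique[of "{k. k < p \<and> r b < r k}" "\<lambda>a. B a b - B' a b"])
      fix k assume "k < p" "k \<notin> {k. k < p \<and> r b < r k}"
      then have "\<not> r b < r k" by simp
      then show "B k b - B' k b = 0" using assms[THEN semD(2)] by (metis diff_self)
    next
      fix k assume "k \<in> {k. k < p \<and> r b < r k}"
      then have k: "cv p S (resid B b) k = 0" "cv p S (resid B' b) k = 0"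
        using assms[THEN semD(4)] True by auto
      then show "cv p S (\<lambda>a. B a b - B' a b) k = 0"
        by (simp add: resid_def cv_diff)
    qed (use True in simp)
    then show ?thesis by simp
  qed
qed

text \<open>Column j of B holds the regression coefficients of j on everything of higher rank, and D
  the residual variances. Residuals of different variables are uncorrelated, and an orthogonal
  expansion in them yields the inverse formula.\<close>

lemma sem_exists:
  assumes r: "inj_on r {..<p}" "\<And>a. a < p \<Longrightarrow> r a < p"
  shows "\<exists>B D. sem r B D"
proof -
  define T where "T b = {a. a < p \<and> r b < r a}" for b
  have "\<exists>b. (\<forall>k. k \<notin> T j \<longrightarrow> b k = 0) \<and> (\<forall>k\<in>T j. cv p S b k = cv p S (unit j) k)" for j
    by (rule regression_exists) (auto simp: T_def)
  then obtain \<beta> where \<beta>: "\<And>j k. k \<notin> T j \<Longrightarrow> \<beta> j k = 0" "\<And>j k. k \<in> T j \<Longrightarrow> cv p S (\<beta> j) k = cv p S (unit j) k"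
    by metis
  define B where "B = (\<lambda>a b. if b < p then \<beta> b a else 0)"
  define D where "D k = ip p S (resid B k) (resid B k)" for k
  have sup: "supported p B"
    using \<beta>(1) by (auto simp: supported_def B_def T_def)
  have ord: "r b < r a" if "B a b \<noteq> 0" for a b
    using that \<beta>(1)[of a b] by (auto simp: B_def T_def split: if_splits)
  have orth: "cv p S (resid B b) a = 0" if "a < p" "b < p" "r b < r a" for a b
    using \<beta>(2)[of a b] that by (simp add: resid_def B_def cv_diff T_def)
  have diag: "resid B k k = 1" for k
    using ord[of k k] by (auto simp: resid_def)
  have Dpos: "D k > 0" if "k < p" for k
    unfolding D_def using ip_pos[OF that, of "resid B k"] diag by simp
  have orth': "ip p S (resid B j) (resid B k) = 0" if "j < p" "k < p" "r j < r k" for j k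
    unfolding ip_cv
  proof (intro sum.neutral ballI)
    fix x assume x: "x \<in> {..<p}"
    show "cv p S (resid B j) x * resid B k x = 0"
    proof (cases "r j < r x")
      case True then show ?thesis using orth x that by simp
    next
      case False
      then have "B x k = 0" "x \<noteq> k" using ord[of x k] that by auto
      then show ?thesis by (simp add: resid_def)
    qed
  qed
  have res_orth: "ip p S (resid B j) (resid B k) = (if j = k then D j else 0)" if "j < p" "k < p" for j k
  proof (cases "j = k")
    case False
    then have "r j \<noteq> r k" using r(1) that by (auto simp: inj_on_def)
    then show ?thesis using orth'[of j k] orth'[of k j] that ip_commute[of "resid B j" "resid B k"] False
      by (cases "r j < r k") auto
  qed (simp add: D_def)
  \<comment> \<open>The orthogonal projection onto the span of the residual columns. The inverse
    formula says that it fixes every unit vector.\<close>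
  define P where "P v a = (\<Sum>k<p. resid B k a * (ip p S (resid B k) v / D k))" for v a
  have Pres: "P (resid B m) a = resid B m a" if "m < p" for m a
  proof -
    have "P (resid B m) a = (\<Sum>k<p. resid B k a * unit m k)"
      unfolding P_def using that Dpos[OF that] by (intro sum.cong refl) (auto simp: res_orth unit_def)
    then show ?thesis using that by simp
  qed
  have P_add: "P (\<lambda>i. v i + w i) a = P v a + P w a" for v w a
    by (simp add: P_def ip_add_right add_divide_distrib distrib_left sum.distrib)
  have P_sum: "P (\<lambda>i. \<Sum>c<p. g c * unit c i) a = (\<Sum>c<p. g c * P (unit c) a)" for g a
  proof -
    have *: "ip p S w (\<lambda>i. \<Sum>c<p. g c * unit c i) = (\<Sum>c<p. g c * ip p S w (unit c))" for w
    proof -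
      have "ip p S w (\<lambda>i. \<Sum>c<p. g c * unit c i) = ip p S w g"
        by (rule ip_cong) (auto simp: unit_def if_distrib[of "\<lambda>x. _ * x"] cong: if_cong)
      also have "\<dots> = (\<Sum>c<p. g c * ip p S w (unit c))"
        by (simp add: ip_unit) (simp add: ip_cv mult.commute)
      finally show ?thesis .
    qed
    have "P (\<lambda>i. \<Sum>c<p. g c * unit c i) a = (\<Sum>k<p. \<Sum>c<p. g c * (resid B k a * (ip p S (resid B k) (unit c) / D k)))"
      unfolding P_def * by (simp add: sum_divide_distrib sum_distrib_left mult_ac)
    also have "\<dots> = (\<Sum>c<p. g c * P (unit c) a)"
      by (subst sum.swap) (simp add: P_def sum_distrib_left)
    finally show ?thesis .
  qed
  \<comment> \<open>Induction from the highest rank downwards: a unit vector is its own residual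
    column plus a combination of unit vectors of higher rank. Ranks below p make p - r c a
    measure.\<close>
  have P_unit: "P (unit c) a = unit c a" if "c < p" "a < p" for c a
    using that(1)
  proof (induction "p - r c" arbitrary: c rule: less_induct)
    case less
    have dec: "unit c i = resid B c i + (\<Sum>d<p. B d c * unit d i)" if "i < p" for i
      using that by (simp add: resid_def unit_def if_distrib[of "\<lambda>x. _ * x"] cong: if_cong)
    have "P (unit c) a = P (\<lambda>i. resid B c i + (\<Sum>d<p. B d c * unit d i)) a"
      unfolding P_def by (intro sum.cong refl arg_cong2[where f = "(*)"] arg_cong2[where f = "(/)"] ip_cong dec) 
    also have "\<dots> = resid B c a + (\<Sum>d<p. B d c * P (unit d) a)"
      using less.prems by (simp add: P_add Pres P_sum)
    also have "(\<Sum>d<p. B d c * P (unit d) a) = (\<Sum>d<p. B d c * unit d a)"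
    proof (intro sum.cong refl)
      fix d assume d: "d \<in> {..<p}"
      show "B d c * P (unit d) a = B d c * unit d a"
      proof (cases "B d c = 0")
        case False
        then have "r c < r d" by (rule ord)
        then have "p - r d < p - r c" using r(2)[of d] d by auto
        then show ?thesis using less.hyps[of d] d by auto
      qed simp
    qed
    finally show ?case using dec[OF that(2)] by simp
  qed
  have "(\<Sum>k<p. resid B k a * (cv p S (resid B k) c / D k)) = unit c a" if "a < p" "c < p" for a c
    using P_unit[OF that(2,1)] that by (simp add: P_def ip_unit)
  then have "sem r B D"
    unfolding sem_def using sup ord orth Dpos by blast
  then show ?thesis by blast
qed

section \<open>The inverse covariance and its triangular factor\<close>

lemma left_inverse_unique:
  assumes "supported p W" "supported p W'"
    "\<And>i j. i < p \<Longrightarrow> j < p \<Longrightarrow> (\<Sum>k<p. W i k * S k j) = (if i = j then 1 else 0)"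
    "\<And>i j. i < p \<Longrightarrow> j < p \<Longrightarrow> (\<Sum>k<p. W' i k * S k j) = (if i = j then 1 else 0)"
  shows "W = W'"
proof (intro ext)
  fix a b
  show "W a b = W' a b"
  proof (cases "a < p \<and> b < p")
    case False
    then show ?thesis using assms(1,2)[THEN supportedD] by metis
  next
    case True
    have "W a b - W' a b = 0"
    proof (rule regression_unique[of "{..<p}" "\<lambda>b. W a b - W' a b"])
      fix k assume "k < p"
      then show "cv p S (\<lambda>b. W a b - W' a b) k = 0"
        using assms(3,4)[of a k] True by (simp add: cv_diff) (simp add: cv_def)
    qed (use True in auto)
    then show ?thesis by simp
  qed
qed

text \<open>Cut off outside the index range because the description in \<open>mat_inv\<close> asks
  for a \<open>supported\<close> matrix.\<close>

definition prec :: "(nat \<Rightarrow> nat \<Rightarrow> real) \<Rightarrow> (nat \<Rightarrow> real) \<Rightarrow> nat \<Rightarrow> nat \<Rightarrow> real" where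
  "prec B D = (\<lambda>a b. if a < p \<and> b < p then (\<Sum>k<p. resid B k a * (1 / D k) * resid B k b) else 0)"

lemma prec_left_inverse:
  assumes "a < p" "c < p"
  shows "(\<Sum>b<p. prec B D a b * S b c) = (\<Sum>k<p. resid B k a * (cv p S (resid B k) c / D k))"
proof -
  have "(\<Sum>b<p. prec B D a b * S b c) = (\<Sum>b<p. \<Sum>k<p. resid B k a * (1 / D k) * resid B k b * S b c)"
    using assms by (simp add: prec_def sum_distrib_right)
  also have "\<dots> = (\<Sum>k<p. \<Sum>b<p. resid B k a * (1 / D k) * resid B k b * S b c)"
    by (rule sum.swap)
  also have "\<dots> = (\<Sum>k<p. resid B k a * (cv p S (resid B k) c / D k))"
    unfolding cv_def by (simp add: sum_distrib_left sum_divide_distrib mult_ac)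
  finally show ?thesis .
qed

text \<open>The description in \<open>mat_inv\<close> is met by the product built from the
  factorization for the identity ranking.\<close>

lemma mat_inv_props: "supported p (mat_inv p S)"
  "\<And>i j. i < p \<Longrightarrow> j < p \<Longrightarrow> (\<Sum>k<p. mat_inv p S i k * S k j) = (if i = j then 1 else 0)"
proof -
  obtain B D where sem: "sem id B D" using sem_exists[of id] by auto
  let ?P = "\<lambda>W. supported p W \<and> (\<forall>i<p. \<forall>j<p. (\<Sum>k<p. W i k * S k j) = (if i = j then 1 else 0))"
  have "?P (prec B D)"
    using semD(5)[OF sem] by (auto simp: prec_left_inverse unit_def supported_def) (simp_all add: prec_def)
  then have "\<exists>!W. ?P W"
    by (intro ex1I) (assumption, rule left_inverse_unique, auto)
  then have "?P (mat_inv p S)" unfolding mat_inv_def by (rule theI')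
  then show "supported p (mat_inv p S)"
    "\<And>i j. i < p \<Longrightarrow> j < p \<Longrightarrow> (\<Sum>k<p. mat_inv p S i k * S k j) = (if i = j then 1 else 0)"
    by auto
qed

lemma mat_inv_sem:
  assumes "sem r B D"
  shows "mat_inv p S = prec B D"
proof (rule left_inverse_unique)
  show "supported p (prec B D)" by (simp add: supported_def prec_def)
  show "(\<Sum>k<p. prec B D i k * S k j) = (if i = j then 1 else 0)" if "i < p" "j < p" for i j
    using semD(5)[OF assms that] that by (simp add: prec_left_inverse unit_def)
qed (use mat_inv_props in auto)

text \<open>Here the factorization alone has to give back the orthogonality that characterizes
  regressions. The residual columns are independent, so an expansion in them, obtained from the left
  inverse, can be compared coefficient by coefficient.\<close>

lemma sem_of_ldl:
  assumes pi: "\<pi> permutes {..<p}" and ldl: "ldl_factor p S \<pi> L"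
  shows "\<exists>D. sem (inv \<pi>) (permute_mat (inv \<pi>) L) D"
proof -
  define B where "B = permute_mat (inv \<pi>) L"
  define r where "r = inv \<pi>"
  have r_perm: "r permutes {..<p}" unfolding r_def using pi by (rule permutes_inv)
  have r_lt: "r a < p \<longleftrightarrow> a < p" for a using permutes_in_image[OF r_perm, of a] by simp
  have pi_lt: "\<pi> a < p \<longleftrightarrow> a < p" for a using permutes_in_image[OF pi, of a] by simp
  have r_pi: "r (\<pi> a) = a" "\<pi> (r a) = a" for a
    using permutes_inverses[OF pi] by (auto simp: r_def)
  have inj_r: "r a = r b \<longleftrightarrow> a = b" for a b using r_pi by metis
  obtain E where E: "\<And>k. k < p \<Longrightarrow> E k > 0"
    "\<And>i j. i < p \<Longrightarrow> j < p \<Longrightarrow> permute_mat \<pi> (mat_inv p S) i j =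
       (\<Sum>k<p. ((if i = k then 1 else 0) - L i k) * (1 / E k) * ((if j = k then 1 else 0) - L j k))"
    using ldl unfolding ldl_factor_def by blast
  define D where "D k = E (r k)" for k
  have Dpos: "D k > 0" if "k < p" for k using E(1) r_lt that by (simp add: D_def)
  have sup: "supported p B"
    using ldl r_lt unfolding ldl_factor_def supported_def B_def permute_mat_def r_def[symmetric]
    by (metis not_le)
  have ord: "r b < r a" if "B a b \<noteq> 0" for a b
    using ldl that unfolding ldl_factor_def B_def permute_mat_def r_def[symmetric] by (metis not_le)
  have W: "mat_inv p S a b = prec B D a b" if "a < p" "b < p" for a b
  proof -
    have "mat_inv p S a b = permute_mat \<pi> (mat_inv p S) (r a) (r b)"
      by (simp add: permute_mat_def r_pi)
    also have "\<dots> = (\<Sum>k<p. ((if r a = k then 1 else 0) - L (r a) k) * (1 / E k) * ((if r b = k then 1 else 0) - L (r b) k))"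
      using that r_lt by (intro E(2)) auto
    also have "\<dots> = (\<Sum>k<p. resid B k a * (1 / D k) * resid B k b)"
      by (rule sum.reindex_bij_witness[of _ r \<pi>])
         (auto simp: r_pi r_lt pi_lt resid_def unit_def B_def permute_mat_def D_def r_def[symmetric])
    finally show ?thesis using that by (simp add: prec_def)
  qed
  have inv: "(\<Sum>k<p. resid B k a * (cv p S (resid B k) c / D k)) = unit c a" if "a < p" "c < p" for a c
  proof -
    have "(\<Sum>k<p. resid B k a * (cv p S (resid B k) c / D k)) = (\<Sum>b<p. mat_inv p S a b * S b c)"
      using that by (subst prec_left_inverse[symmetric]) (auto simp: W)
    then show ?thesis using mat_inv_props(2)[OF that] by (simp add: unit_def)
  qed
  have diag: "resid B k k = 1" for k
    using ord[of k k] by (auto simp: resid_def)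
  have tri: "resid B k a = 0" if "r a < r k" for k a
    using ord[of a k] that by (cases "a = k") (auto simp: resid_def)
  \<comment> \<open>Unit triangularity: in the equation for coordinate k only variables of rank at
    most that of k occur, and those of smaller rank already have coefficient zero.\<close>
  have indep: "c k = 0" if c: "\<And>a. a < p \<Longrightarrow> (\<Sum>k<p. c k * resid B k a) = 0" and k: "k < p" for c k
    using k
  proof (induction "r k" arbitrary: k rule: less_induct)
    case less
    have "0 = (\<Sum>m<p. c m * resid B m k)" using c less.prems by simp
    also have "\<dots> = (\<Sum>m<p. c k * unit k m)"
    proof (intro sum.cong refl)
      fix m assume m: "m \<in> {..<p}"
      consider "m = k" | "r m < r k" | "r k < r m" using inj_r by (metis linorder_neqE_nat)
      then show "c m * resid B m k = c k * unit k m"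
        by cases (use diag less.hyps[of m] tri m in \<open>auto simp: unit_def\<close>)
    qed
    also have "\<dots> = c k" using less.prems by simp
    finally show ?case by simp
  qed
  \<comment> \<open>By \<open>inv\<close>, residual column m is the combination of all residual
    columns with coefficients ip / D; by independence only the coefficient at m is nonzero, and it
    is 1.\<close>
  have ip_orth: "ip p S (resid B k) (resid B m) = D k * unit m k" if km: "k < p" "m < p" for k m
  proof -
    have "ip p S (resid B k) (resid B m) / D k - unit m k = 0"
    proof (rule indep[of "\<lambda>k. ip p S (resid B k) (resid B m) / D k - unit m k"])
      fix a assume a: "a < p"
      have "(\<Sum>k<p. ip p S (resid B k) (resid B m) / D k * resid B k a)
          = (\<Sum>k<p. \<Sum>c<p. resid B m c * (resid B k a * (cv p S (resid B k) c / D k)))"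
        by (simp add: ip_cv sum_divide_distrib sum_distrib_left mult_ac)
      also have "\<dots> = (\<Sum>c<p. resid B m c * unit c a)"
        by (subst sum.swap, intro sum.cong refl, subst sum_distrib_left[symmetric], subst inv)
          (use a in auto)
      also have "\<dots> = (\<Sum>c<p. resid B m c * unit a c)"
        by (intro sum.cong refl) (auto simp: unit_def)
      also have "\<dots> = resid B m a" using a by simp
      finally show "(\<Sum>k<p. (ip p S (resid B k) (resid B m) / D k - unit m k) * resid B k a) = 0"
        using that by (simp add: left_diff_distrib sum_subtractf)
    qed (use km in simp)
    then show ?thesis using Dpos[OF km(1)] by (simp add: field_simps)
  qed
  \<comment> \<open>Again from the highest rank downwards: the residual part of the unit vector is
    removed by \<open>ip_orth\<close>, its parents by the induction hypothesis.\<close>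
  have orth: "cv p S (resid B b) a = 0" if ab: "b < p" "a < p" "r b < r a" for a b
    using ab(2,3)
  proof (induction "p - r a" arbitrary: a rule: less_induct)
    case less
    have dec: "unit a i = resid B a i + (\<Sum>d<p. B d a * unit d i)" if "i < p" for i
      using that by (simp add: resid_def unit_def if_distrib[of "\<lambda>x. _ * x"] cong: if_cong)
    have "cv p S (resid B b) a = ip p S (resid B b) (unit a)" using less.prems by (simp add: ip_unit)
    also have "\<dots> = ip p S (resid B b) (\<lambda>i. resid B a i + (\<Sum>d<p. B d a * unit d i))"
      by (intro ip_cong dec refl)
    also have "\<dots> = ip p S (resid B b) (resid B a) + ip p S (resid B b) (\<lambda>d. B d a)"
      unfolding ip_add_right
      by (intro arg_cong2[where f = "(+)"] refl ip_cong) (auto simp: unit_def if_distrib[of "\<lambda>x. _ * x"] cong: if_cong)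
    also have "\<dots> = (\<Sum>d<p. cv p S (resid B b) d * B d a)"
      using less.prems ab(1) ip_orth[of b a] by (cases "a = b") (auto simp: ip_cv)
    also have "\<dots> = 0"
    proof (intro sum.neutral ballI)
      fix d assume d: "d \<in> {..<p}"
      show "cv p S (resid B b) d * B d a = 0"
      proof (cases "B d a = 0")
        case False
        then have "r a < r d" by (rule ord)
        then show ?thesis using less.hyps[of d] less.prems r_lt[of d] d by auto
      qed simp
    qed
    finally show ?case .
  qed
  have "sem r B D" unfolding sem_def using sup ord Dpos orth inv by blast
  then show ?thesis unfolding r_def B_def by blast
qed

lemma ldl_of_sem:
  assumes pi: "\<pi> permutes {..<p}" and sem: "sem (inv \<pi>) B D"
  shows "ldl_factor p S \<pi> (permute_mat \<pi> B)"
proof -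
  have pi_lt: "\<pi> a < p \<longleftrightarrow> a < p" for a using permutes_in_image[OF pi, of a] by simp
  have r_lt: "inv \<pi> a < p \<longleftrightarrow> a < p" for a using permutes_in_image[OF permutes_inv[OF pi], of a] by simp
  have r_pi [simp]: "inv \<pi> (\<pi> a) = a" "\<pi> (inv \<pi> a) = a" for a
    using permutes_inverses[OF pi] by auto
  have inj: "\<pi> a = \<pi> b \<longleftrightarrow> a = b" for a b using r_pi by metis
  have "permute_mat \<pi> (mat_inv p S) i j = (\<Sum>k<p. ((if i = k then 1 else 0) - permute_mat \<pi> B i k)
       * (1 / D (\<pi> k)) * ((if j = k then 1 else 0) - permute_mat \<pi> B j k))" if "i < p" "j < p" for i j
  proof -
    have "permute_mat \<pi> (mat_inv p S) i j = (\<Sum>k<p. resid B k (\<pi> i) * (1 / D k) * resid B k (\<pi> j))"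
      using mat_inv_sem[OF sem] that by (simp add: permute_mat_def prec_def pi_lt)
    also have "\<dots> = (\<Sum>k<p. resid B (\<pi> k) (\<pi> i) * (1 / D (\<pi> k)) * resid B (\<pi> k) (\<pi> j))"
      by (rule sum.reindex_bij_witness[of _ \<pi> "inv \<pi>"]) (auto simp: pi_lt r_lt)
    finally show ?thesis by (simp add: resid_def unit_def permute_mat_def inj)
  qed
  moreover have "B (\<pi> i) (\<pi> j) = 0" if "i \<le> j" for i j
    using semD(2)[OF sem] that by (metis leD r_pi(1))
  ultimately show ?thesis
    using semD(1,3)[OF sem] pi_lt[unfolded not_le[symmetric]] unfolding ldl_factor_def supported_def
    by (intro conjI exI[of _ "\<lambda>k. D (\<pi> k)"]) (auto simp: permute_mat_def not_le[symmetric])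
qed

text \<open>The one place where the description of L inside \<open>Btilde\<close> is opened:
  existence comes from regressions, uniqueness from turning any factor back into
  regressions.\<close>

lemma Btilde_sem:
  assumes pi: "\<pi> permutes {..<p}"
  shows "\<exists>D. sem (inv \<pi>) (Btilde p S \<pi>) D"
proof -
  have r_lt: "inv \<pi> a < p \<longleftrightarrow> a < p" for a using permutes_in_image[OF permutes_inv[OF pi], of a] by simp
  have r_pi: "inv \<pi> (\<pi> a) = a" "\<pi> (inv \<pi> a) = a" for a
    using permutes_inverses[OF pi] by auto
  have "inj_on (inv \<pi>) {..<p}" using r_pi by (metis inj_on_inverseI)
  then obtain B D where sem: "sem (inv \<pi>) B D"
    using sem_exists[of "inv \<pi>"] r_lt by auto
  have "ldl_factor p S \<pi> (THE L. ldl_factor p S \<pi> L)"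
  proof (rule theI'[of "ldl_factor p S \<pi>"])
    show "\<exists>!L. ldl_factor p S \<pi> L"
    proof (rule ex1I)
      show "ldl_factor p S \<pi> (permute_mat \<pi> B)" by (rule ldl_of_sem[OF pi sem])
      fix L assume "ldl_factor p S \<pi> L"
      from sem_of_ldl[OF pi this] have "permute_mat (inv \<pi>) L = B" using sem_unique[OF _ sem] by blast
      then show "L = permute_mat \<pi> B" by (auto simp: permute_mat_def r_pi)
    qed
  qed
  then show ?thesis unfolding Btilde_def by (rule sem_of_ldl[OF pi])
qed

text \<open>Coordinate a of v is the covariance of v with row a of the inverse, so Cauchy-Schwarz
  bounds it by the variance of v; no eigenvalues or compactness enter. The summand 1 in K keeps it
  positive when p = 0.\<close>

lemma coercive: "\<exists>\<kappa>>0. \<forall>v. ip p S v v \<ge> \<kappa> * (\<Sum>i<p. (v i)\<^sup>2)"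
proof -
  define W where "W = mat_inv p S"
  define K where "K = 1 + (\<Sum>a<p. ip p S (W a) (W a))"
  have K: "K > 0" unfolding K_def by (intro add_pos_nonneg sum_nonneg ip_nonneg) auto
  have "(1 / K) * (\<Sum>i<p. (v i)\<^sup>2) \<le> ip p S v v" for v
  proof -
    have "(v a)\<^sup>2 \<le> ip p S (W a) (W a) * ip p S v v" if "a < p" for a
    proof -
      have "ip p S (W a) v = (\<Sum>k<p. unit a k * v k)"
        unfolding ip_cv using mat_inv_props(2)[OF that] by (simp add: cv_def W_def unit_def eq_commute)
      then have "ip p S (W a) v = v a" using that by simp
      then show ?thesis using Cauchy_Schwarz[of "W a" v] by simp
    qed
    then have "(\<Sum>i<p. (v i)\<^sup>2) \<le> (\<Sum>i<p. ip p S (W i) (W i) * ip p S v v)"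
      by (intro sum_mono) auto
    also have "\<dots> \<le> K * ip p S v v"
      unfolding K_def sum_distrib_right[symmetric] using ip_nonneg[of v] by (intro mult_right_mono) auto
    finally show ?thesis using K by (simp add: field_simps)
  qed
  then show ?thesis using K by (intro exI[of _ "1 / K"]) auto
qed

end

section \<open>Separation by walks\<close>

definition walk :: "(nat \<times> nat) set \<Rightarrow> nat list \<Rightarrow> bool" where
  "walk G vs \<longleftrightarrow> vs \<noteq> [] \<and>
     (\<forall>m. Suc m < length vs \<longrightarrow> (vs ! m, vs ! Suc m) \<in> G \<or> (vs ! Suc m, vs ! m) \<in> G)"

lemma trail_iff_walk: "trail G vs \<longleftrightarrow> walk G vs \<and> distinct vs"
  by (auto simp: trail_def walk_def)

lemma unblockedD:
  assumes "\<not> blocked G S vs" "0 < m" "Suc m < length vs"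
  shows "collider G vs m \<Longrightarrow> G\<^sup>* `` {vs ! m} \<inter> S \<noteq> {}" "\<not> collider G vs m \<Longrightarrow> vs ! m \<notin> S"
  using assms unfolding blocked_def by metis+

lemma acyclic_asym: "acyclic G \<Longrightarrow> (u, v) \<in> G \<Longrightarrow> (v, u) \<notin> G"
  by (meson acyclic_def r_into_trancl trancl_into_trancl)

text \<open>An unblocked walk that leaves a vertex along an arrow cannot turn round: the first
  turning point would be a collider all of whose descendants are descendants of that vertex, hence
  outside S.\<close>

lemma walk_descend:
  assumes w: "walk G vs" and nb: "\<not> blocked G S vs" and fwd: "(vs ! a, vs ! Suc a) \<in> G"
    and k: "Suc a \<le> k" "k < length vs" and ns: "G\<^sup>* `` {vs ! a} \<inter> S = {}"
  shows "(vs ! a, vs ! k) \<in> G\<^sup>+ \<and> (vs ! (k - 1), vs ! k) \<in> G"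
  using k
proof (induction k rule: dec_induct)
  case base
  then show ?case using fwd by auto
next
  case (step k)
  then have IH: "(vs ! a, vs ! k) \<in> G\<^sup>+" "(vs ! (k - 1), vs ! k) \<in> G" by auto
  have "\<not> collider G vs k"
  proof
    assume "collider G vs k"
    then have "G\<^sup>* `` {vs ! k} \<inter> S \<noteq> {}" using unblockedD(1)[OF nb, of k] step by auto
    then show False using ns IH(1) by (auto dest!: trancl_into_rtrancl dest: rtrancl_trans)
  qed
  then have "(vs ! Suc k, vs ! k) \<notin> G" using IH(2) by (simp add: collider_def)
  then have "(vs ! k, vs ! Suc k) \<in> G" using w step by (auto simp: walk_def)
  then show ?case using IH(1) by auto
qed

text \<open>Cutting a loop changes the status of the junction only. If the junction is no collider
  afterwards, it was none at one of its two old positions and hence is outside S.\<close>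

lemma walk_shortcut:
  assumes acyc: "acyclic G" and w: "walk G vs" and nb: "\<not> blocked G S vs"
    and ab: "a < b" "b < length vs" "vs ! a = vs ! b"
  defines "vs' \<equiv> take (Suc a) vs @ drop (Suc b) vs"
  shows "walk G vs'" "\<not> blocked G S vs'" "hd vs' = hd vs" "last vs' = last vs" "length vs' < length vs"
proof -
  define s where "s = b - a"
  have len: "length vs' = length vs - s" using ab by (auto simp: vs'_def s_def)
  have lo: "vs' ! m = vs ! m" if "m \<le> a" for m
    using that ab by (simp add: vs'_def nth_append)
  \<comment> \<open>The shift is valid at m = a too, because positions a and b carry the same
    vertex; so the edges at the junction are covered.\<close>
  have hi: "vs' ! m = vs ! (m + s)" if "a \<le> m" "m < length vs'" for m
  proof (cases "m = a")
    case True
    then show ?thesis using lo[of a] ab by (simp add: s_def)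
  next
    case False
    then have "vs' ! m = drop (Suc b) vs ! (m - Suc a)"
      using that ab by (simp add: vs'_def nth_append min_def)
    also have "\<dots> = vs ! (Suc b + (m - Suc a))" using that ab by (intro nth_drop) auto
    also have "Suc b + (m - Suc a) = m + s" using that ab False by (simp add: s_def)
    finally show ?thesis .
  qed
  show "length vs' < length vs" using ab by (simp add: len s_def)
  show "hd vs' = hd vs" using ab by (cases vs) (auto simp: vs'_def)
  show "last vs' = last vs"
  proof (cases "Suc b < length vs")
    case True
    then show ?thesis by (simp add: vs'_def)
  next
    case False
    then have "Suc b = length vs" using ab by simp
    then have "last vs = vs ! b" using ab by (metis diff_Suc_1 last_conv_nth length_greater_0_conv zero_less_Suc)
    moreover have "last vs' = vs ! a" using ab \<open>Suc b = length vs\<close>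
      by (simp add: vs'_def take_Suc_conv_app_nth)
    ultimately show ?thesis using ab by simp
  qed
  show "walk G vs'"
    unfolding walk_def
  proof (intro conjI allI impI)
    show "vs' \<noteq> []" using ab by (auto simp: vs'_def)
    fix m assume m: "Suc m < length vs'"
    show "(vs' ! m, vs' ! Suc m) \<in> G \<or> (vs' ! Suc m, vs' ! m) \<in> G"
    proof (cases "m < a")
      case True
      then show ?thesis using w m lo[of m] lo[of "Suc m"] by (simp add: walk_def len)
    next
      case False
      then show ?thesis using w m hi[of m] hi[of "Suc m"] by (simp add: walk_def len)
    qed
  qed
  have mid: "if collider G vs' m then G\<^sup>* `` {vs' ! m} \<inter> S \<noteq> {} else vs' ! m \<notin> S"
    if m: "0 < m" "Suc m < length vs'" for m
  proof -
    consider "m < a" | "m = a" | "a < m" by linarith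
    then show ?thesis
    proof cases
      case 1
      then have "collider G vs' m = collider G vs m" using lo m by (simp add: collider_def)
      then show ?thesis using unblockedD[OF nb, of m] m lo[of m] 1 by (auto simp: len)
    next
      case 3
      then have eq: "vs' ! (m - 1) = vs ! (m + s - 1)" "vs' ! m = vs ! (m + s)" "vs' ! Suc m = vs ! Suc (m + s)"
        using hi[of "m - 1"] hi[of m] hi[of "Suc m"] m by auto
      then have "collider G vs' m = collider G vs (m + s)" by (simp add: collider_def)
      then show ?thesis using unblockedD[OF nb, of "m + s"] m eq by (auto simp: len)
    next
      case 2
      define x where "x = vs ! a"
      have b: "Suc b < length vs" using 2 m ab by (auto simp: len s_def)
      have x: "vs' ! m = x" "vs ! b = x" using 2 lo ab by (auto simp: x_def)
      have prev: "vs' ! (m - 1) = vs ! (a - 1)" using 2 lo by simp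
      have "Suc a + s = Suc b" using ab by (simp add: s_def)
      then have nxt: "vs' ! Suc m = vs ! Suc b" using hi[of "Suc a"] 2 m by simp
      have old_a: "collider G vs a \<Longrightarrow> G\<^sup>* `` {x} \<inter> S \<noteq> {}" "\<not> collider G vs a \<Longrightarrow> x \<notin> S"
        using unblockedD[OF nb, of a] 2 m b ab by (auto simp: x_def)
      have old_b: "\<not> collider G vs b \<Longrightarrow> x \<notin> S"
        using unblockedD[OF nb, of b] b ab x by auto
      show ?thesis
      proof (cases "collider G vs' m")
        case False
        then have "(vs ! (a - 1), x) \<notin> G \<or> (vs ! Suc b, x) \<notin> G"
          using x prev nxt by (simp add: collider_def)
        then have "\<not> collider G vs a \<or> \<not> collider G vs b" using x by (auto simp: collider_def x_def)
        then show ?thesis using False old_a old_b x by auto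
      next
        \<comment> \<open>The junction has become a collider. Either it was one at position a
          already, or the loop starts along an arrow leaving x; if then no descendant of x were in
          S, the loop would be a directed cycle.\<close>
        case True
        then have into: "(vs ! (a - 1), x) \<in> G" using x prev by (simp add: collider_def)
        have "G\<^sup>* `` {x} \<inter> S \<noteq> {}"
        proof (cases "(vs ! Suc a, x) \<in> G")
          case True
          then show ?thesis using into old_a(1) by (simp add: collider_def x_def)
        next
          case False
          moreover have "Suc a < length vs" using ab by simp
          ultimately have fwd: "(vs ! a, vs ! Suc a) \<in> G" using w unfolding walk_def x_def by blast
          show ?thesis
          proof
            assume "G\<^sup>* `` {x} \<inter> S = {}"
            then have "(vs ! a, vs ! b) \<in> G\<^sup>+"
              using walk_descend[OF w nb fwd, of b] ab by (simp add: x_def)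
            then show False using acyc ab by (simp add: acyclic_def)
          qed
        qed
        then show ?thesis using True x by simp
      qed
    qed
  qed
  show "\<not> blocked G S vs'"
  proof
    assume "blocked G S vs'"
    then obtain m where m: "0 < m" "Suc m < length vs'"
      "if collider G vs' m then G\<^sup>* `` {vs' ! m} \<inter> S = {} else vs' ! m \<in> S"
      unfolding blocked_def by blast
    then show False using mid[OF m(1,2)] by (auto split: if_splits)
  qed
qed

text \<open>Needed because \<open>d_separated\<close> speaks about trails only, while concatenating
  edges gives walks.\<close>

lemma unblocked_walk_imp_trail:
  assumes "acyclic G" "walk G vs" "\<not> blocked G S vs"
  shows "\<exists>us. trail G us \<and> hd us = hd vs \<and> last us = last vs \<and> \<not> blocked G S us"
  using assms(2,3)
proof (induction "length vs" arbitrary: vs rule: less_induct)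
  case less
  show ?case
  proof (cases "distinct vs")
    case True
    then show ?thesis using less.prems by (auto simp: trail_iff_walk)
  next
    case False
    then obtain a b where "a < b" "b < length vs" "vs ! a = vs ! b"
      unfolding distinct_conv_nth by (metis linorder_neqE_nat)
    note sc = walk_shortcut[OF assms(1) less.prems this]
    show ?thesis using less.hyps[OF sc(5,1,2)] sc(3,4) by auto
  qed
qed

lemma walk_snoc:
  assumes w: "walk G vs" and nb: "\<not> blocked G S vs"
    and adj: "(last vs, v) \<in> G \<or> (v, last vs) \<in> G"
    and mid: "1 < length vs \<Longrightarrow>
      if (vs ! (length vs - 2), last vs) \<in> G \<and> (v, last vs) \<in> G then G\<^sup>* `` {last vs} \<inter> S \<noteq> {} else last vs \<notin> S"
  shows "walk G (vs @ [v])" "\<not> blocked G S (vs @ [v])"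
proof -
  have ne: "vs \<noteq> []" using w by (simp add: walk_def)
  have lst: "last vs = vs ! (length vs - 1)" using ne by (rule last_conv_nth)
  show "walk G (vs @ [v])"
    unfolding walk_def
  proof (intro conjI allI impI)
    fix m assume m: "Suc m < length (vs @ [v])"
    show "((vs @ [v]) ! m, (vs @ [v]) ! Suc m) \<in> G \<or> ((vs @ [v]) ! Suc m, (vs @ [v]) ! m) \<in> G"
    proof (cases "Suc m < length vs")
      case True
      then show ?thesis using w by (simp add: walk_def nth_append)
    next
      case False
      then have "m = length vs - 1" "Suc m = length vs" using m by auto
      then show ?thesis using adj lst ne by (simp add: nth_append)
    qed
  qed simp
  show "\<not> blocked G S (vs @ [v])"
  proof
    assume "blocked G S (vs @ [v])"
    then obtain m where m: "0 < m" "Suc m < length (vs @ [v])"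
      and bl: "if collider G (vs @ [v]) m then G\<^sup>* `` {(vs @ [v]) ! m} \<inter> S = {} else (vs @ [v]) ! m \<in> S"
      unfolding blocked_def by blast
    show False
    proof (cases "Suc m < length vs")
      case True
      then have "collider G (vs @ [v]) m = collider G vs m" "(vs @ [v]) ! m = vs ! m"
        by (auto simp: collider_def nth_append)
      then show False using bl unblockedD[OF nb m(1) True] by (auto split: if_splits)
    next
      case False
      then have l: "Suc m = length vs" using m by simp
      then have "(vs @ [v]) ! m = last vs" "(vs @ [v]) ! (m - 1) = vs ! (length vs - 2)" "(vs @ [v]) ! Suc m = v"
        using lst m by (auto simp: nth_append l[symmetric] numeral_2_eq_2)
      then show False using bl mid l m(1) by (auto simp: collider_def split: if_splits)
    qed
  qed
qed

text \<open>The closure rules of the Bayes ball. Colliders are opened by membership in S only: a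
  collider with a proper descendant in S is handled by a walk that runs down to S and back up, which
  is admissible since walks may repeat vertices.\<close>

definition barrier :: "(nat \<times> nat) set \<Rightarrow> nat \<Rightarrow> nat set \<Rightarrow> nat set \<Rightarrow> nat set \<Rightarrow> bool" where
  "barrier G i S Y Z \<longleftrightarrow> i \<in> Z \<and> Y \<inter> S = {} \<and>
     (\<forall>k v. k \<in> Y \<longrightarrow> (k, v) \<in> G \<longrightarrow> v \<notin> S \<longrightarrow> v \<in> Y) \<and>
     (\<forall>k v. k \<in> Y \<longrightarrow> (k, v) \<in> G \<longrightarrow> v \<in> S \<longrightarrow> v \<in> Z) \<and>
     (\<forall>v. v \<in> Z \<longrightarrow> v \<notin> S \<longrightarrow> v \<in> Y) \<and>
     (\<forall>c v. c \<in> Z \<longrightarrow> (v, c) \<in> G \<longrightarrow> v \<notin> S \<longrightarrow> v \<in> Z)"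

lemma barrierD:
  assumes "barrier G i S Y Z"
  shows "i \<in> Z" "Y \<inter> S = {}"
    "k \<in> Y \<Longrightarrow> (k, v) \<in> G \<Longrightarrow> v \<notin> S \<Longrightarrow> v \<in> Y"
    "k \<in> Y \<Longrightarrow> (k, v) \<in> G \<Longrightarrow> v \<in> S \<Longrightarrow> v \<in> Z"
    "v \<in> Z \<Longrightarrow> v \<notin> S \<Longrightarrow> v \<in> Y"
    "c \<in> Z \<Longrightarrow> (v, c) \<in> G \<Longrightarrow> v \<notin> S \<Longrightarrow> v \<in> Z"
  using assms unfolding barrier_def by metis+

text \<open>\<open>Y\<close> is the set of vertices reached by unblocked walks from \<open>i\<close>, and \<open>Z\<close> collects
  those vertices from which such a walk may continue to a parent.\<close>

lemma d_separated_barrier: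
  assumes acyc: "acyclic G" and i: "i \<notin> S" and ds: "d_separated G i j S"
  shows "\<exists>Y Z. barrier G i S Y Z \<and> j \<notin> Y"
proof -
  define C where "C vs v \<longleftrightarrow> walk G vs \<and> \<not> blocked G S vs \<and> hd vs = i \<and> last vs = v" for vs v
  define Y where "Y = {v. v \<notin> S \<and> (\<exists>vs. C vs v)}"
  define Z where "Z = {v. v = i \<or> (\<exists>vs. C vs v \<and> 1 < length vs \<and>
      (if v \<in> S then (vs ! (length vs - 2), v) \<in> G else (v, vs ! (length vs - 2)) \<in> G))}"
  have Ci: "C [i] i" by (simp add: C_def walk_def blocked_def)
  have C_ne: "vs \<noteq> []" if "C vs v" for vs v using that by (auto simp: C_def walk_def)
  have ext: "C (vs @ [v]) v" if "C vs k" "(k, v) \<in> G \<or> (v, k) \<in> G"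
    "1 < length vs \<Longrightarrow> if (vs ! (length vs - 2), k) \<in> G \<and> (v, k) \<in> G then G\<^sup>* `` {k} \<inter> S \<noteq> {} else k \<notin> S"
    for vs k v
    using that walk_snoc[of G vs S v] C_ne[OF that(1)] by (auto simp: C_def)
  have last2: "(vs @ [v]) ! (length (vs @ [v]) - 2) = k" "1 < length (vs @ [v])" if "C vs k" for vs v k
    using C_ne[OF that] that by (auto simp: C_def nth_append last_conv_nth neq_Nil_conv)
  have step_Y: "\<exists>vs. C vs v \<and> 1 < length vs \<and> vs ! (length vs - 2) = k" if kY: "k \<in> Y" and kv: "(k, v) \<in> G" for k v
  proof -
    from kY obtain vs where vs: "C vs k" "k \<notin> S" by (auto simp: Y_def)
    have "C (vs @ [v]) v"
      using vs kv acyclic_asym[OF acyc kv] by (intro ext) auto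
    then show ?thesis using last2[OF vs(1)] by blast
  qed
  have "barrier G i S Y Z"
    unfolding barrier_def
  proof (intro conjI allI impI)
    show "i \<in> Z" by (simp add: Z_def)
    show "Y \<inter> S = {}" by (auto simp: Y_def)
    show "v \<in> Y" if "k \<in> Y" "(k, v) \<in> G" "v \<notin> S" for k v
      using step_Y[OF that(1,2)] that(3) by (auto simp: Y_def)
    show "v \<in> Z" if "k \<in> Y" "(k, v) \<in> G" "v \<in> S" for k v
      using step_Y[OF that(1,2)] that(2,3) by (auto simp: Z_def)
    show "v \<in> Y" if "v \<in> Z" "v \<notin> S" for v
      using that Ci by (auto simp: Z_def Y_def)
    show "v \<in> Z" if cZ: "c \<in> Z" and vc: "(v, c) \<in> G" and v: "v \<notin> S" for c v
    proof -
      \<comment> \<open>If c lies in S, it was entered from a parent and is a collider opened by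
        itself. Otherwise it is the start, or it was entered from a child and by asymmetry is no
        collider.\<close>
      have "\<exists>vs. C vs c \<and> (1 < length vs \<longrightarrow>
         (if (vs ! (length vs - 2), c) \<in> G \<and> (v, c) \<in> G then G\<^sup>* `` {c} \<inter> S \<noteq> {} else c \<notin> S))"
      proof (cases "c = i")
        case True
        then show ?thesis using Ci by (intro exI[of _ "[i]"]) auto
      next
        case False
        then obtain vs where vs: "C vs c" "if c \<in> S then (vs ! (length vs - 2), c) \<in> G else (c, vs ! (length vs - 2)) \<in> G"
          using cZ by (auto simp: Z_def)
        show ?thesis
        proof (cases "c \<in> S")
          case True
          then show ?thesis using vs vc by (intro exI[of _ vs]) auto
        next
          case False
          then show ?thesis using vs acyclic_asym[OF acyc] by (intro exI[of _ vs]) auto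
        qed
      qed
      then obtain vs where vs: "C vs c" "C (vs @ [v]) v" using ext vc by blast
      then show ?thesis using last2[OF vs(1)] vc v unfolding Z_def by auto
    qed
  qed
  moreover have "j \<notin> Y"
  proof
    assume "j \<in> Y"
    then obtain vs where "C vs j" by (auto simp: Y_def)
    then obtain us where "trail G us" "hd us = i" "last us = j" "\<not> blocked G S us"
      using unblocked_walk_imp_trail[OF acyc] by (metis C_def)
    then show False using ds by (auto simp: d_separated_def)
  qed
  ultimately show ?thesis by blast
qed

text \<open>The local Markov property in graph form. A walk leaving i through a parent is blocked
  there; one leaving through a child would, if unblocked, be directed all the way to j by
  \<open>walk_descend\<close>.\<close>

lemma d_separated_by_parents:
  assumes acyc: "acyclic G" and par: "\<And>k. (k, i) \<in> G \<Longrightarrow> k \<in> S"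
    and desc: "G\<^sup>* `` {i} \<inter> S = {}" and j: "(i, j) \<notin> G\<^sup>*" "j \<notin> S"
  shows "d_separated G i j S"
  unfolding d_separated_def
proof (intro allI impI)
  fix vs assume "trail G vs \<and> hd vs = i \<and> last vs = j"
  then have w: "walk G vs" and ne: "vs \<noteq> []" and hd: "vs ! 0 = i" and lst: "vs ! (length vs - 1) = j"
    by (auto simp: trail_iff_walk walk_def hd_conv_nth last_conv_nth)
  have "i \<noteq> j" using j by auto
  then have len: "1 < length vs" using hd lst ne by (cases "length vs = 1") (auto simp: neq_Nil_conv)
  then consider "(i, vs ! 1) \<in> G" | "(vs ! 1, i) \<in> G" using w hd by (auto simp: walk_def)
  then show "blocked G S vs"
  proof cases
    case 1
    show ?thesis
    proof (rule ccontr)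
      assume "\<not> blocked G S vs"
      from walk_descend[OF w this, of 0 "length vs - 1"] have "(i, j) \<in> G\<^sup>+"
        using 1 len hd lst desc by auto
      then show False using j by (simp add: trancl_into_rtrancl)
    qed
  next
    case 2
    then have S1: "vs ! 1 \<in> S" by (rule par)
    then have "length vs \<noteq> 2" using lst j by auto
    then have "Suc 1 < length vs" using len by simp
    moreover have "\<not> collider G vs 1" using acyclic_asym[OF acyc 2] hd by (simp add: collider_def)
    ultimately show ?thesis unfolding blocked_def using S1 by (intro exI[of _ 1]) auto
  qed
qed

section \<open>Global Markov property\<close>

text \<open>Adjointness of I - B and its transpose, the pairing behind the energy argument.\<close>

lemma sum_swap_transpose:
  fixes y z :: "nat \<Rightarrow> real"
  shows "(\<Sum>v<p. y v * (z v - (\<Sum>k<p. B v k * z k))) = (\<Sum>k<p. z k * (y k - (\<Sum>v<p. B v k * y v)))"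
proof -
  have "(\<Sum>v<p. y v * (\<Sum>k<p. B v k * z k)) = (\<Sum>v<p. \<Sum>k<p. z k * (B v k * y v))"
    by (simp add: sum_distrib_left mult_ac)
  also have "\<dots> = (\<Sum>k<p. z k * (\<Sum>v<p. B v k * y v))"
    by (subst sum.swap) (simp add: sum_distrib_left)
  finally show ?thesis by (simp add: right_diff_distrib sum_subtractf mult.commute)
qed

context pd_mat
begin

text \<open>The equations over T are the normal equations, making b the regression of i on T; the
  equation for j is the vanishing of the partial covariance of i and j given T.\<close>

definition partial_uncorr :: "nat \<Rightarrow> nat \<Rightarrow> nat set \<Rightarrow> bool" where
  "partial_uncorr i j T \<longleftrightarrow> (\<exists>b. (\<forall>k. k \<notin> T \<longrightarrow> b k = 0) \<and> (\<forall>k\<in>insert j T. cv p S (\<lambda>a. unit i a - b a) k = 0))"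

lemma sem_acyclic:
  assumes "sem r B D"
  shows "acyclic (graph_of p B)"
  by (rule acyclicI_order[of _ r]) (use semD(2)[OF assms] in \<open>auto simp: graph_of_def\<close>)

text \<open>Writing \<open>e\<close> for the residual of variable \<open>i\<close> on \<open>T\<close>, put \<open>y = \<Sigma>e\<close> and \<open>z = D\<^sup>-\<^sup>1(I-B)\<^sup>Ty\<close>, so that
  \<open>e = (I-B)z\<close>. Pairing \<open>e\<close> with \<open>y\<close> restricted to the complement of \<open>Y\<close> gives zero, and on the other
  hand the sum of \<open>D z\<^sup>2\<close> over the complement of \<open>Y \<union> Z\<close>; hence \<open>y\<close> vanishes off \<open>Y\<close>.\<close>

theorem d_separated_imp_partial_uncorr:
  assumes sem: "sem r B D" and r_lt: "\<And>a. a < p \<Longrightarrow> r a < p"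
    and ij: "i < p" "j < p" "i \<noteq> j" and T: "T \<subseteq> {..<p} - {i, j}"
    and ds: "d_separated (graph_of p B) i j T"
  shows "partial_uncorr i j T"
proof -
  define G where "G = graph_of p B"
  have G: "(a, b) \<in> G \<longleftrightarrow> a < p \<and> b < p \<and> B a b \<noteq> 0" for a b by (simp add: G_def graph_of_def)
  have "finite T" "T \<subseteq> {..<p}" "i \<notin> T" using T finite_subset[of T "{..<p}"] by auto
  obtain b where b: "\<And>k. k \<notin> T \<Longrightarrow> b k = 0" "\<And>k. k \<in> T \<Longrightarrow> cv p S b k = cv p S (unit i) k"
    using regression_exists[OF \<open>finite T\<close> \<open>T \<subseteq> {..<p}\<close>, of "unit i"] by blast
  obtain Y Z where br: "barrier G i T Y Z" and "j \<notin> Y"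
    using d_separated_barrier[OF sem_acyclic[OF sem] \<open>i \<notin> T\<close> ds] unfolding G_def by blast
  note YZ = barrierD(1,2)[OF br] \<open>j \<notin> Y\<close>
    and YY = barrierD(3)[OF br] and YZ' = barrierD(4)[OF br]
    and ZY = barrierD(5)[OF br] and ZZ = barrierD(6)[OF br]
  define e where "e = (\<lambda>a. unit i a - b a)"
  define y where "y k = cv p S e k" for k
  define z where "z k = ip p S e (resid B k) / D k" for k
  have z_alt: "z k = ip p S (resid B k) e / D k" for k
    using ip_commute[of e "resid B k"] by (simp add: z_def)
  have yT: "y k = 0" if "k \<in> T" for k using b(2)[OF that] by (simp add: y_def e_def cv_diff)
  have e0: "e a = 0" if "a \<notin> T" "a \<noteq> i" for a using b(1) that by (simp add: e_def)
  have z_eq: "D k * z k = y k - (\<Sum>c<p. B c k * y c)" if "k < p" for k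
  proof -
    have "D k * z k = ip p S e (resid B k)" using semD(3)[OF sem that] by (simp add: z_def)
    also have "\<dots> = ip p S e (unit k) - ip p S e (\<lambda>a. B a k)" unfolding resid_def by (rule ip_diff_right)
    also have "\<dots> = y k - (\<Sum>c<p. B c k * y c)" using that by (simp add: ip_unit y_def ip_cv mult.commute)
    finally show ?thesis .
  qed
  \<comment> \<open>The inverse formula in \<open>sem\<close> expands e in the residual columns,
    with coefficients z.\<close>
  have e_eq: "e a = z a - (\<Sum>k<p. B a k * z k)" if a: "a < p" for a
  proof -
    have "e a = (\<Sum>c<p. (\<Sum>k<p. resid B k a * (cv p S (resid B k) c / D k)) * e c)"
      using semD(5)[OF sem a] a by (simp add: unit_def if_distrib[of "\<lambda>x. x * _"] cong: if_cong)
    also have "\<dots> = (\<Sum>c<p. \<Sum>k<p. resid B k a * (cv p S (resid B k) c / D k) * e c)"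
      by (simp add: sum_distrib_right)
    also have "\<dots> = (\<Sum>k<p. \<Sum>c<p. resid B k a * (cv p S (resid B k) c / D k) * e c)"
      by (rule sum.swap)
    also have "\<dots> = (\<Sum>k<p. resid B k a * z k)"
      by (simp add: z_alt ip_cv sum_divide_distrib sum_distrib_left mult_ac)
    also have "\<dots> = (\<Sum>k<p. unit a k * z k) - (\<Sum>k<p. B a k * z k)"
      unfolding sum_subtractf[symmetric]
      by (intro sum.cong refl) (auto simp: resid_def unit_def algebra_simps)
    finally show ?thesis using a by simp
  qed
  \<comment> \<open>Induction towards children, which have smaller rank. At such a c the vector e
    vanishes, so z at c is a combination over its children. No child is in Z, as c would then be in
    Z, and so none is in T; hence all are in Y and outside Z.\<close>
  have zY: "z c = 0" if "c \<in> Y" "c \<notin> Z" "c < p" for c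
    using that
  proof (induction "r c" arbitrary: c rule: less_induct)
    case less
    have c: "c \<notin> T" "c \<noteq> i" using less.prems YZ by auto
    have "(\<Sum>k<p. B c k * z k) = 0"
    proof (intro sum.neutral ballI)
      fix k assume k: "k \<in> {..<p}"
      show "B c k * z k = 0"
      proof (cases "B c k = 0")
        case False
        then have ck: "(c, k) \<in> G" using less.prems k by (simp add: G)
        have "k \<notin> Z" using ZZ[OF _ ck c(1)] less.prems by auto
        then have "k \<in> Y" using YY[OF less.prems(1) ck] YZ'[OF less.prems(1) ck] by auto
        then show ?thesis using less.hyps[of k] semD(2)[OF sem False] \<open>k \<notin> Z\<close> k by auto
      qed simp
    qed
    then show ?case using e_eq[of c] e0[of c] c less.prems by simp
  qed
  define y' where "y' v = (if v \<in> Y then 0 else y v)" for v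
  \<comment> \<open>The vector e lives on T and i. On T the covariance y is zero, and i belongs to
    Y, where y' is zero.\<close>
  have "(\<Sum>v<p. y' v * e v) = 0"
  proof (intro sum.neutral ballI)
    fix v
    show "y' v * e v = 0"
      using yT e0[of v] ZY[of v] YZ(1) by (cases "v \<in> Y"; cases "v \<in> T"; cases "v = i") (auto simp: y'_def)
  qed
  then have "(\<Sum>v<p. y' v * (z v - (\<Sum>k<p. B v k * z k))) = 0" by (simp add: e_eq)
  then have sum0: "(\<Sum>k<p. z k * (y' k - (\<Sum>v<p. B v k * y' v))) = 0"
    by (simp only: sum_swap_transpose[where y = y' and z = z and B = B])
  \<comment> \<open>On Z both y' and its values at parents vanish; on the rest of Y the factor z
    vanishes; elsewhere no parent is in Y, so y' may be replaced by y and a square appears.\<close>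
  have summand: "z k * (y' k - (\<Sum>v<p. B v k * y' v)) = (if k \<in> Y \<union> Z then 0 else D k * (z k)\<^sup>2)" if k: "k < p" for k
  proof -
    consider "k \<in> Z" | "k \<in> Y" "k \<notin> Z" | "k \<notin> Y \<union> Z" by blast
    then show ?thesis
    proof cases
      case 1
      have "y' k = 0" using ZY[OF 1] yT by (cases "k \<in> T") (auto simp: y'_def)
      moreover have "(\<Sum>v<p. B v k * y' v) = 0"
      proof (intro sum.neutral ballI)
        fix v assume v: "v \<in> {..<p}"
        show "B v k * y' v = 0"
        proof (cases "B v k = 0")
          case False
          then have "(v, k) \<in> G" using v k by (simp add: G)
          then have "v \<in> T \<or> v \<in> Y" using ZZ[OF 1] ZY by blast
          then show ?thesis using yT by (auto simp: y'_def)
        qed simp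
      qed
      ultimately show ?thesis using 1 by simp
    next
      case 2
      then show ?thesis using zY k by simp
    next
      case 3
      have "(\<Sum>v<p. B v k * y' v) = (\<Sum>v<p. B v k * y v)"
      proof (intro sum.cong refl)
        fix v assume v: "v \<in> {..<p}"
        show "B v k * y' v = B v k * y v"
        proof (cases "B v k = 0")
          case False
          then have "(v, k) \<in> G" using v k by (simp add: G)
          then have "v \<notin> Y" using YY[of v k] YZ'[of v k] 3 by blast
          then show ?thesis by (simp add: y'_def)
        qed simp
      qed
      moreover have "y' k = y k" using 3 by (simp add: y'_def)
      ultimately show ?thesis using z_eq[OF k] 3 by (simp add: power2_eq_square mult_ac)
    qed
  qed
  have z0: "z k = 0" if k: "k < p" "k \<notin> Y" "k \<notin> Z" for k
  proof -
    have "(\<Sum>k<p. if k \<in> Y \<union> Z then 0 else D k * (z k)\<^sup>2) = 0"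
      using sum0 by (simp add: summand)
    moreover have "(if k \<in> Y \<union> Z then 0 else D k * (z k)\<^sup>2) \<ge> 0" if "k \<in> {..<p}" for k
      using that semD(3)[OF sem, of k] by simp
    ultimately have "(if k \<in> Y \<union> Z then 0 else D k * (z k)\<^sup>2) = 0"
      using k(1) by (subst (asm) sum_nonneg_eq_0_iff) auto
    then show ?thesis using k semD(3)[OF sem, of k] by simp
  qed
  \<comment> \<open>From the highest rank downwards: off Y and T both z and the contributions of the
    parents vanish, since a parent in Y would put its child into Y.\<close>
  have y0: "y v = 0" if "v \<notin> Y" "v < p" for v
    using that
  proof (induction "p - r v" arbitrary: v rule: less_induct)
    case less
    show ?case
    proof (cases "v \<in> T")
      case False
      then have "v \<notin> Z" using ZY less.prems by blast
      then have "z v = 0" using z0 less.prems by blast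
      moreover have "(\<Sum>c<p. B c v * y c) = 0"
      proof (intro sum.neutral ballI)
        fix c assume c: "c \<in> {..<p}"
        show "B c v * y c = 0"
        proof (cases "B c v = 0")
          case nz: False
          then have "(c, v) \<in> G" using c less.prems by (simp add: G)
          then have "c \<notin> Y" using YY less.prems False by blast
          moreover have "p - r c < p - r v" using semD(2)[OF sem nz] r_lt[of c] c by auto
          ultimately show ?thesis using less.hyps[of c] c by auto
        qed simp
      qed
      ultimately show ?thesis using z_eq[of v] less.prems by simp
    qed (simp add: yT)
  qed
  have "cv p S e k = 0" if "k \<in> insert j T" for k
    using that yT y0[of j] YZ(3) ij by (auto simp: y_def)
  then show ?thesis unfolding partial_uncorr_def e_def using b(1) by blast
qed

end

section \<open>Fourier analysis of conditional expectations\<close>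

lemmas L1_cong = Bochner_Integration.integral_cong
  and L1_bound = Bochner_Integration.integrable_bound
  and L1_diff = Bochner_Integration.integral_diff

context prob_space
begin

text \<open>Divided by their common mass, which the frequency 0 reveals, g and h are probability
  densities under which V has the same characteristic function; Levy uniqueness applies. Mass zero
  is separate because it cannot be normalized.\<close>

lemma fourier_unique_densities:
  fixes g h V :: "'a \<Rightarrow> real"
  assumes [measurable]: "V \<in> borel_measurable M" and g: "integrable M g" "\<And>w. g w \<ge> 0"
    and h: "integrable M h" "\<And>w. h w \<ge> 0"
    and eq: "\<And>t. (\<integral>w. g w *\<^sub>R iexp (t * V w) \<partial>M) = (\<integral>w. h w *\<^sub>R iexp (t * V w) \<partial>M)"
    and [measurable]: "B \<in> sets borel"
  shows "(\<integral>w. g w * indicator B (V w) \<partial>M) = (\<integral>w. h w * indicator B (V w) \<partial>M)"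
proof -
  have [measurable]: "g \<in> borel_measurable M" "h \<in> borel_measurable M" using g h by auto
  define m where "m = (\<integral>w. g w \<partial>M)"
  have "complex_of_real m = complex_of_real (\<integral>w. h w \<partial>M)"
    using eq[of 0] unfolding m_def by (simp add: scaleR_conv_of_real)
  then have m: "(\<integral>w. h w \<partial>M) = m" by simp
  have "m \<ge> 0" unfolding m_def using g by simp
  show ?thesis
  proof (cases "m = 0")
    case True
    then have "AE w in M. g w = 0" "AE w in M. h w = 0"
      using integral_nonneg_eq_0_iff_AE[OF g(1)] integral_nonneg_eq_0_iff_AE[OF h(1)] g h m m_def by auto
    then have "(\<integral>w. g w * indicator B (V w) \<partial>M) = (\<integral>w. 0 \<partial>M)" "(\<integral>w. h w * indicator B (V w) \<partial>M) = (\<integral>w. 0 \<partial>M)"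
      by (intro integral_cong_AE; auto)+
    then show ?thesis by simp
  next
    case False
    then have mpos: "m > 0" using \<open>m \<ge> 0\<close> by simp
    have dist: "real_distribution (distr (density M (\<lambda>w. ennreal (f w / m))) borel V) \<and>
        char (distr (density M (\<lambda>w. ennreal (f w / m))) borel V) = (\<lambda>t. (1 / m) *\<^sub>R (\<integral>w. f w *\<^sub>R iexp (t * V w) \<partial>M)) \<and>
        measure (distr (density M (\<lambda>w. ennreal (f w / m))) borel V) B = (\<integral>w. f w * indicator B (V w) \<partial>M) / m"
      if f: "integrable M f" "\<And>w. f w \<ge> 0" "(\<integral>w. f w \<partial>M) = m" for f
    proof -
      have [measurable]: "f \<in> borel_measurable M" using f by auto
      let ?N = "density M (\<lambda>w. ennreal (f w / m))"
      have "emeasure ?N (space ?N) = (\<integral>\<^sup>+w. ennreal (f w / m) \<partial>M)"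
        by (simp add: emeasure_density cong: nn_integral_cong)
      also have "\<dots> = ennreal (\<integral>w. f w / m \<partial>M)"
        using f mpos by (intro nn_integral_eq_integral) auto
      also have "\<dots> = 1" using f mpos by simp
      finally interpret N: prob_space ?N by (rule prob_spaceI)
      have V: "V \<in> borel_measurable ?N" by simp
      have rd: "real_distribution (distr ?N borel V)" using V by (rule N.real_distribution_distr)
      have "char (distr ?N borel V) t = (1 / m) *\<^sub>R (\<integral>w. f w *\<^sub>R iexp (t * V w) \<partial>M)" for t
      proof -
        have "char (distr ?N borel V) t = (\<integral>w. iexp (t * V w) \<partial>?N)"
          unfolding char_def by (subst integral_distr) auto
        also have "\<dots> = (\<integral>w. (f w / m) *\<^sub>R iexp (t * V w) \<partial>M)"
          using f mpos by (subst integral_density) auto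
        also have "\<dots> = (\<integral>w. (1 / m) *\<^sub>R (f w *\<^sub>R iexp (t * V w)) \<partial>M)"
          by simp
        also have "\<dots> = (1 / m) *\<^sub>R (\<integral>w. f w *\<^sub>R iexp (t * V w) \<partial>M)"
          by (rule integral_scaleR_right)
        finally show ?thesis .
      qed
      moreover have "measure (distr ?N borel V) B = (\<integral>w. f w * indicator B (V w) \<partial>M) / m"
      proof -
        have "measure (distr ?N borel V) B = (\<integral>x. indicator B x \<partial>distr ?N borel V)" by simp
        also have "\<dots> = (\<integral>w. indicator B (V w) \<partial>?N)" by (subst integral_distr) auto
        also have "\<dots> = (\<integral>w. (f w / m) *\<^sub>R indicator B (V w) \<partial>M)"
          using f mpos by (subst integral_density) auto
        also have "\<dots> = (\<integral>w. (f w * indicator B (V w)) / m \<partial>M)" by simp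
        also have "\<dots> = (\<integral>w. f w * indicator B (V w) \<partial>M) / m" by (rule integral_divide_zero)
        finally show ?thesis .
      qed
      ultimately show ?thesis using rd by auto
    qed
    note dg = dist[OF g m_def[symmetric]] and dh = dist[OF h m]
    have "distr (density M (\<lambda>w. ennreal (g w / m))) borel V = distr (density M (\<lambda>w. ennreal (h w / m))) borel V"
      using dg dh eq by (intro Levy_uniqueness) auto
    then show ?thesis using dg dh mpos by simp
  qed
qed

lemma integrable_mult_iexp:
  fixes f :: "'a \<Rightarrow> complex"
  assumes f: "integrable M f" and [measurable]: "V \<in> borel_measurable M"
  shows "integrable M (\<lambda>w. f w * iexp (V w))"
proof (rule L1_bound[OF f])
  have [measurable]: "f \<in> borel_measurable M" using f by auto
  show "(\<lambda>w. f w * iexp (V w)) \<in> borel_measurable M" by measurable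
qed (simp add: norm_mult)

lemma integrable_mult_indicator':
  fixes f :: "'a \<Rightarrow> 'b :: {banach, second_countable_topology, real_normed_algebra_1}"
  assumes f: "integrable M f" and [measurable]: "V \<in> borel_measurable M" "B \<in> sets borel"
  shows "integrable M (\<lambda>w. f w * of_real (indicator B (V w :: real)))"
proof (rule L1_bound[OF f])
  have [measurable]: "f \<in> borel_measurable M" using f by auto
  show "(\<lambda>w. f w * of_real (indicator B (V w))) \<in> borel_measurable M" by measurable
qed (auto simp: indicator_def)

text \<open>Conjugation only reverses the frequency, so the hypothesis passes to real and imaginary
  parts; positive and negative parts of these are nonnegative densities.\<close>

lemma fourier_orth_one:
  fixes f :: "'a \<Rightarrow> complex" and V :: "'a \<Rightarrow> real"
  assumes f: "integrable M f" and V [measurable]: "V \<in> borel_measurable M"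
    and eq: "\<And>t. (\<integral>w. f w * iexp (t * V w) \<partial>M) = 0" and [measurable]: "B \<in> sets borel"
  shows "(\<integral>w. f w * of_real (indicator B (V w)) \<partial>M) = 0"
proof -
  have [measurable]: "f \<in> borel_measurable M" using f by auto
  have eqc: "(\<integral>w. cnj (f w) * iexp (t * V w) \<partial>M) = 0" for t
  proof -
    have "(\<integral>w. cnj (f w) * iexp (t * V w) \<partial>M) = (\<integral>w. cnj (f w * iexp ((- t) * V w)) \<partial>M)"
      by (simp add: exp_cnj)
    also have "\<dots> = cnj (\<integral>w. f w * iexp ((- t) * V w) \<partial>M)"
      by (rule Bochner_Integration.integral_cnj)
    finally show ?thesis using eq[of "- t"] by simp
  qed
  have int: "integrable M (\<lambda>w. f w * iexp (t * V w))" "integrable M (\<lambda>w. cnj (f w) * iexp (t * V w))" for t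
    using integrable_mult_iexp[of f "\<lambda>w. t * V w"] integrable_mult_iexp[of "\<lambda>w. cnj (f w)" "\<lambda>w. t * V w"] f
    by simp_all
  have *: "(\<integral>w. g w * indicator B (V w) \<partial>M) = 0"
    if g: "integrable M g" and g0: "\<And>t. (\<integral>w. g w *\<^sub>R iexp (t * V w) \<partial>M) = 0" for g
  proof -
    let ?p = "\<lambda>w. max (g w) 0" and ?n = "\<lambda>w. max (- g w) 0"
    have i: "integrable M ?p" "integrable M ?n" using g by auto
    have ic: "integrable M (\<lambda>w. h w *\<^sub>R iexp (t * V w))" if "integrable M h" for h t
      using integrable_mult_iexp[of "\<lambda>w. complex_of_real (h w)" "\<lambda>w. t * V w"] that
      by (simp add: scaleR_conv_of_real)
    have "(\<integral>w. ?p w *\<^sub>R iexp (t * V w) \<partial>M) = (\<integral>w. ?n w *\<^sub>R iexp (t * V w) \<partial>M)" for t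
    proof -
      have "(\<integral>w. ?p w *\<^sub>R iexp (t * V w) \<partial>M) - (\<integral>w. ?n w *\<^sub>R iexp (t * V w) \<partial>M)
          = (\<integral>w. ?p w *\<^sub>R iexp (t * V w) - ?n w *\<^sub>R iexp (t * V w) \<partial>M)"
        using i by (intro L1_diff[symmetric] ic)
      also have "\<dots> = (\<integral>w. g w *\<^sub>R iexp (t * V w) \<partial>M)"
        by (intro L1_cong refl) (auto simp: max_def scaleR_left_diff_distrib[symmetric])
      finally show ?thesis using g0 by simp
    qed
    from fourier_unique_densities[OF V i(1) _ i(2) _ this, of B]
    have "(\<integral>w. ?p w * indicator B (V w) \<partial>M) = (\<integral>w. ?n w * indicator B (V w) \<partial>M)" by simp
    moreover have "(\<integral>w. ?p w * indicator B (V w) \<partial>M) - (\<integral>w. ?n w * indicator B (V w) \<partial>M)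
        = (\<integral>w. ?p w * indicator B (V w) - ?n w * indicator B (V w) \<partial>M)"
      using i integrable_mult_indicator'[of ?p V B] integrable_mult_indicator'[of ?n V B]
      by (intro L1_diff[symmetric]) auto
    moreover have "\<dots> = (\<integral>w. g w * indicator B (V w) \<partial>M)"
      by (intro L1_cong refl) (auto simp: max_def)
    ultimately show ?thesis by simp
  qed
  have re: "(\<integral>w. Re (f w) * indicator B (V w) \<partial>M) = 0"
  proof (rule *)
    show "integrable M (\<lambda>w. Re (f w))" using f by simp
    fix t
    have "(\<integral>w. Re (f w) *\<^sub>R iexp (t * V w) \<partial>M) = (\<integral>w. (f w * iexp (t * V w) + cnj (f w) * iexp (t * V w)) / 2 \<partial>M)"
      by (intro L1_cong refl) (simp add: distrib_right[symmetric] complex_add_cnj scaleR_conv_of_real)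
    then show "(\<integral>w. Re (f w) *\<^sub>R iexp (t * V w) \<partial>M) = 0"
      using int eq eqc by simp
  qed
  have im: "(\<integral>w. Im (f w) * indicator B (V w) \<partial>M) = 0"
  proof (rule *)
    show "integrable M (\<lambda>w. Im (f w))" using f by simp
    fix t
    have "(\<integral>w. Im (f w) *\<^sub>R iexp (t * V w) \<partial>M) = (\<integral>w. (f w * iexp (t * V w) - cnj (f w) * iexp (t * V w)) / (2 * \<i>) \<partial>M)"
    proof (intro L1_cong refl)
      fix w
      have "(f w - cnj (f w)) / (2 * \<i>) = of_real (Im (f w))"
        by (simp add: complex_diff_cnj) (simp add: complex_eq_iff)
      then show "Im (f w) *\<^sub>R iexp (t * V w) = (f w * iexp (t * V w) - cnj (f w) * iexp (t * V w)) / (2 * \<i>)"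
        by (metis left_diff_distrib scaleR_conv_of_real times_divide_eq_left)
    qed
    then show "(\<integral>w. Im (f w) *\<^sub>R iexp (t * V w) \<partial>M) = 0"
      using int eq eqc by simp
  qed
  have "integrable M (\<lambda>w. f w * of_real (indicator B (V w)))" using f by (intro integrable_mult_indicator') auto
  then show ?thesis
    using re im integral_Re[of M "\<lambda>w. f w * of_real (indicator B (V w))"] integral_Im[of M "\<lambda>w. f w * of_real (indicator B (V w))"]
    by (simp add: complex_eq_iff)
qed

lemma fourier_orth_rectangles:
  fixes f :: "'a \<Rightarrow> complex" and V :: "'i \<Rightarrow> 'a \<Rightarrow> real"
  assumes "finite K" "integrable M f" "\<And>k. k \<in> K \<Longrightarrow> V k \<in> borel_measurable M"
    and "\<And>t. (\<integral>w. f w * iexp (\<Sum>k\<in>K. t k * V k w) \<partial>M) = 0" and "\<And>k. k \<in> K \<Longrightarrow> B k \<in> sets borel"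
  shows "(\<integral>w. f w * of_real (\<Prod>k\<in>K. indicator (B k) (V k w)) \<partial>M) = 0"
  using assms
proof (induction K arbitrary: f rule: finite_induct)
  case empty
  then show ?case by simp
next
  case (insert k K)
  have [measurable]: "V k \<in> borel_measurable M" "B k \<in> sets borel" using insert.prems by auto
  have [measurable]: "f \<in> borel_measurable M" using insert.prems by auto
  have V: "V l \<in> borel_measurable M" if "l \<in> K" for l using insert.prems that by auto
  have P [measurable]: "(\<lambda>w. \<Prod>l\<in>K. indicator (B l) (V l w) :: real) \<in> borel_measurable M"
    using V insert.prems by (intro borel_measurable_prod) auto
  have fP: "integrable M (\<lambda>w. f w * of_real (\<Prod>l\<in>K. indicator (B l) (V l w)))"
  proof (rule L1_bound[OF insert.prems(1)])
    show "(\<lambda>w. f w * of_real (\<Prod>l\<in>K. indicator (B l) (V l w))) \<in> borel_measurable M" by measurable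
    have "\<bar>\<Prod>l\<in>K. indicator (B l) (V l w) :: real\<bar> \<le> 1" for w
      by (simp add: abs_prod indicator_def prod_le_1)
    then show "AE w in M. norm (f w * of_real (\<Prod>l\<in>K. indicator (B l) (V l w))) \<le> norm (f w)"
      by (simp add: norm_mult mult_left_le del: of_real_prod)
  qed
  \<comment> \<open>The exponential in the new coordinate is absorbed into f, so the induction
    hypothesis holds at each frequency s; the one-variable lemma then trades s for an
    indicator.\<close>
  have step: "(\<integral>w. (f w * iexp (s * V k w)) * of_real (\<Prod>l\<in>K. indicator (B l) (V l w)) \<partial>M) = 0" for s
  proof (rule insert.IH)
    show "integrable M (\<lambda>w. f w * iexp (s * V k w))"
      using insert.prems integrable_mult_iexp[of f "\<lambda>w. s * V k w"] by simp
    fix t :: "'i \<Rightarrow> real"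
    have "(\<integral>w. f w * iexp (s * V k w) * iexp (\<Sum>l\<in>K. t l * V l w) \<partial>M)
        = (\<integral>w. f w * iexp (\<Sum>l\<in>insert k K. (t(k := s)) l * V l w) \<partial>M)"
    proof (intro L1_cong refl)
      fix w
      have "(\<Sum>l\<in>insert k K. (t(k := s)) l * V l w) = s * V k w + (\<Sum>l\<in>K. (t(k := s)) l * V l w)"
        using insert.hyps by (subst sum.insert) auto
      also have "(\<Sum>l\<in>K. (t(k := s)) l * V l w) = (\<Sum>l\<in>K. t l * V l w)"
        using insert.hyps by (intro sum.cong refl) auto
      finally show "f w * iexp (s * V k w) * iexp (\<Sum>l\<in>K. t l * V l w)
          = f w * iexp (\<Sum>l\<in>insert k K. (t(k := s)) l * V l w)"
        by (simp only: of_real_add distrib_left exp_add mult.assoc)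
    qed
    then show "(\<integral>w. f w * iexp (s * V k w) * iexp (\<Sum>l\<in>K. t l * V l w) \<partial>M) = 0"
      using insert.prems(3) by simp
  qed (use insert.prems in auto)
  have "(\<integral>w. (f w * of_real (\<Prod>l\<in>K. indicator (B l) (V l w))) * of_real (indicator (B k) (V k w)) \<partial>M) = 0"
    by (rule fourier_orth_one[OF fP]) (use step in \<open>auto simp: mult_ac\<close>)
  then show ?case using insert.hyps by (simp add: mult_ac)
qed

end

section \<open>Orthogonality to the sigma-algebra of a subvector\<close>

definition sigY :: "'a measure \<Rightarrow> ('a \<Rightarrow> nat \<Rightarrow> real) \<Rightarrow> nat set \<Rightarrow> 'a measure" where
  "sigY M Y T = vimage_algebra (space M) (\<lambda>w. restrict (Y w) T) (PiM T (\<lambda>_. borel))"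

text \<open>States through test functions that the conditional expectation of a complex f given F
  vanishes. Asking only for an integrable product admits unbounded tests such as the
  coordinates.\<close>

definition orth_to :: "'a measure \<Rightarrow> 'a measure \<Rightarrow> ('a \<Rightarrow> complex) \<Rightarrow> bool" where
  "orth_to M F f \<longleftrightarrow> (\<forall>\<phi> :: 'a \<Rightarrow> complex. \<phi> \<in> borel_measurable F \<longrightarrow> integrable M (\<lambda>w. f w * \<phi> w) \<longrightarrow>
     (\<integral>w. f w * \<phi> w \<partial>M) = 0)"

lemma orth_toD: "orth_to M F f \<Longrightarrow> \<phi> \<in> borel_measurable F \<Longrightarrow> integrable M (\<lambda>w. f w * \<phi> w) \<Longrightarrow> (\<integral>w. f w * \<phi> w \<partial>M) = 0"
  by (simp add: orth_to_def)

context prob_space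
begin

lemma restrict_measurable:
  assumes "\<And>k. k \<in> T \<Longrightarrow> (\<lambda>w. Y w k) \<in> borel_measurable M"
  shows "(\<lambda>w. restrict (Y w) T) \<in> measurable M (PiM T (\<lambda>_. borel :: real measure))"
  using assms by (intro measurable_restrict) auto

lemma sigY_subalgebra:
  assumes "\<And>k. k \<in> T \<Longrightarrow> (\<lambda>w. Y w k) \<in> borel_measurable M"
  shows "subalgebra M (sigY M Y T)"
proof -
  have "{(\<lambda>w. restrict (Y w) T) -` A \<inter> space M |A. A \<in> sets (Pi\<^sub>M T (\<lambda>_. borel))} \<subseteq> sets M"
    using measurable_sets[OF restrict_measurable[of T Y, OF assms]] by auto
  then have "sets (sigY M Y T) \<subseteq> sets M"
    unfolding sigY_def sets_vimage_algebra by (rule sets.sigma_sets_subset)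
  then show ?thesis by (simp add: subalgebra_def sigY_def)
qed

lemma measurable_sigY:
  assumes "k \<in> T"
  shows "(\<lambda>w. Y w k) \<in> borel_measurable (sigY M Y T)"
proof -
  have "(\<lambda>w. restrict (Y w) T) \<in> measurable (sigY M Y T) (PiM T (\<lambda>_. borel))"
    unfolding sigY_def by (rule measurable_vimage_algebra1) (auto simp: space_PiM)
  from measurable_compose[OF this measurable_component_singleton[OF assms]]
  show ?thesis using assms by (simp add: restrict_def)
qed

text \<open>Testing on sets of F forces the conditional expectation of g to vanish, and an
  F-measurable factor moves past it.\<close>

lemma orth_to_real:
  assumes F: "subalgebra M F" and g: "integrable M g"
    and C: "\<And>C. C \<in> sets F \<Longrightarrow> (\<integral>w. indicator C w * g w \<partial>M) = 0"
    and \<phi>: "\<phi> \<in> borel_measurable F" "integrable M (\<lambda>w. \<phi> w * g w)"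
  shows "(\<integral>w. \<phi> w * g w \<partial>M) = (0::real)"
proof -
  interpret sigma_finite_subalgebra M F
    by (rule finite_measure_subalgebra_is_sigma_finite, unfold_locales) (rule F)
  have "AE w in M. real_cond_exp M F g w = 0"
    by (rule real_cond_exp_charact) (use g C in \<open>auto simp: set_lebesgue_integral_def\<close>)
  moreover have "(\<integral>w. \<phi> w * g w \<partial>M) = (\<integral>w. \<phi> w * real_cond_exp M F g w \<partial>M)"
    using real_cond_exp_intg(2)[OF \<phi>(2,1)] g by auto
  moreover have "(\<integral>w. \<phi> w * real_cond_exp M F g w \<partial>M) = (\<integral>w. 0 \<partial>M)"
    using calculation(1) measurable_from_subalg[OF F \<phi>(1)] by (intro integral_cong_AE) auto
  ultimately show ?thesis by simp
qed

lemma orth_to_I: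
  fixes f :: "'a \<Rightarrow> complex"
  assumes F: "subalgebra M F" and f: "integrable M f"
    and C: "\<And>C. C \<in> sets F \<Longrightarrow> (\<integral>w. f w * of_real (indicator C w) \<partial>M) = 0"
  shows "orth_to M F f"
  unfolding orth_to_def
proof (intro allI impI)
  fix \<phi> :: "'a \<Rightarrow> complex" assume \<phi> [measurable]: "\<phi> \<in> borel_measurable F" and int: "integrable M (\<lambda>w. f w * \<phi> w)"
  have [measurable]: "\<phi> \<in> borel_measurable M" by (rule measurable_from_subalg[OF F \<phi>])
  have fm [measurable]: "f \<in> borel_measurable M" using f by auto
  have CM: "C \<in> sets M" if "C \<in> sets F" for C using that F by (auto simp: subalgebra_def)
  have intC: "integrable M (\<lambda>w. f w * of_real (indicator C w))" if C: "C \<in> sets F" for C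
  proof (rule L1_bound[OF f])
    have [measurable]: "C \<in> sets M" by (rule CM[OF C])
    show "(\<lambda>w. f w * of_real (indicator C w)) \<in> borel_measurable M" by measurable
  qed (auto simp: indicator_def)
  have re: "(\<integral>w. indicator C w * Re (f w) \<partial>M) = 0" and im: "(\<integral>w. indicator C w * Im (f w) \<partial>M) = 0" if "C \<in> sets F" for C
    using C[OF that] integral_Re[OF intC[OF that]] integral_Im[OF intC[OF that]] by (simp_all add: mult.commute)
  have z: "(\<integral>w. \<psi> w * u w \<partial>M) = 0" "integrable M (\<lambda>w. \<psi> w * u w)"
    if u: "u = (\<lambda>w. Re (f w)) \<or> u = (\<lambda>w. Im (f w))" and \<psi>: "\<psi> = (\<lambda>w. Re (\<phi> w)) \<or> \<psi> = (\<lambda>w. Im (\<phi> w))"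
    for u \<psi> :: "'a \<Rightarrow> real"
  proof -
    have um: "u \<in> borel_measurable M" "\<psi> \<in> borel_measurable M" "\<psi> \<in> borel_measurable F" using u \<psi> by auto
    show i: "integrable M (\<lambda>w. \<psi> w * u w)"
    proof (rule L1_bound[OF int])
      show "(\<lambda>w. \<psi> w * u w) \<in> borel_measurable M" using um by measurable
      have "\<bar>\<psi> w * u w\<bar> \<le> norm (f w * \<phi> w)" for w
      proof -
        have "\<bar>\<psi> w\<bar> \<le> norm (\<phi> w)" using \<psi> abs_Re_le_cmod abs_Im_le_cmod by auto
        moreover have "\<bar>u w\<bar> \<le> norm (f w)" using u abs_Re_le_cmod abs_Im_le_cmod by auto
        ultimately have "\<bar>\<psi> w\<bar> * \<bar>u w\<bar> \<le> norm (\<phi> w) * norm (f w)" by (intro mult_mono) auto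
        then show ?thesis by (simp add: abs_mult norm_mult mult.commute)
      qed
      then show "AE w in M. norm (\<psi> w * u w) \<le> norm (f w * \<phi> w)" by simp
    qed
    show "(\<integral>w. \<psi> w * u w \<partial>M) = 0"
      using orth_to_real[OF F _ _ um(3) i] u re im f by auto
  qed
  have "(\<integral>w. Re (f w * \<phi> w) \<partial>M) = 0" "(\<integral>w. Im (f w * \<phi> w) \<partial>M) = 0"
    using z[of "\<lambda>w. Re (f w)" "\<lambda>w. Re (\<phi> w)"] z[of "\<lambda>w. Im (f w)" "\<lambda>w. Im (\<phi> w)"]
      z[of "\<lambda>w. Re (f w)" "\<lambda>w. Im (\<phi> w)"] z[of "\<lambda>w. Im (f w)" "\<lambda>w. Re (\<phi> w)"]
    by (simp_all add: mult.commute)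
  then show "(\<integral>w. f w * \<phi> w \<partial>M) = 0"
    using integral_Re[OF int] integral_Im[OF int] by (simp add: complex_eq_iff)
qed

text \<open>The positive and negative parts of g, as densities pushed forward to the product space,
  agree on rectangles and hence as measures; every set of the generated sigma-algebra is a
  preimage.\<close>

lemma fourier_orth_sigY_real:
  fixes g :: "'a \<Rightarrow> real"
  assumes K: "finite K" and Y: "\<And>k. k \<in> K \<Longrightarrow> (\<lambda>w. Y w k) \<in> borel_measurable M"
    and g: "integrable M g"
    and rect: "\<And>B. (\<And>k. k \<in> K \<Longrightarrow> B k \<in> sets borel) \<Longrightarrow> (\<integral>w. g w * (\<Prod>k\<in>K. indicator (B k) (Y w k)) \<partial>M) = 0"
    and C: "C \<in> sets (sigY M Y K)"
  shows "(\<integral>w. g w * indicator C w \<partial>M) = 0"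
proof -
  have gm [measurable]: "g \<in> borel_measurable M" using g by auto
  define R where "R = (\<lambda>w. restrict (Y w) K)"
  have R [measurable]: "R \<in> measurable M (PiM K (\<lambda>_. borel))" unfolding R_def using Y by (rule restrict_measurable)
  let ?p = "\<lambda>w. max (g w) 0" and ?n = "\<lambda>w. max (- g w) 0"
  define N where "N f = distr (density M (\<lambda>w. ennreal (f w))) (PiM K (\<lambda>_. borel :: real measure)) R" for f
  have ind: "integrable M (\<lambda>w. f w * indicator A w)" if "integrable M f" "A \<in> sets M" for f :: "'a \<Rightarrow> real" and A
    using integrable_mult_indicator[OF that(2,1)] by (simp add: mult.commute)
  have N: "emeasure (N f) A = ennreal (\<integral>w. f w * indicator (R -` A \<inter> space M) w \<partial>M)"
    if f: "integrable M f" "\<And>w. f w \<ge> 0" and A: "A \<in> sets (PiM K (\<lambda>_. borel))" for f A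
  proof -
    have [measurable]: "f \<in> borel_measurable M" "A \<in> sets (PiM K (\<lambda>_. borel))" using f A by auto
    have RA: "R -` A \<inter> space M \<in> sets M" by measurable
    have "emeasure (N f) A = emeasure (density M (\<lambda>w. ennreal (f w))) (R -` A \<inter> space M)"
      unfolding N_def using A by (subst emeasure_distr) auto
    also have "\<dots> = (\<integral>\<^sup>+w. ennreal (f w) * indicator (R -` A \<inter> space M) w \<partial>M)"
      using RA by (intro emeasure_density) auto
    also have "\<dots> = (\<integral>\<^sup>+w. ennreal (f w * indicator (R -` A \<inter> space M) w) \<partial>M)"
      by (intro nn_integral_cong) (auto simp: indicator_def)
    also have "\<dots> = ennreal (\<integral>w. f w * indicator (R -` A \<inter> space M) w \<partial>M)"
      using f by (intro nn_integral_eq_integral ind RA) auto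
    finally show ?thesis .
  qed
  have i: "integrable M ?p" "integrable M ?n" using g by auto
  have diff: "(\<integral>w. ?p w * indicator A w \<partial>M) - (\<integral>w. ?n w * indicator A w \<partial>M) = (\<integral>w. g w * indicator A w \<partial>M)"
    if "A \<in> sets M" for A
  proof -
    have "(\<integral>w. ?p w * indicator A w \<partial>M) - (\<integral>w. ?n w * indicator A w \<partial>M)
        = (\<integral>w. ?p w * indicator A w - ?n w * indicator A w \<partial>M)"
      using i that by (intro L1_diff[symmetric] ind)
    also have "\<dots> = (\<integral>w. g w * indicator A w \<partial>M)"
      by (intro L1_cong refl) (auto simp: max_def)
    finally show ?thesis .
  qed
  have "N ?p = N ?n"
  proof (rule measure_eqI_PiM_finite[OF K, where A = "\<lambda>_. space (PiM K (\<lambda>_. borel))"])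
    show "sets (N ?p) = sets (PiM K (\<lambda>_. borel))" "sets (N ?n) = sets (PiM K (\<lambda>_. borel))" by (auto simp: N_def)
    show "range (\<lambda>_::nat. space (PiM K (\<lambda>_. borel :: real measure))) \<subseteq> prod_algebra K (\<lambda>_. borel)"
      using prod_algebraI_finite[OF K, of "\<lambda>_. UNIV" "\<lambda>_. borel :: real measure"] by (auto simp: space_PiM)
    show "(\<Union>i::nat. space (PiM K (\<lambda>_. borel :: real measure))) = space (PiM K (\<lambda>_. borel))" by simp
    show "emeasure (N ?p) (space (PiM K (\<lambda>_. borel))) \<noteq> \<infinity>" using N[OF i(1)] by simp
    fix A :: "nat \<Rightarrow> real set" assume A: "\<And>k. k \<in> K \<Longrightarrow> A k \<in> sets borel"
    have PA: "Pi\<^sub>E K A \<in> sets (PiM K (\<lambda>_. borel))" using K A by (intro sets_PiM_I_finite) auto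
    have RA: "R -` Pi\<^sub>E K A \<inter> space M \<in> sets M" using PA by measurable
    have "(\<integral>w. g w * indicator (R -` Pi\<^sub>E K A \<inter> space M) w \<partial>M) = (\<integral>w. g w * (\<Prod>k\<in>K. indicator (A k) (Y w k)) \<partial>M)"
    proof (intro L1_cong refl)
      fix w assume w: "w \<in> space M"
      show "g w * indicator (R -` Pi\<^sub>E K A \<inter> space M) w = g w * (\<Prod>k\<in>K. indicator (A k) (Y w k))"
      proof (cases "\<forall>k\<in>K. Y w k \<in> A k")
        case True
        then show ?thesis using w by (simp add: R_def indicator_def PiE_def)
      next
        case False
        then have "(\<Prod>k\<in>K. indicator (A k) (Y w k)) = (0::real)" using K by (auto intro!: prod_zero simp: indicator_def)
        then show ?thesis using False by (auto simp: R_def indicator_def PiE_def Pi_def)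
      qed
    qed
    also have "\<dots> = 0" by (rule rect[OF A])
    finally show "emeasure (N ?p) (Pi\<^sub>E K A) = emeasure (N ?n) (Pi\<^sub>E K A)"
      using diff[OF RA] N[OF i(1) _ PA] N[OF i(2) _ PA] by simp
  qed
  from C obtain A where A: "A \<in> sets (PiM K (\<lambda>_. borel))" and CA: "C = R -` A \<inter> space M"
    unfolding sigY_def R_def by (subst (asm) sets_vimage_algebra2) (auto simp: space_PiM)
  have RA: "R -` A \<inter> space M \<in> sets M" using A by measurable
  have "ennreal (\<integral>w. ?p w * indicator C w \<partial>M) = ennreal (\<integral>w. ?n w * indicator C w \<partial>M)"
    using N[OF i(1) _ A] N[OF i(2) _ A] \<open>N ?p = N ?n\<close> CA by simp
  then have "(\<integral>w. ?p w * indicator C w \<partial>M) = (\<integral>w. ?n w * indicator C w \<partial>M)"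
    by (subst (asm) ennreal_inj) (auto intro!: Bochner_Integration.integral_nonneg)
  then show ?thesis using diff[OF RA] CA by simp
qed

text \<open>Reduces statements conditional on a Gaussian subvector to characteristic functions,
  which are explicit.\<close>

lemma fourier_orth_sigY:
  fixes f :: "'a \<Rightarrow> complex"
  assumes K: "finite K" and Y: "\<And>k. k \<in> K \<Longrightarrow> (\<lambda>w. Y w k) \<in> borel_measurable M"
    and f: "integrable M f" and four: "\<And>t. (\<integral>w. f w * iexp (\<Sum>k\<in>K. t k * Y w k) \<partial>M) = 0"
  shows "orth_to M (sigY M Y K) f"
proof (rule orth_to_I[OF sigY_subalgebra[of K Y, OF Y] f])
  have [measurable]: "f \<in> borel_measurable M" using f by auto
  fix C assume C: "C \<in> sets (sigY M Y K)"
  have P: "(\<lambda>w. \<Prod>k\<in>K. indicator (B k) (Y w k) :: real) \<in> borel_measurable M" if "\<And>k. k \<in> K \<Longrightarrow> B k \<in> sets borel" for B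
    using Y that by (intro borel_measurable_prod) (auto intro!: borel_measurable_indicator' simp: measurable_sets)
  have int: "integrable M (\<lambda>w. f w * of_real (h w))" if [measurable]: "h \<in> borel_measurable M" and "\<And>w. \<bar>h w\<bar> \<le> 1" for h :: "'a \<Rightarrow> real"
  proof (rule L1_bound[OF f])
    show "(\<lambda>w. f w * of_real (h w)) \<in> borel_measurable M" by measurable
    show "AE w in M. norm (f w * of_real (h w)) \<le> norm (f w)" using that(2) by (simp add: norm_mult mult_left_le)
  qed
  have intB: "integrable M (\<lambda>w. f w * of_real (\<Prod>k\<in>K. indicator (B k) (Y w k)))" if "\<And>k. k \<in> K \<Longrightarrow> B k \<in> sets borel" for B
    by (intro int P that) (simp_all add: abs_prod indicator_def prod_le_1)
  have z: "(\<integral>w. f w * of_real (\<Prod>k\<in>K. indicator (B k) (Y w k)) \<partial>M) = 0" if "\<And>k. k \<in> K \<Longrightarrow> B k \<in> sets borel" for B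
    by (rule fourier_orth_rectangles[OF K f Y four that])
  have *: "(\<integral>w. u (f w) * indicator C w \<partial>M) = 0" if u: "u = Re \<or> u = Im" for u
  proof (rule fourier_orth_sigY_real[OF K Y _ _ C])
    show "integrable M (\<lambda>w. u (f w))" using f u by auto
    fix B :: "nat \<Rightarrow> real set" assume B: "\<And>k. k \<in> K \<Longrightarrow> B k \<in> sets borel"
    show "(\<integral>w. u (f w) * (\<Prod>k\<in>K. indicator (B k) (Y w k)) \<partial>M) = 0"
      using integral_Re[OF intB[of B, OF B]] integral_Im[OF intB[of B, OF B]] z[of B, OF B] u by (auto simp del: of_real_prod)
  qed
  note *[of Re] *[of Im]
  moreover have "C \<in> sets M" using C sigY_subalgebra[of K Y, OF Y] by (auto simp: subalgebra_def)
  then have "integrable M (\<lambda>w. f w * of_real (indicator C w))" by (intro int) (auto simp: indicator_def)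
  ultimately show "(\<integral>w. f w * of_real (indicator C w) \<partial>M) = 0"
    using integral_Re[of M "\<lambda>w. f w * of_real (indicator C w)"] integral_Im[of M "\<lambda>w. f w * of_real (indicator C w)"]
    by (simp add: complex_eq_iff)
qed


lemma sigY_mono:
  assumes "T \<subseteq> K"
  shows "subalgebra (sigY M Y K) (sigY M Y T)"
proof -
  have R: "(\<lambda>w. restrict (Y w) T) \<in> measurable (sigY M Y K) (PiM T (\<lambda>_. borel))"
    using assms by (intro measurable_restrict measurable_sigY) auto
  have sp: "space (sigY M Y K) = space M" by (simp add: sigY_def)
  have "{(\<lambda>w. restrict (Y w) T) -` A \<inter> space M |A. A \<in> sets (Pi\<^sub>M T (\<lambda>_. borel))} \<subseteq> sets (sigY M Y K)"
    using measurable_sets[OF R] by (auto simp: sp)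
  then have "sigma_sets (space (sigY M Y K)) {(\<lambda>w. restrict (Y w) T) -` A \<inter> space M |A. A \<in> sets (Pi\<^sub>M T (\<lambda>_. borel))} \<subseteq> sets (sigY M Y K)"
    by (rule sets.sigma_sets_subset)
  then have "sets (sigY M Y T) \<subseteq> sets (sigY M Y K)"
    unfolding sp by (simp add: sigY_def sets_vimage_algebra)
  then show ?thesis by (simp add: subalgebra_def sigY_def)
qed

lemma orth_to_cond_exp:
  assumes F: "subalgebra M F" and g: "integrable M g"
  shows "orth_to M F (\<lambda>w. of_real (g w - real_cond_exp M F g w))"
proof -
  interpret sigma_finite_subalgebra M F
    by (rule finite_measure_subalgebra_is_sigma_finite, unfold_locales) (rule F)
  have gm [measurable]: "g \<in> borel_measurable M" using g by auto
  have P: "integrable M (real_cond_exp M F g)" using g by (rule real_cond_exp_int)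
  show ?thesis
  proof (rule orth_to_I[OF F])
    show "integrable M (\<lambda>w. complex_of_real (g w - real_cond_exp M F g w))" using g P by simp
    fix C assume C: "C \<in> sets F"
    then have CM: "C \<in> sets M" using F by (auto simp: subalgebra_def)
    have ig: "integrable M (\<lambda>w. indicator C w * g w)" "integrable M (\<lambda>w. indicator C w * real_cond_exp M F g w)"
      using integrable_mult_indicator[OF CM g] integrable_mult_indicator[OF CM P] by auto
    have "(\<integral>w. (g w - real_cond_exp M F g w) * indicator C w \<partial>M)
        = (\<integral>w. indicator C w * g w \<partial>M) - (\<integral>w. indicator C w * real_cond_exp M F g w \<partial>M)"
      unfolding L1_diff[OF ig, symmetric] 
      by (intro L1_cong refl) (simp add: algebra_simps)
    also have "(\<integral>w. indicator C w * real_cond_exp M F g w \<partial>M) = (\<integral>w. indicator C w * g w \<partial>M)"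
      by (rule real_cond_exp_intg(2)[OF ig(1) _ gm]) (use C in simp)
    finally have "complex_of_real (\<integral>w. (g w - real_cond_exp M F g w) * indicator C w \<partial>M) = 0" by simp
    then show "(\<integral>w. complex_of_real (g w - real_cond_exp M F g w) * of_real (indicator C w) \<partial>M) = 0"
      unfolding integral_complex_of_real[symmetric] of_real_mult .
  qed
qed

end

section \<open>Linear forms in a Gaussian vector\<close>

locale gauss = prob_space M + pd_mat p S
  for M :: "'a measure" and p S +
  fixes Y :: "'a \<Rightarrow> nat \<Rightarrow> real"
  assumes mvn: "mvn M p S Y"
begin

definition lin :: "(nat \<Rightarrow> real) \<Rightarrow> 'a \<Rightarrow> real" where
  "lin a w = (\<Sum>k<p. a k * Y w k)"

lemma lin_unit: "k < p \<Longrightarrow> lin (unit k) w = Y w k"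
  by (simp add: lin_def)

lemma lin_add: "lin (\<lambda>k. a k + b k) w = lin a w + lin b w"
  by (simp add: lin_def distrib_right sum.distrib)

lemma lin_diff: "lin (\<lambda>k. a k - b k) w = lin a w - lin b w"
  by (simp add: lin_def left_diff_distrib sum_subtractf)

lemma lin_scale: "lin (\<lambda>k. c * a k) w = c * lin a w"
  by (simp add: lin_def sum_distrib_left mult.assoc)

lemma lin_dist:
  assumes "i < p" "a i \<noteq> 0"
  shows "distributed M lborel (lin a) (normal_density 0 (sqrt (ip p S a a)))"
  using mvn assms unfolding mvn_def lin_def ip_def by blast

lemma lin_meas: "lin a \<in> borel_measurable M"
proof (cases "\<exists>i<p. a i \<noteq> 0")
  case True
  then show ?thesis using distributed_measurable[OF lin_dist] by auto
next
  case False
  then have "lin a = (\<lambda>_. 0)" by (auto simp: lin_def)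
  then show ?thesis by simp
qed

lemma Y_meas: "k < p \<Longrightarrow> (\<lambda>w. Y w k) \<in> borel_measurable M"
  using lin_meas[of "unit k"] by (simp add: lin_unit cong: measurable_cong)

lemma lin_trivial:
  assumes "\<not> (\<exists>i<p. a i \<noteq> 0)"
  shows "lin a = (\<lambda>_. 0)" "ip p S a a = 0"
  using assms by (auto simp: lin_def ip_def)

lemma lin_char: "(\<integral>w. iexp (lin a w) \<partial>M) = of_real (exp (- (ip p S a a) / 2))"
proof (cases "\<exists>i<p. a i \<noteq> 0")
  case True
  then obtain i where i: "i < p" "a i \<noteq> 0" by auto
  define \<sigma> where "\<sigma> = sqrt (ip p S a a)"
  have \<sigma>: "\<sigma> > 0" using ip_pos[of i a, OF i] by (simp add: \<sigma>_def)
  have d: "distributed M lborel (\<lambda>w. (lin a w - 0) / \<sigma>) std_normal_density"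
    using lin_dist[of i a, OF i] unfolding \<sigma>_def[symmetric] using normal_standard_normal_convert[OF \<sigma>, of "lin a" 0] by simp
  have m: "(\<lambda>w. lin a w / \<sigma>) \<in> borel_measurable M" using lin_meas by simp
  have "distr M borel (\<lambda>w. lin a w / \<sigma>) = distr M lborel (\<lambda>w. lin a w / \<sigma>)"
    by (rule distr_cong) auto
  also have "\<dots> = std_normal_distribution"
    using distributed_distr_eq_density[OF d] by simp
  finally have eq: "distr M borel (\<lambda>w. lin a w / \<sigma>) = std_normal_distribution" .
  have "(\<integral>w. iexp (lin a w) \<partial>M) = (\<integral>w. iexp (\<sigma> * (lin a w / \<sigma>)) \<partial>M)"
    using \<sigma> by simp
  also have "\<dots> = char (distr M borel (\<lambda>w. lin a w / \<sigma>)) \<sigma>"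
    unfolding char_def using m by (subst integral_distr) auto
  also have "\<dots> = of_real (exp (- \<sigma>\<^sup>2 / 2))"
    unfolding eq char_std_normal_distribution by simp
  also have "\<sigma>\<^sup>2 = ip p S a a" using ip_nonneg[of a] by (simp add: \<sigma>_def)
  finally show ?thesis .
next
  case False
  show ?thesis by (simp add: lin_trivial[OF False] prob_space)
qed

text \<open>The fourth moment later bounds the variance of a product of two forms.\<close>

lemma lin_moments_all:
  "integrable M (\<lambda>w. lin a w ^ k) \<and> (\<integral>w. lin a w \<partial>M) = 0 \<and>
    (\<integral>w. (lin a w)\<^sup>2 \<partial>M) = ip p S a a \<and> (\<integral>w. lin a w ^ 4 \<partial>M) = 3 * (ip p S a a)\<^sup>2"
proof (cases "\<exists>i<p. a i \<noteq> 0")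
  case True
  then obtain i where i: "i < p" "a i \<noteq> 0" by auto
  define \<sigma> where "\<sigma> = sqrt (ip p S a a)"
  have \<sigma>: "\<sigma> > 0" using ip_pos[of i a, OF i] by (simp add: \<sigma>_def)
  have \<sigma>2: "\<sigma>\<^sup>2 = ip p S a a" using ip_nonneg[of a] by (simp add: \<sigma>_def)
  note d = lin_dist[of i a, OF i, folded \<sigma>_def]
  have "integrable M (\<lambda>w. lin a w ^ k)"
    using distributed_integrable[OF d, of "\<lambda>x. x ^ k"] integrable_normal_moment[OF \<sigma>, of 0 k]
    by simp
  moreover have "(\<integral>w. lin a w \<partial>M) = 0"
    using distributed_integral[OF d, of "\<lambda>x. x"] integral_normal_moment_odd[OF \<sigma>, of 0 0] by simp
  moreover have "(\<integral>w. (lin a w)\<^sup>2 \<partial>M) = \<sigma>\<^sup>2"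
    using distributed_integral[OF d, of "\<lambda>x. x\<^sup>2"] integral_normal_moment_even[OF \<sigma>, of 0 1]
    by (simp add: power2_eq_square)
  moreover have "(\<integral>w. lin a w ^ 4 \<partial>M) = 3 * (\<sigma>\<^sup>2)\<^sup>2"
    using distributed_integral[OF d, of "\<lambda>x. x ^ 4"] integral_normal_moment_even[OF \<sigma>, of 0 2] \<sigma>
    by (simp add: fact_numeral field_simps)
  ultimately show ?thesis by (simp add: \<sigma>2)
next
  case False
  show ?thesis using lin_trivial[OF False] by simp
qed

lemmas lin_moments = lin_moments_all[THEN conjunct1] lin_moments_all[THEN conjunct2, THEN conjunct1]
  lin_moments_all[THEN conjunct2, THEN conjunct2, THEN conjunct1]
  lin_moments_all[THEN conjunct2, THEN conjunct2, THEN conjunct2]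

lemma lin_integrable: "integrable M (lin a)"
  using lin_moments(1)[of a 1] by simp

text \<open>Polarization: \<open>mvn\<close> describes single forms only, so a product is written
  through squares of forms.\<close>

lemma lin_prod:
  shows "integrable M (\<lambda>w. lin a w * lin b w)" "(\<integral>w. lin a w * lin b w \<partial>M) = ip p S a b"
proof -
  have eq: "lin a w * lin b w = ((lin (\<lambda>k. a k + b k) w)\<^sup>2 - (lin a w)\<^sup>2 - (lin b w)\<^sup>2) / 2" for w
    by (simp add: lin_add power2_eq_square algebra_simps)
  have i: "integrable M (\<lambda>w. (lin c w)\<^sup>2)" for c by (rule lin_moments)
  show "integrable M (\<lambda>w. lin a w * lin b w)" unfolding eq using i by simp
  have "(\<integral>w. lin a w * lin b w \<partial>M) = (ip p S (\<lambda>k. a k + b k) (\<lambda>k. a k + b k) - ip p S a a - ip p S b b) / 2"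
    unfolding eq using i by (simp add: lin_moments)
  also have "\<dots> = ip p S a b"
    using ip_commute[of a b] by (simp add: ip_add_left ip_add_right)
  finally show "(\<integral>w. lin a w * lin b w \<partial>M) = ip p S a b" .
qed

text \<open>Fourier version of the independence of the form e from the coordinates in K: e is
  uncorrelated with every form v supported on K, so the characteristic function of s e + v
  factors.\<close>

lemma lin_orth_sigY:
  assumes K: "K \<subseteq> {..<p}" and e: "\<And>k. k \<in> K \<Longrightarrow> cv p S e k = 0"
  shows "orth_to M (sigY M Y K) (\<lambda>w. iexp (s * lin e w) - of_real (exp (- (s\<^sup>2 * ip p S e e) / 2)))"
proof (rule fourier_orth_sigY)
  show fin: "finite K" using K finite_subset by auto
  show "(\<lambda>w. Y w k) \<in> borel_measurable M" if "k \<in> K" for k using that K by (intro Y_meas) auto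
  have iex: "integrable M (\<lambda>w. iexp (lin a w))" for a
    using integrable_mult_iexp[of "\<lambda>_. 1" "lin a"] lin_meas by simp
  show "integrable M (\<lambda>w. iexp (s * lin e w) - of_real (exp (- (s\<^sup>2 * ip p S e e) / 2)))"
    using iex[of "\<lambda>k. s * e k"] by (simp add: lin_scale)
  fix t :: "nat \<Rightarrow> real"
  define v where "v = (\<lambda>k. if k \<in> K then t k else 0)"
  have v: "(\<Sum>k\<in>K. t k * Y w k) = lin v w" for w
    unfolding lin_def v_def using K by (intro sum.mono_neutral_cong_left) auto
  have ev: "ip p S e v = 0" unfolding ip_cv using e by (intro sum.neutral) (auto simp: v_def)
  have "(\<integral>w. (iexp (s * lin e w) - of_real (exp (- (s\<^sup>2 * ip p S e e) / 2))) * iexp (lin v w) \<partial>M)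
     = (\<integral>w. iexp (lin (\<lambda>k. s * e k + v k) w) - of_real (exp (- (s\<^sup>2 * ip p S e e) / 2)) * iexp (lin v w) \<partial>M)"
    by (intro L1_cong refl) (simp add: lin_add lin_scale algebra_simps exp_add)
  also have "\<dots> = (\<integral>w. iexp (lin (\<lambda>k. s * e k + v k) w) \<partial>M) - of_real (exp (- (s\<^sup>2 * ip p S e e) / 2)) * (\<integral>w. iexp (lin v w) \<partial>M)"
    using iex[of v] iex[of "\<lambda>k. s * e k + v k"] by simp
  also have "\<dots> = 0"
    using ev ip_commute[of e v] unfolding lin_char
    by (simp add: ip_add_left ip_add_right ip_scale_left ip_scale_right power2_eq_square
        exp_add[symmetric] add_divide_distrib flip: of_real_mult)
  finally show "(\<integral>w. (iexp (s * lin e w) - of_real (exp (- (s\<^sup>2 * ip p S e e) / 2))) * iexp (\<Sum>k\<in>K. t k * Y w k) \<partial>M) = 0"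
    by (simp add: v)
qed

end

section \<open>Conditional independence as vanishing partial covariance\<close>

context gauss
begin

text \<open>Let h be the indicator of Y_j in B minus its conditional expectation given Y_T. It is
  enough that h is orthogonal to functions of Y_i and Y_T, which holds because Y_i is a form in Y_T
  plus a residual independent of (Y_j, Y_T).\<close>

lemma partial_uncorr_imp_cond_indep:
  assumes ij: "i < p" "j < p" and T: "T \<subseteq> {..<p} - {i, j}" and pu: "partial_uncorr i j T"
  shows "cond_indep M Y i j T"
proof -
  define F where "F = sigY M Y T"
  have Tp: "T \<subseteq> {..<p}" "finite T" using T finite_subset[of T "{..<p}"] by auto
  have Ym: "(\<lambda>w. Y w k) \<in> borel_measurable M" if "k \<in> insert i (insert j T)" for k
    using that Tp ij by (intro Y_meas) auto
  have F: "subalgebra M F" unfolding F_def using Ym by (intro sigY_subalgebra) auto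
  interpret sigma_finite_subalgebra M F
    by (rule finite_measure_subalgebra_is_sigma_finite, unfold_locales) (rule F)
  obtain b where b: "\<And>k. k \<notin> T \<Longrightarrow> b k = 0" and orth: "\<And>k. k \<in> insert j T \<Longrightarrow> cv p S (\<lambda>a. unit i a - b a) k = 0"
    using pu unfolding partial_uncorr_def by blast
  define e where "e = (\<lambda>a. unit i a - b a)"
  define K where "K = insert j T"
  define K' where "K' = insert i T"
  have [measurable]: "(\<lambda>w. Y w i) \<in> borel_measurable M" "(\<lambda>w. Y w j) \<in> borel_measurable M" using ij by (auto intro: Y_meas)
  have Yi: "Y w i = lin e w + lin b w" for w
    using ij by (simp add: e_def lin_diff lin_unit)
  have Kp: "K \<subseteq> {..<p}" using ij Tp by (auto simp: K_def)
  have lin_F: "lin v \<in> borel_measurable F" if "\<And>k. k \<notin> T \<Longrightarrow> v k = 0" for v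
  proof -
    have "lin v = (\<lambda>w. \<Sum>k\<in>T. v k * Y w k)"
      unfolding lin_def using that Tp by (intro ext sum.mono_neutral_right) auto
    then show ?thesis unfolding F_def by (auto intro!: borel_measurable_sum borel_measurable_times measurable_sigY)
  qed
  have F_K: "g \<in> measurable F N \<Longrightarrow> g \<in> measurable (sigY M Y K) N"
    "g \<in> measurable F N \<Longrightarrow> g \<in> measurable (sigY M Y K') N" for g and N :: "'c measure"
    unfolding F_def K_def K'_def by (rule measurable_from_subalg[OF sigY_mono], auto)+
  have "AE w in M. real_cond_exp M F (\<lambda>u. indicator A (Y u i) * indicator B (Y u j)) w
      = real_cond_exp M F (\<lambda>u. indicator A (Y u i)) w * real_cond_exp M F (\<lambda>u. indicator B (Y u j)) w"
    if AB [measurable]: "A \<in> sets borel" "B \<in> sets borel" for A B :: "real set"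
  proof -
    define IA where "IA = (\<lambda>u. indicator A (Y u i) :: real)"
    define IB where "IB = (\<lambda>u. indicator B (Y u j) :: real)"
    define PA where "PA = real_cond_exp M F IA"
    define PB where "PB = real_cond_exp M F IB"
    have m [measurable]: "IA \<in> borel_measurable M" "IB \<in> borel_measurable M" unfolding IA_def IB_def by auto
    have int: "integrable M IA" "integrable M IB"
      by (rule integrable_const_bound[of _ 1]; auto simp: IA_def IB_def indicator_def)+
    have PF: "PA \<in> borel_measurable F" "PB \<in> borel_measurable F" unfolding PA_def PB_def by auto
    have PM [measurable]: "PA \<in> borel_measurable M" "PB \<in> borel_measurable M" using PF measurable_from_subalg[OF F] by auto
    have Pint: "integrable M PA" "integrable M PB" unfolding PA_def PB_def using int by (auto intro: real_cond_exp_int)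
    define h where "h w = IB w - PB w" for w
    have hm [measurable]: "h \<in> borel_measurable M" unfolding h_def by measurable
    have hint: "integrable M h" unfolding h_def using int Pint by simp
    have hK: "h \<in> borel_measurable (sigY M Y K)"
    proof -
      have "(\<lambda>w. Y w j) \<in> borel_measurable (sigY M Y K)" by (rule measurable_sigY) (simp add: K_def)
      from measurable_compose[OF this borel_measurable_indicator[OF AB(2)]] have "IB \<in> borel_measurable (sigY M Y K)"
        unfolding IB_def by simp
      then show ?thesis unfolding h_def using F_K(1)[OF PF(2)] by simp
    qed
    have hF: "orth_to M F (\<lambda>w. of_real (h w))"
      unfolding h_def PB_def using orth_to_cond_exp[OF F int(2)] .
    \<comment> \<open>Since phi is a function of (Y_j, Y_T), the exponential of the residual may be
      replaced by its mean c; what is left is h against a function of Y_T.\<close>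
    have stepA: "(\<integral>w. of_real (h w) * iexp (s * lin e w + lin v w) \<partial>M) = 0" if v: "\<And>k. k \<notin> T \<Longrightarrow> v k = 0" for s v
    proof -
      define c where "c = complex_of_real (exp (- (s\<^sup>2 * ip p S e e) / 2))"
      define \<phi> where "\<phi> w = of_real (h w) * iexp (lin v w)" for w
      have vF: "(\<lambda>w. iexp (lin v w)) \<in> borel_measurable F" using lin_F[OF v] by measurable
      have \<phi>K: "\<phi> \<in> borel_measurable (sigY M Y K)"
        unfolding \<phi>_def using hK F_K(1)[OF vF] by measurable
      have i\<phi>: "integrable M \<phi>" unfolding \<phi>_def using hint by (intro integrable_mult_iexp lin_meas) simp
      have i1: "integrable M (\<lambda>w. \<phi> w * iexp (s * lin e w))"
        using integrable_mult_iexp[OF i\<phi>, of "\<lambda>w. s * lin e w"] lin_meas by simp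
      have "orth_to M (sigY M Y K) (\<lambda>w. iexp (s * lin e w) - c)"
        unfolding c_def using Kp by (rule lin_orth_sigY) (use orth in \<open>auto simp: e_def K_def\<close>)
      note z = orth_toD[OF this \<phi>K]
      have eq: "(iexp (s * lin e w) - c) * \<phi> w = \<phi> w * iexp (s * lin e w) - c * \<phi> w" for w
        by (simp add: algebra_simps)
      have "(\<integral>w. \<phi> w * iexp (s * lin e w) - c * \<phi> w \<partial>M) = 0"
        using i1 i\<phi> by (intro z[unfolded eq]) simp
      then have "(\<integral>w. \<phi> w * iexp (s * lin e w) \<partial>M) = c * (\<integral>w. \<phi> w \<partial>M)"
        using i1 i\<phi> by simp
      also have "(\<integral>w. \<phi> w \<partial>M) = 0"
        using orth_toD[OF hF vF, folded \<phi>_def, OF i\<phi>] .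
      finally show ?thesis by (simp add: \<phi>_def distrib_left exp_add mult_ac)
    qed
    have stepB: "orth_to M (sigY M Y K') (\<lambda>w. of_real (h w))"
    proof (rule fourier_orth_sigY)
      show "finite K'" using Tp by (simp add: K'_def)
      show "(\<lambda>w. Y w k) \<in> borel_measurable M" if "k \<in> K'" for k using that Ym by (auto simp: K'_def)
      show "integrable M (\<lambda>w. complex_of_real (h w))" using hint by simp
      fix t :: "nat \<Rightarrow> real"
      define v where "v = (\<lambda>k. t i * b k + (if k \<in> T then t k else 0))"
      have "i \<notin> T" using T by auto
      have "(\<Sum>k\<in>K'. t k * Y w k) = t i * lin e w + lin v w" for w
      proof -
        have "(\<Sum>k\<in>K'. t k * Y w k) = t i * Y w i + (\<Sum>k\<in>T. t k * Y w k)"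
          using Tp \<open>i \<notin> T\<close> by (simp add: K'_def)
        also have "(\<Sum>k\<in>T. t k * Y w k) = lin (\<lambda>k. if k \<in> T then t k else 0) w"
          unfolding lin_def using Tp by (intro sum.mono_neutral_cong_left) auto
        finally show ?thesis by (simp add: Yi v_def lin_add lin_scale distrib_left)
      qed
      then show "(\<integral>w. of_real (h w) * iexp (\<Sum>k\<in>K'. t k * Y w k) \<partial>M) = 0"
        using stepA[of v "t i"] b by (simp add: v_def)
    qed
    have stepC: "(\<integral>w. indicator C w * (IA w * h w) \<partial>M) = 0" if C: "C \<in> sets F" for C
    proof -
      have CM: "C \<in> sets M" using C F by (auto simp: subalgebra_def)
      have "(\<lambda>w. Y w i) \<in> borel_measurable (sigY M Y K')" by (rule measurable_sigY) (simp add: K'_def)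
      from measurable_compose[OF this borel_measurable_indicator[OF AB(1)]] have "IA \<in> borel_measurable (sigY M Y K')"
        unfolding IA_def by simp
      moreover have "(indicator C :: 'a \<Rightarrow> real) \<in> borel_measurable (sigY M Y K')" using C by (intro F_K(2)) simp
      ultimately have m': "(\<lambda>w. complex_of_real (IA w * indicator C w)) \<in> borel_measurable (sigY M Y K')" by measurable
      have "integrable M (\<lambda>w. h w * (IA w * indicator C w))"
        using hint by (rule L1_bound)
          (use CM in \<open>auto simp: IA_def indicator_def\<close>)
      then have "integrable M (\<lambda>w. complex_of_real (h w * (IA w * indicator C w)))" by (simp only: complex_of_real_integrable_eq)
      then have "(\<integral>w. complex_of_real (h w * (IA w * indicator C w)) \<partial>M) = 0"
        using orth_toD[OF stepB m'] by simp
      then have "(\<integral>w. h w * (IA w * indicator C w) \<partial>M) = 0" by (simp only: integral_complex_of_real of_real_eq_0_iff)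
      then show ?thesis by (simp add: mult_ac)
    qed
    \<comment> \<open>Over sets of F, \<open>stepC\<close> lets PB replace IB; as PB is
      F-measurable, PA may then replace IA.\<close>
    have "AE w in M. real_cond_exp M F (\<lambda>u. IA u * IB u) w = PA w * PB w"
    proof (rule real_cond_exp_charact)
      have ib: "integrable M (\<lambda>w. f w * IA w)" if "integrable M f" for f
        using that by (rule L1_bound) (use that in \<open>auto simp: IA_def indicator_def\<close>)
      show iAB: "integrable M (\<lambda>w. IA w * IB w)" using ib[OF int(2)] by (simp add: mult.commute)
      have iPBA: "integrable M (\<lambda>w. PB w * IA w)" by (rule ib[OF Pint(2)])
      have "integrable M (\<lambda>w. PB w * real_cond_exp M F IA w)"
        by (rule real_cond_exp_intg(1)[OF iPBA PF(2) m(1)])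
      then show "integrable M (\<lambda>w. PA w * PB w)" by (simp add: PA_def mult.commute)
      show "(\<lambda>w. PA w * PB w) \<in> borel_measurable F" using PF by measurable
      fix C assume C: "C \<in> sets F"
      have CM: "C \<in> sets M" using C F by (auto simp: subalgebra_def)
      have iC: "integrable M (\<lambda>w. (indicator C w * PB w) * IA w)" 
        using integrable_mult_indicator[OF CM Pint(2)] by (intro ib) simp
      have CPB: "(\<lambda>w. indicator C w * PB w) \<in> borel_measurable F" using C PF by measurable
      have "(\<integral>w. indicator C w * (IA w * IB w) \<partial>M) - (\<integral>w. (indicator C w * PB w) * IA w \<partial>M)
          = (\<integral>w. indicator C w * (IA w * h w) \<partial>M)"
        using integrable_mult_indicator[OF CM iAB] iC
        by (subst L1_diff[symmetric]) (auto simp: h_def algebra_simps)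
      then have "(\<integral>w. indicator C w * (IA w * IB w) \<partial>M) = (\<integral>w. (indicator C w * PB w) * IA w \<partial>M)"
        using stepC[OF C] by simp
      also have "\<dots> = (\<integral>w. (indicator C w * PB w) * PA w \<partial>M)"
        unfolding PA_def by (rule real_cond_exp_intg(2)[OF iC CPB m(1), symmetric])
      finally show "(\<integral>w\<in>C. (IA w * IB w) \<partial>M) = (\<integral>w\<in>C. (PA w * PB w) \<partial>M)"
        by (simp add: set_lebesgue_integral_def mult_ac)
    qed
    then show ?thesis unfolding PA_def PB_def unfolding IA_def IB_def .
  qed
  then show ?thesis unfolding cond_indep_def F_def sigY_def Let_def by blast
qed

text \<open>The bridge from events, in which \<open>cond_indep\<close> is stated, to the coordinates
  themselves, in which covariances are.\<close>

lemma orth_indicator_imp_orth: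
  fixes f V :: "'a \<Rightarrow> real"
  assumes [measurable]: "V \<in> borel_measurable M" and f: "integrable M f"
    and ind: "\<And>B. B \<in> sets borel \<Longrightarrow> (\<integral>w. indicator B (V w) * f w \<partial>M) = 0"
    and fV: "integrable M (\<lambda>w. V w * f w)"
  shows "(\<integral>w. V w * f w \<partial>M) = 0"
proof -
  let ?F = "vimage_algebra (space M) V borel"
  have sets: "sets ?F = {V -` A \<inter> space M |A. A \<in> sets borel}" by (rule sets_vimage_algebra2) auto
  have F: "subalgebra M ?F"
    unfolding subalgebra_def sets using measurable_sets[OF assms(1)] by auto
  show ?thesis
  proof (rule orth_to_real[OF F f _ _ fV])
    show "V \<in> borel_measurable ?F" by (rule measurable_vimage_algebra1) auto
    fix C assume "C \<in> sets ?F"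
    then obtain B where B: "B \<in> sets borel" "C = V -` B \<inter> space M" unfolding sets by auto
    have "(\<integral>w. indicator C w * f w \<partial>M) = (\<integral>w. indicator B (V w) * f w \<partial>M)"
      by (intro L1_cong refl) (auto simp: B indicator_def)
    then show "(\<integral>w. indicator C w * f w \<partial>M) = 0" using ind[OF B(1)] by simp
  qed
qed

text \<open>The covariance of Y_j with the residual e is tested on indicators of Y_j. Each is h plus
  its conditional expectation PB: conditional independence takes care of h, and for PB it matters
  that e is independent of Y_T with mean zero.\<close>

lemma cond_indep_imp_partial_uncorr:
  assumes ij: "i < p" "j < p" and T: "T \<subseteq> {..<p} - {i, j}" and ci: "cond_indep M Y i j T"
  shows "partial_uncorr i j T"
proof -
  define F where "F = sigY M Y T"
  have Tp: "T \<subseteq> {..<p}" "finite T" using T finite_subset[of T "{..<p}"] by auto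
  have Ym: "(\<lambda>w. Y w k) \<in> borel_measurable M" if "k \<in> T" for k
    using that Tp by (intro Y_meas) auto
  have F: "subalgebra M F" unfolding F_def using Ym by (intro sigY_subalgebra) auto
  interpret sigma_finite_subalgebra M F
    by (rule finite_measure_subalgebra_is_sigma_finite, unfold_locales) (rule F)
  obtain b where b: "\<And>k. k \<notin> T \<Longrightarrow> b k = 0" "\<And>k. k \<in> T \<Longrightarrow> cv p S b k = cv p S (unit i) k"
    using regression_exists[OF Tp(2,1), of "unit i"] by blast
  define e where "e = (\<lambda>a. unit i a - b a)"
  have e_T: "cv p S e k = 0" if "k \<in> T" for k using b(2)[OF that] by (simp add: e_def cv_diff)
  have [measurable]: "(\<lambda>w. Y w i) \<in> borel_measurable M" "(\<lambda>w. Y w j) \<in> borel_measurable M" using ij by (auto intro: Y_meas)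
  have em [measurable]: "lin e \<in> borel_measurable M" by (rule lin_meas)
  have le: "lin e w = Y w i - (\<Sum>k\<in>T. b k * Y w k)" for w
  proof -
    have "lin b w = (\<Sum>k\<in>T. b k * Y w k)"
      unfolding lin_def using b(1) Tp by (intro sum.mono_neutral_right) auto
    then show ?thesis using ij by (simp add: e_def lin_diff lin_unit)
  qed
  have Yint: "integrable M (\<lambda>w. Y w k)" if "k < p" for k
    using lin_integrable[of "unit k"] by (simp add: lin_unit[OF that] cong: Bochner_Integration.integrable_cong)
  \<comment> \<open>The crude bound 2 serves the indicators, the conditional expectation and their
    difference alike.\<close>
  have bdd: "integrable M (\<lambda>w. g w * f w)" if "integrable M g" "f \<in> borel_measurable M" "AE w in M. \<bar>f w\<bar> \<le> 2" for f g :: "'a \<Rightarrow> real"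
  proof (rule L1_bound[of _ "\<lambda>w. 2 * g w"])
    show "AE w in M. norm (g w * f w) \<le> norm (2 * g w)"
      using that(3) by eventually_elim (use mult_left_mono in \<open>fastforce simp: abs_mult mult.commute[of 2]\<close>)
  qed (use that in auto)
  have key: "(\<integral>w. indicator B (Y w j) * lin e w \<partial>M) = 0" if B [measurable]: "B \<in> sets borel" for B
  proof -
    define IB where "IB = (\<lambda>u. indicator B (Y u j) :: real)"
    define PB where "PB = real_cond_exp M F IB"
    have IBm [measurable]: "IB \<in> borel_measurable M" unfolding IB_def by auto
    have IBi: "integrable M IB" by (rule integrable_const_bound[of _ 1]) (auto simp: IB_def indicator_def)
    have PF: "PB \<in> borel_measurable F" unfolding PB_def by auto
    have PM [measurable]: "PB \<in> borel_measurable M" using PF measurable_from_subalg[OF F] by auto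
    have Pint: "integrable M PB" unfolding PB_def using IBi by (rule real_cond_exp_int)
    have "AE w in M. 0 \<le> PB w" "AE w in M. PB w \<le> 1"
      unfolding PB_def using IBi by (intro real_cond_exp_ge_c real_cond_exp_le_c; auto simp: IB_def)+
    then have Pb: "AE w in M. \<bar>PB w\<bar> \<le> 2" by eventually_elim auto
    have hb: "AE w in M. \<bar>IB w - PB w\<bar> \<le> 2"
      using \<open>AE w in M. 0 \<le> PB w\<close> \<open>AE w in M. PB w \<le> 1\<close> by eventually_elim (auto simp: IB_def indicator_def)
    define h where "h w = IB w - PB w" for w
    have hm [measurable]: "h \<in> borel_measurable M" unfolding h_def by measurable
    have hint: "integrable M h" unfolding h_def using IBi Pint by simp
    have hF: "orth_to M F (\<lambda>w. of_real (h w))"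
      unfolding h_def PB_def using orth_to_cond_exp[OF F IBi] .
    have h_Y: "integrable M (\<lambda>w. Y w k * h w)" if "k < p" for k
      using Yint[OF that] hm hb unfolding h_def by (rule bdd)
    have h_T: "(\<integral>w. Y w k * h w \<partial>M) = 0" if k: "k \<in> T" for k
    proof -
      have kp: "k < p" using k Tp by auto
      have "(\<lambda>w. Y w k) \<in> borel_measurable F" unfolding F_def using k by (rule measurable_sigY)
      then have "(\<lambda>w. complex_of_real (Y w k)) \<in> borel_measurable F" by measurable
      from orth_toD[OF hF this] have "(\<integral>w. complex_of_real (Y w k * h w) \<partial>M) = 0"
        using h_Y[OF kp, THEN complex_of_real_integrable_eq[THEN iffD2]] by (simp add: mult.commute)
      then show ?thesis by (simp only: integral_complex_of_real of_real_eq_0_iff)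
    qed
    have h_i: "(\<integral>w. Y w i * h w \<partial>M) = 0"
    proof (rule orth_indicator_imp_orth[OF _ hint _ h_Y[OF ij(1)]])
      fix A :: "real set" assume A [measurable]: "A \<in> sets borel"
      define IA where "IA = (\<lambda>u. indicator A (Y u i) :: real)"
      have IAm [measurable]: "IA \<in> borel_measurable M" unfolding IA_def by auto
      have IAi: "integrable M IA" by (rule integrable_const_bound[of _ 1]) (auto simp: IA_def indicator_def)
      have i1: "integrable M (\<lambda>w. PB w * IA w)"
        by (rule bdd[OF Pint]) (auto simp: IA_def indicator_def)
      have i2: "integrable M (\<lambda>w. IA w * IB w)"
        by (rule bdd[OF IAi]) (auto simp: IB_def indicator_def)
      have "(\<integral>w. IA w * IB w \<partial>M) = (\<integral>w. real_cond_exp M F (\<lambda>w. IA w * IB w) w \<partial>M)"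
        using real_cond_exp_int(2)[OF i2] by simp
      also have "\<dots> = (\<integral>w. PB w * real_cond_exp M F IA w \<partial>M)"
      proof (rule integral_cong_AE)
        show "AE w in M. real_cond_exp M F (\<lambda>w. IA w * IB w) w = PB w * real_cond_exp M F IA w"
          using ci A B unfolding cond_indep_def Let_def sigY_def[symmetric] F_def[symmetric] IA_def IB_def PB_def
          by (simp add: mult.commute)
      qed auto
      also have "\<dots> = (\<integral>w. PB w * IA w \<partial>M)"
        by (rule real_cond_exp_intg(2)[OF i1 PF IAm])
      finally have "(\<integral>w. IA w * IB w \<partial>M) - (\<integral>w. PB w * IA w \<partial>M) = 0" by simp
      then have "(\<integral>w. IA w * h w \<partial>M) = 0"
        unfolding L1_diff[OF i2 i1, symmetric] h_def by (simp add: algebra_simps)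
      then show "(\<integral>w. indicator A (Y w i) * h w \<partial>M) = 0" by (simp add: IA_def)
    qed simp
    have "(\<integral>w. lin e w * h w \<partial>M) = (\<integral>w. Y w i * h w - (\<Sum>k\<in>T. b k * (Y w k * h w)) \<partial>M)"
      by (simp add: le left_diff_distrib sum_distrib_right mult.assoc)
    also have "\<dots> = (\<integral>w. Y w i * h w \<partial>M) - (\<Sum>k\<in>T. b k * (\<integral>w. Y w k * h w \<partial>M))"
    proof -
      have "integrable M (\<lambda>w. b k * (Y w k * h w))" if "k \<in> T" for k
        using h_Y[of k] that Tp by auto
      then show ?thesis using h_Y[OF ij(1)] by simp
    qed
    also have "\<dots> = 0" using h_i h_T by simp
    finally have eh: "(\<integral>w. lin e w * h w \<partial>M) = 0" .
    have eP: "(\<integral>w. lin e w * PB w \<partial>M) = 0"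
    proof -
      \<comment> \<open>\<open>lin_orth_sigY\<close> controls exponentials of e rather than e
        itself, so the roles are swapped: PB, centred so that the factor c meets mean zero, is shown
        orthogonal to all functions of e. \<open>Y'\<close> presents e as a vector with the single
        coordinate 0.\<close>
      define m where "m = (\<integral>w. PB w \<partial>M)"
      define g where "g w = PB w - m" for w
      define Y' where "Y' w k = lin e w" for w and k :: nat
      have gi: "integrable M g" unfolding g_def using Pint by simp
      have gF: "g \<in> borel_measurable F" unfolding g_def using PF by measurable
      have g0: "(\<integral>w. g w \<partial>M) = 0" unfolding g_def using Pint by (simp add: m_def prob_space)
      have "orth_to M (sigY M Y' {0}) (\<lambda>w. of_real (g w))"
      proof (rule fourier_orth_sigY)
        show "integrable M (\<lambda>w. complex_of_real (g w))" using gi by simp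
        fix t :: "nat \<Rightarrow> real"
        define c where "c = complex_of_real (exp (- ((t 0)\<^sup>2 * ip p S e e) / 2))"
        have gc: "integrable M (\<lambda>w. complex_of_real (g w))" using gi by simp
        have i1: "integrable M (\<lambda>w. of_real (g w) * iexp (t 0 * lin e w))"
          using integrable_mult_iexp[OF gc, of "\<lambda>w. t 0 * lin e w"] em by simp
        have "orth_to M F (\<lambda>w. iexp (t 0 * lin e w) - c)"
          unfolding c_def F_def using Tp(1) e_T by (rule lin_orth_sigY)
        moreover have "(\<lambda>w. complex_of_real (g w)) \<in> borel_measurable F" using gF by measurable
        ultimately have z: "integrable M (\<lambda>w. (iexp (t 0 * lin e w) - c) * of_real (g w)) \<Longrightarrow>
            (\<integral>w. (iexp (t 0 * lin e w) - c) * of_real (g w) \<partial>M) = 0" by (rule orth_toD)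
        have eq: "(iexp (t 0 * lin e w) - c) * of_real (g w) = of_real (g w) * iexp (t 0 * lin e w) - c * of_real (g w)" for w
          by (simp add: algebra_simps)
        have "(\<integral>w. of_real (g w) * iexp (t 0 * lin e w) - c * of_real (g w) \<partial>M) = 0"
          using i1 gc by (intro z[unfolded eq]) simp
        then have "(\<integral>w. of_real (g w) * iexp (t 0 * lin e w) \<partial>M) = c * (\<integral>w. of_real (g w) \<partial>M)"
          using i1 gc by simp
        then show "(\<integral>w. of_real (g w) * iexp (\<Sum>k\<in>{0}. t k * Y' w k) \<partial>M) = 0"
          using g0 by (simp add: Y'_def)
      qed (auto simp: Y'_def)
      moreover have "(\<lambda>w. complex_of_real (lin e w)) \<in> borel_measurable (sigY M Y' {0})"
        using measurable_sigY[of 0 "{0}" Y'] unfolding Y'_def by simp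
      moreover have ge: "integrable M (\<lambda>w. g w * lin e w)"
        unfolding g_def left_diff_distrib
        using bdd[OF lin_integrable[of e] PM Pb] lin_integrable[of e] by (simp add: mult.commute)
      then have "integrable M (\<lambda>w. complex_of_real (g w * lin e w))" by (simp only: complex_of_real_integrable_eq)
      ultimately have "(\<integral>w. complex_of_real (g w * lin e w) \<partial>M) = 0"
        using orth_toD[of M "sigY M Y' {0}" "\<lambda>w. of_real (g w)"] by simp
      then have "(\<integral>w. g w * lin e w \<partial>M) = 0" by (simp only: integral_complex_of_real of_real_eq_0_iff)
      moreover have "(\<integral>w. lin e w * PB w \<partial>M) = (\<integral>w. g w * lin e w + m * lin e w \<partial>M)"
        by (intro L1_cong refl) (simp add: g_def algebra_simps)
      ultimately show ?thesis using ge lin_integrable[of e] lin_moments(2)[of e] by simp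
    qed
    have "(\<integral>w. indicator B (Y w j) * lin e w \<partial>M) = (\<integral>w. lin e w * h w + lin e w * PB w \<partial>M)"
      by (intro L1_cong refl) (simp add: h_def IB_def algebra_simps)
    also have "\<dots> = 0"
      using bdd[OF lin_integrable[of e] PM Pb] bdd[OF lin_integrable[of e] hm hb[folded h_def]] eh eP by simp
    finally show ?thesis .
  qed
  have pr: "Y w j * lin e w = lin (unit j) w * lin e w" for w using ij by (simp add: lin_unit)
  have "integrable M (\<lambda>w. Y w j * lin e w)" unfolding pr by (rule lin_prod)
  from orth_indicator_imp_orth[OF _ lin_integrable[of e] key this]
  have "(\<integral>w. Y w j * lin e w \<partial>M) = 0" by simp
  then have "cv p S e j = 0"
    unfolding pr lin_prod(2) using ij ip_commute[of "unit j" e] by (simp add: ip_unit)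
  then show ?thesis
    unfolding partial_uncorr_def using b(1) e_T unfolding e_def by blast
qed

end

text \<open>The definition quantifies over all Gaussian vectors on M; the given Y excludes the
  vacuous case.\<close>

lemma indep_model_gauss_eq:
  assumes "prob_space M" "pos_def p S" "mvn M p S Y"
  shows "indep_model_gauss M p S = {(i, j, T). i < p \<and> j < p \<and> i \<noteq> j \<and> T \<subseteq> {..<p} - {i, j} \<and> pd_mat.partial_uncorr p S i j T}"
proof -
  have g: "gauss M p S Y'" if "mvn M p S Y'" for Y'
    using assms that by (simp add: gauss_def gauss_axioms_def pd_mat_def)
  have "(\<forall>Y'. mvn M p S Y' \<longrightarrow> cond_indep M Y' i j T) \<longleftrightarrow> pd_mat.partial_uncorr p S i j T"
    if "i < p" "j < p" "T \<subseteq> {..<p} - {i, j}" for i j T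
    using gauss.partial_uncorr_imp_cond_indep[OF g that] gauss.cond_indep_imp_partial_uncorr[OF g that] assms(3) by blast
  then show ?thesis unfolding indep_model_gauss_def by blast
qed

section \<open>Concentration of sample covariances\<close>

lemma (in prob_space) second_moment_sum_indep:
  fixes Z :: "'i \<Rightarrow> 'a \<Rightarrow> real" and V :: real
  assumes I: "finite I" and ind: "indep_vars (\<lambda>_. borel) Z I"
    and int: "\<And>i. i \<in> I \<Longrightarrow> integrable M (\<lambda>w. (Z i w)\<^sup>2)"
    and mean: "\<And>i. i \<in> I \<Longrightarrow> (\<integral>w. Z i w \<partial>M) = 0"
    and var: "\<And>i. i \<in> I \<Longrightarrow> (\<integral>w. (Z i w)\<^sup>2 \<partial>M) \<le> V"
  shows "integrable M (\<lambda>w. (\<Sum>i\<in>I. Z i w)\<^sup>2)" "(\<integral>w. (\<Sum>i\<in>I. Z i w)\<^sup>2 \<partial>M) \<le> card I * V"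
proof -
  have Zm: "Z i \<in> borel_measurable M" if "i \<in> I" for i using ind that by (auto simp: indep_vars_def)
  have Zi: "integrable M (Z i)" if "i \<in> I" for i
    using square_integrable_imp_integrable[OF Zm int] that by blast
  have pair: "integrable M (\<lambda>w. Z i w * Z j w)" "(\<integral>w. Z i w * Z j w \<partial>M) \<le> (if i = j then V else 0)"
    if "i \<in> I" "j \<in> I" for i j
  proof -
    have "integrable M (\<lambda>w. Z i w * Z j w) \<and> (\<integral>w. Z i w * Z j w \<partial>M) \<le> (if i = j then V else 0)"
    proof (cases "i = j")
      case True
      then show ?thesis using int[of j] var[of j] that by (simp add: power2_eq_square)
    next
      case False
      have iv: "indep_vars (\<lambda>_. borel) Z {i, j}" using ind that by (rule_tac indep_vars_subset) auto
      have fin: "finite {i, j}" by simp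
      have "(\<integral>w. (\<Prod>k\<in>{i, j}. Z k w) \<partial>M) = (\<Prod>k\<in>{i, j}. \<integral>w. Z k w \<partial>M)"
        by (rule indep_vars_lebesgue_integral[OF fin iv]) (use Zi that in auto)
      moreover have "integrable M (\<lambda>w. \<Prod>k\<in>{i, j}. Z k w)"
        by (rule indep_vars_integrable[OF fin iv]) (use Zi that in auto)
      ultimately show ?thesis using False mean that by simp
    qed
    then show "integrable M (\<lambda>w. Z i w * Z j w)" "(\<integral>w. Z i w * Z j w \<partial>M) \<le> (if i = j then V else 0)" by auto
  qed
  have eq: "(\<Sum>i\<in>I. Z i w)\<^sup>2 = (\<Sum>i\<in>I. \<Sum>j\<in>I. Z i w * Z j w)" for w
    by (simp add: power2_eq_square sum_product)
  show "integrable M (\<lambda>w. (\<Sum>i\<in>I. Z i w)\<^sup>2)"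
    unfolding eq using pair by (intro Bochner_Integration.integrable_sum) auto
  have "(\<integral>w. (\<Sum>i\<in>I. Z i w)\<^sup>2 \<partial>M) = (\<Sum>i\<in>I. \<Sum>j\<in>I. \<integral>w. Z i w * Z j w \<partial>M)"
    unfolding eq using pair by (simp add: Bochner_Integration.integral_sum Bochner_Integration.integrable_sum)
  also have "\<dots> \<le> (\<Sum>i\<in>I. \<Sum>j\<in>I. if i = j then V else 0)"
    using pair by (intro sum_mono) auto
  also have "\<dots> = card I * V" using I by simp
  finally show "(\<integral>w. (\<Sum>i\<in>I. Z i w)\<^sup>2 \<partial>M) \<le> card I * V" .
qed

definition dotp :: "nat \<Rightarrow> (nat \<Rightarrow> real) \<Rightarrow> (nat \<Rightarrow> real) \<Rightarrow> real" where
  "dotp p a x = (\<Sum>k<p. a k * x k)"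

definition emp :: "nat \<Rightarrow> nat \<Rightarrow> (nat \<Rightarrow> nat \<Rightarrow> real) \<Rightarrow> (nat \<Rightarrow> real) \<Rightarrow> (nat \<Rightarrow> real) \<Rightarrow> real" where
  "emp n p Xd a b = (\<Sum>i<n. dotp p a (Xd i) * dotp p b (Xd i)) / n"

locale sample = prob_space M + pd_mat p S
  for M :: "'a measure" and p S +
  fixes n :: nat and X :: "'a \<Rightarrow> nat \<Rightarrow> nat \<Rightarrow> real"
  assumes rows: "\<And>i. i < n \<Longrightarrow> mvn M p S (\<lambda>w. X w i)"
    and indep: "indep_vars (\<lambda>_. PiM {..<p} (\<lambda>_. borel)) (\<lambda>i w. restrict (X w i) {..<p}) {..<n}"
begin

lemma emp_measurable: "(\<lambda>w. emp n p (X w) a b) \<in> borel_measurable M"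
proof -
  have "(\<lambda>w. X w i k) \<in> borel_measurable M" if "i < n" "k < p" for i k
  proof -
    interpret g: gauss M p S "\<lambda>w. X w i" using rows[OF that(1)] by unfold_locales
    show ?thesis using g.Y_meas[OF that(2)] .
  qed
  then show ?thesis
    unfolding emp_def dotp_def
    by (intro borel_measurable_divide borel_measurable_sum borel_measurable_times) auto
qed

text \<open>Chebyshev's inequality; the constant comes from (x y)^2 \<le> (x^4 + y^4) / 2 and the
  Gaussian fourth moment, three times the squared variance.\<close>

lemma emp_deviation:
  fixes s :: real
  assumes n: "n > 0" and s: "s > 0"
  shows "prob {w \<in> space M. \<bar>emp n p (X w) a b - ip p S a b\<bar> \<ge> s}
    \<le> (3 * ((ip p S a a)\<^sup>2 + (ip p S b b)\<^sup>2) / 2) / (n * s\<^sup>2)"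
proof -
  define \<mu> where "\<mu> = ip p S a b"
  define V where "V = 3 * ((ip p S a a)\<^sup>2 + (ip p S b b)\<^sup>2) / 2"
  define Z where "Z i w = dotp p a (X w i) * dotp p b (X w i) - \<mu>" for i w
  have Z: "integrable M (\<lambda>w. (Z i w)\<^sup>2) \<and> integrable M (Z i) \<and> (\<integral>w. Z i w \<partial>M) = 0 \<and> (\<integral>w. (Z i w)\<^sup>2 \<partial>M) \<le> V" if "i < n" for i
  proof -
    interpret g: gauss M p S "\<lambda>w. X w i" using rows[OF that] by unfold_locales
    define U where "U w = g.lin a w * g.lin b w" for w
    have ZU: "Z i w = U w - \<mu>" for w by (simp add: Z_def U_def dotp_def g.lin_def)
    have U: "integrable M U" "(\<integral>w. U w \<partial>M) = \<mu>" unfolding U_def \<mu>_def by (rule g.lin_prod)+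
    have i4: "integrable M (\<lambda>w. (g.lin a w ^ 4 + g.lin b w ^ 4) / 2)" using g.lin_moments(1) by simp
    have le: "(U w)\<^sup>2 \<le> (g.lin a w ^ 4 + g.lin b w ^ 4) / 2" for w
    proof -
      have "0 \<le> ((g.lin a w)\<^sup>2 - (g.lin b w)\<^sup>2)\<^sup>2" by simp
      then show ?thesis by (simp add: U_def power2_eq_square power4_eq_xxxx algebra_simps)
    qed
    have Um: "U \<in> borel_measurable M" using U(1) by simp
    have U2: "integrable M (\<lambda>w. (U w)\<^sup>2)"
      using i4 by (rule L1_bound) (use Um le in auto)
    have "(\<integral>w. (U w)\<^sup>2 \<partial>M) \<le> (\<integral>w. (g.lin a w ^ 4 + g.lin b w ^ 4) / 2 \<partial>M)"
      using U2 i4 le by (intro integral_mono)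
    also have "\<dots> = V" using g.lin_moments(1) by (simp add: g.lin_moments V_def algebra_simps)
    finally have "(\<integral>w. (U w)\<^sup>2 \<partial>M) \<le> V" .
    moreover have Z2: "(Z i w)\<^sup>2 = (U w)\<^sup>2 - 2 * \<mu> * U w + \<mu>\<^sup>2" for w
      by (simp add: ZU power2_eq_square algebra_simps)
    have "(\<integral>w. (Z i w)\<^sup>2 \<partial>M) = (\<integral>w. (U w)\<^sup>2 \<partial>M) - 2 * \<mu> * \<mu> + \<mu>\<^sup>2"
      unfolding Z2 using U U2 prob_space by simp
    then have "(\<integral>w. (Z i w)\<^sup>2 \<partial>M) \<le> (\<integral>w. (U w)\<^sup>2 \<partial>M)" by (simp add: power2_eq_square)
    moreover have "integrable M (\<lambda>w. (Z i w)\<^sup>2)" unfolding Z2 using U U2 by simp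
    moreover have "(\<integral>w. Z i w \<partial>M) = 0" unfolding ZU using U by (simp add: prob_space)
    ultimately show ?thesis using U by (simp add: ZU[abs_def])
  qed
  have indZ: "indep_vars (\<lambda>_. borel) Z {..<n}"
  proof -
    have "indep_vars (\<lambda>_. borel) (\<lambda>i w. (\<lambda>x. dotp p a x * dotp p b x - \<mu>) (restrict (X w i) {..<p})) {..<n}"
      by (rule indep_vars_compose2[OF indep]) (simp add: dotp_def)
    then show ?thesis by (simp add: Z_def[abs_def] dotp_def)
  qed
  have sum2: "integrable M (\<lambda>w. (\<Sum>i<n. Z i w)\<^sup>2)" "(\<integral>w. (\<Sum>i<n. Z i w)\<^sup>2 \<partial>M) \<le> n * V"
    using second_moment_sum_indep[OF _ indZ, of V] Z by auto
  have dev: "emp n p (X w) a b - \<mu> = (\<Sum>i<n. Z i w) / n" for w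
    using n by (simp add: emp_def Z_def sum_subtractf diff_divide_distrib)
  define f where "f w = emp n p (X w) a b - \<mu>" for w
  have f2: "(f w)\<^sup>2 = (\<Sum>i<n. Z i w)\<^sup>2 / n\<^sup>2" for w by (simp add: f_def dev power_divide)
  have fm: "f \<in> borel_measurable M" unfolding f_def using emp_measurable by simp
  have f0: "(\<integral>w. f w \<partial>M) = 0"
    unfolding f_def dev using Z by (simp add: Bochner_Integration.integral_sum)
  have "prob {w \<in> space M. s \<le> \<bar>f w - (\<integral>w. f w \<partial>M)\<bar>} \<le> variance f / s\<^sup>2"
    using fm s sum2 by (intro Chebyshev_inequality) (auto simp: f2)
  also have "\<dots> = (\<integral>w. (\<Sum>i<n. Z i w)\<^sup>2 \<partial>M) / n\<^sup>2 / s\<^sup>2" by (simp add: f0 f2)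
  also have "\<dots> \<le> (n * V) / n\<^sup>2 / s\<^sup>2" using sum2 by (intro divide_right_mono) auto
  also have "\<dots> = V / (n * s\<^sup>2)" using n by (simp add: power2_eq_square)
  finally show ?thesis unfolding f0 by (simp add: f_def \<mu>_def V_def)
qed

end

text \<open>A union bound over P, with t fixed before n, M and X because C1, C2 and C3 are built
  from it. The summand 1 in t keeps it positive when all variance bounds vanish.\<close>

lemma uniform_deviation:
  assumes "pos_def p S" "finite P" "\<epsilon> > 0"
  shows "\<exists>t>0. \<forall>n (M :: 'a measure) X. n > 0 \<longrightarrow> sample M p S n X \<longrightarrow>
    (\<exists>A\<in>sets M. measure M A \<ge> 1 - \<epsilon> \<and>
       A \<subseteq> {w \<in> space M. \<forall>(a, b)\<in>P. \<bar>emp n p (X w) a b - ip p S a b\<bar> \<le> t / sqrt n})"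
proof -
  define V where "V = (\<lambda>(a, b). 3 * ((ip p S a a)\<^sup>2 + (ip p S b b)\<^sup>2) / 2)"
  have V0: "V ab \<ge> 0" for ab by (auto simp: V_def split: prod.split)
  define t where "t = sqrt ((1 + (\<Sum>ab\<in>P. V ab)) / \<epsilon>)"
  have pos: "1 + (\<Sum>ab\<in>P. V ab) > 0" by (intro add_pos_nonneg sum_nonneg V0) simp
  have t: "t > 0" using pos assms by (simp add: t_def)
  have t2: "t\<^sup>2 = (1 + (\<Sum>ab\<in>P. V ab)) / \<epsilon>" using pos assms by (simp add: t_def)
  show ?thesis
  proof (intro exI[of _ t] conjI t allI impI)
    fix n and M :: "'a measure" and X assume n: "n > 0" and "sample M p S n X"
    interpret sample M p S n X by fact
    have st: "t / sqrt n > 0" using t n by simp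
    define E where "E = (\<lambda>(a, b). {w \<in> space M. \<bar>emp n p (X w) a b - ip p S a b\<bar> \<ge> t / sqrt n})"
    have Em: "E ab \<in> sets M" for ab
    proof (cases ab)
      case (Pair a b)
      have [measurable]: "(\<lambda>w. emp n p (X w) a b) \<in> borel_measurable M" by (rule emp_measurable)
      show ?thesis unfolding E_def Pair by simp
    qed
    have Ep: "prob (E ab) \<le> V ab / t\<^sup>2" for ab
      using emp_deviation[OF n st, of "fst ab" "snd ab"] n
      by (simp add: E_def V_def case_prod_unfold power_divide)
    have "prob (\<Union>ab\<in>P. E ab) \<le> (\<Sum>ab\<in>P. prob (E ab))"
      using assms Em by (intro finite_measure_subadditive_finite) auto
    also have "\<dots> \<le> (\<Sum>ab\<in>P. V ab / t\<^sup>2)" by (intro sum_mono Ep)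
    also have "\<dots> = (\<Sum>ab\<in>P. V ab) / t\<^sup>2" by (simp add: sum_divide_distrib)
    also have "\<dots> \<le> \<epsilon>" unfolding t2 using pos assms by (simp add: field_simps)
    finally have bad: "prob (\<Union>ab\<in>P. E ab) \<le> \<epsilon>" .
    have UE: "(\<Union>ab\<in>P. E ab) \<in> sets M" using assms Em by (intro sets.finite_UN) auto
    have "prob (space M - (\<Union>ab\<in>P. E ab)) \<ge> 1 - \<epsilon>" using bad by (simp add: prob_compl[OF UE])
    moreover have "space M - (\<Union>ab\<in>P. E ab) \<subseteq> {w \<in> space M. \<forall>(a, b)\<in>P. \<bar>emp n p (X w) a b - ip p S a b\<bar> \<le> t / sqrt n}"
      by (fastforce simp: E_def)
    ultimately show "\<exists>A\<in>sets M. measure M A \<ge> 1 - \<epsilon> \<and>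
       A \<subseteq> {w \<in> space M. \<forall>(a, b)\<in>P. \<bar>emp n p (X w) a b - ip p S a b\<bar> \<le> t / sqrt n}"
      using UE by (intro bexI[of _ "space M - (\<Union>ab\<in>P. E ab)"]) auto
  qed
qed

section \<open>Restricted minimizers\<close>

lemma mcp_zero: "lam > 0 \<Longrightarrow> \<gamma> > 0 \<Longrightarrow> mcp lam \<gamma> 0 = 0"
  by (simp add: mcp_def)

lemma mcp_large: "lam * \<gamma> \<le> x \<Longrightarrow> mcp lam \<gamma> x = lam\<^sup>2 * \<gamma> / 2"
  by (simp add: mcp_def)

text \<open>The deficit to the saturation level is quadratic with factor 1 / (2 gamma), so a large
  gamma lets the curvature of the loss dominate it.\<close>

lemma mcp_gap:
  assumes "lam > 0" "\<gamma> > 0" "x < lam * \<gamma>"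
  shows "lam\<^sup>2 * \<gamma> / 2 - mcp lam \<gamma> x = (lam * \<gamma> - x)\<^sup>2 / (2 * \<gamma>)"
  using assms by (simp add: mcp_def field_simps power2_eq_square)

text \<open>By concavity the penalty lies above its chord from 0 to the saturation point, whose
  slope is half of lambda.\<close>

lemma mcp_ge_linear:
  assumes "lam > 0" "\<gamma> > 0" "0 \<le> x" "x \<le> lam * \<gamma>"
  shows "lam * x / 2 \<le> mcp lam \<gamma> x"
proof (cases "x < lam * \<gamma>")
  case True
  have "x\<^sup>2 \<le> x * (lam * \<gamma>)" using assms by (simp add: power2_eq_square mult_left_mono)
  then have "x\<^sup>2 / (2 * lam * \<gamma>) \<le> x * (lam * \<gamma>) / (2 * lam * \<gamma>)"
    using assms by (intro divide_right_mono) auto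
  also have "\<dots> = x / 2" using assms by simp
  finally have "lam * (x / 2) \<le> lam * (x - x\<^sup>2 / (2 * lam * \<gamma>))"
    using assms by (intro mult_left_mono) auto
  then show ?thesis using True by (simp add: mcp_def)
next
  case False
  then have "x = lam * \<gamma>" using assms by simp
  then show ?thesis by (simp add: mcp_def power2_eq_square)
qed

lemma mcp_nonneg:
  assumes "lam > 0" "\<gamma> > 0" "0 \<le> x"
  shows "0 \<le> mcp lam \<gamma> x"
proof (cases "x \<le> lam * \<gamma>")
  case True
  have "0 \<le> lam * x / 2" using assms by simp
  then show ?thesis using mcp_ge_linear[OF assms(1,2,3) True] by linarith
next
  case False
  then show ?thesis using assms by (simp add: mcp_def)
qed

definition colobj :: "nat \<Rightarrow> (nat \<Rightarrow> nat \<Rightarrow> real) \<Rightarrow> real \<Rightarrow> real \<Rightarrow> nat \<Rightarrow> (nat \<Rightarrow> real) \<Rightarrow> real" where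
  "colobj p H lam \<gamma> j b = ip p H (\<lambda>a. unit j a - b a) (\<lambda>a. unit j a - b a) / 2 + (\<Sum>k<p. mcp lam \<gamma> \<bar>b k\<bar>)"

lemma ip_sym:
  assumes "\<And>i j. i < p \<Longrightarrow> j < p \<Longrightarrow> H i j = H j i"
  shows "ip p H u v = ip p H v u"
proof -
  have "ip p H u v = (\<Sum>j<p. \<Sum>i<p. u i * H i j * v j)"
    unfolding ip_def by (rule sum.swap)
  also have "\<dots> = ip p H v u"
    unfolding ip_def by (intro sum.cong refl) (use assms in \<open>auto simp: mult_ac\<close>)
  finally show ?thesis .
qed

lemma ip_square_diff:
  assumes "\<And>i j. i < p \<Longrightarrow> j < p \<Longrightarrow> H i j = H j i"
  shows "ip p H (\<lambda>a. e a - u a) (\<lambda>a. e a - u a) = ip p H e e - 2 * ip p H e u + ip p H u u"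
  using ip_sym[of p H u e] assms by (simp add: ip_diff_left ip_diff_right)

text \<open>P holds the admissible positions and beta is the population column. Comparison with beta
  puts b within l1 distance R = 4 p tau / kappa of it; as R is at most lambda, no true entry is
  lost. If a spurious entry x is deleted, the loss grows by at most |x| (tau + G R) < lambda |x| /
  2, which is less than the penalty saved.\<close>

lemma minimizer_support:
  assumes sym: "\<And>i j. i < p \<Longrightarrow> j < p \<Longrightarrow> H i j = H j i"
    and coer: "\<And>u. ip p H u u \<ge> \<kappa> * (\<Sum>k<p. (u k)\<^sup>2)" and \<kappa>: "\<kappa> > 0"
    and G: "\<And>i j. i < p \<Longrightarrow> j < p \<Longrightarrow> \<bar>H i j\<bar> \<le> G"
    and \<beta>: "\<And>k. k < p \<Longrightarrow> k \<notin> P \<Longrightarrow> \<beta> k = 0" and b: "\<And>k. k < p \<Longrightarrow> k \<notin> P \<Longrightarrow> b k = 0"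
    and noise: "\<And>k. k \<in> P \<Longrightarrow> \<bar>cv p H (\<lambda>a. unit j a - \<beta> a) k\<bar> \<le> \<tau>"
    and lam: "lam > 0" and \<gamma>: "\<gamma> \<ge> 1" "\<gamma> * \<kappa> \<ge> 2" and \<tau>: "\<tau> \<ge> 0"
    and R1: "4 * p * \<tau> / \<kappa> \<le> lam" and R2: "\<tau> + G * (4 * p * \<tau> / \<kappa>) < lam / 2"
    and \<beta>min: "\<And>k. k < p \<Longrightarrow> \<beta> k \<noteq> 0 \<Longrightarrow> \<bar>\<beta> k\<bar> > (1 + \<gamma>) * lam"
    and opt: "\<And>b'. (\<And>k. k < p \<Longrightarrow> k \<notin> P \<Longrightarrow> b' k = 0) \<Longrightarrow> colobj p H lam \<gamma> j b \<le> colobj p H lam \<gamma> j b'"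
    and k: "k < p"
  shows "b k \<noteq> 0 \<longleftrightarrow> \<beta> k \<noteq> 0"
proof -
  define e where "e = (\<lambda>a. unit j a - \<beta> a)"
  define u where "u = (\<lambda>a. b a - \<beta> a)"
  define s where "s = (\<Sum>k<p. \<bar>u k\<bar>)"
  define R where "R = 4 * p * \<tau> / \<kappa>"
  have \<gamma>0: "\<gamma> > 0" using \<gamma> by simp
  have G0: "G \<ge> 0" using G[OF k k] by simp
  have s0: "s \<ge> 0" by (simp add: s_def sum_nonneg)
  have u0: "u k = 0" if "k < p" "k \<notin> P" for k using \<beta>[OF that] b[OF that] by (simp add: u_def)
  have eb: "(\<lambda>a. unit j a - b a) = (\<lambda>a. e a - u a)" by (simp add: e_def u_def)
  have eu: "ip p H e u \<le> \<tau> * s"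
  proof -
    have "cv p H e k * u k \<le> \<tau> * \<bar>u k\<bar>" if "k < p" for k
    proof (cases "k \<in> P")
      case True
      have "cv p H e k * u k \<le> \<bar>cv p H e k\<bar> * \<bar>u k\<bar>" by (metis abs_ge_self abs_mult)
      also have "\<dots> \<le> \<tau> * \<bar>u k\<bar>" using noise[OF True] by (intro mult_right_mono) (auto simp: e_def)
      finally show ?thesis .
    qed (simp add: u0 that)
    then show ?thesis unfolding ip_cv s_def sum_distrib_left by (intro sum_mono) auto
  qed
  \<comment> \<open>Only where beta is nonzero can b have the smaller penalty. There beta is
    saturated and the deficit is at most u^2 / (2 gamma), hence kappa u^2 / 4: half of the curvature
    is spent here.\<close>
  have pen: "mcp lam \<gamma> \<bar>b k\<bar> - mcp lam \<gamma> \<bar>\<beta> k\<bar> \<ge> - (\<kappa> / 4) * (u k)\<^sup>2" if "k < p" for k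
  proof (cases "\<beta> k = 0")
    case True
    have "0 \<le> (\<kappa> / 4) * (u k)\<^sup>2" using \<kappa> by simp
    then show ?thesis using mcp_nonneg[OF lam \<gamma>0, of "\<bar>b k\<bar>"] mcp_zero[OF lam \<gamma>0] True by simp
  next
    case False
    have big: "\<bar>\<beta> k\<bar> > lam * \<gamma> + lam" using \<beta>min[OF that False] by (simp add: algebra_simps)
    then have \<rho>\<beta>: "mcp lam \<gamma> \<bar>\<beta> k\<bar> = lam\<^sup>2 * \<gamma> / 2" using lam by (intro mcp_large) simp
    show ?thesis
    proof (cases "\<bar>b k\<bar> < lam * \<gamma>")
      case True
      have "0 \<le> lam * \<gamma> - \<bar>b k\<bar>" "lam * \<gamma> - \<bar>b k\<bar> \<le> \<bar>u k\<bar>" using True big lam by (auto simp: u_def)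
      then have "(lam * \<gamma> - \<bar>b k\<bar>)\<^sup>2 \<le> (u k)\<^sup>2" using power_mono[of "lam * \<gamma> - \<bar>b k\<bar>" "\<bar>u k\<bar>" 2] by simp
      then have "(lam * \<gamma> - \<bar>b k\<bar>)\<^sup>2 / (2 * \<gamma>) \<le> (u k)\<^sup>2 / (2 * \<gamma>)" using \<gamma>0 by (intro divide_right_mono) auto
      also have "\<dots> = (1 / (2 * \<gamma>)) * (u k)\<^sup>2" by simp
      also have "\<dots> \<le> (\<kappa> / 4) * (u k)\<^sup>2"
        using \<gamma> \<gamma>0 by (intro mult_right_mono) (auto simp: field_simps)
      finally show ?thesis using mcp_gap[OF lam \<gamma>0 True] \<rho>\<beta> by simp
    next
      case False
      have "0 \<le> (\<kappa> / 4) * (u k)\<^sup>2" using \<kappa> by simp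
      then show ?thesis using mcp_large[of lam \<gamma> "\<bar>b k\<bar>"] False \<rho>\<beta> by simp
    qed
  qed
  have "colobj p H lam \<gamma> j b \<le> colobj p H lam \<gamma> j \<beta>" using \<beta> by (rule opt)
  then have "ip p H u u / 2 - ip p H e u + (\<Sum>k<p. mcp lam \<gamma> \<bar>b k\<bar> - mcp lam \<gamma> \<bar>\<beta> k\<bar>) \<le> 0"
    unfolding colobj_def eb e_def[symmetric] using ip_square_diff[of p H e u] sym
    by (simp add: sum_subtractf add_divide_distrib diff_divide_distrib)
  moreover have "(\<Sum>k<p. mcp lam \<gamma> \<bar>b k\<bar> - mcp lam \<gamma> \<bar>\<beta> k\<bar>) \<ge> (\<Sum>k<p. - (\<kappa> / 4) * (u k)\<^sup>2)"
    using pen by (intro sum_mono) auto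
  moreover have "(\<Sum>k<p. - (\<kappa> / 4) * (u k)\<^sup>2) = - (\<kappa> / 4) * (\<Sum>k<p. (u k)\<^sup>2)"
    by (rule sum_distrib_left[symmetric])
  ultimately have quad: "\<kappa> / 4 * (\<Sum>k<p. (u k)\<^sup>2) \<le> \<tau> * s" using coer[of u] eu by (simp add: algebra_simps)
  have "s\<^sup>2 \<le> p * (\<Sum>k<p. (u k)\<^sup>2)"
    unfolding s_def using sum_squared_le_sum_of_squares[of "\<lambda>k. \<bar>u k\<bar>" "{..<p}"] by (simp add: mult.commute)
  then have "\<kappa> / 4 * s\<^sup>2 \<le> p * (\<kappa> / 4 * (\<Sum>k<p. (u k)\<^sup>2))" using \<kappa> by (simp add: mult_left_mono mult_ac)
  also have "\<dots> \<le> p * (\<tau> * s)" using quad by (intro mult_left_mono) auto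
  finally have "s * (\<kappa> / 4 * s) \<le> s * (p * \<tau>)" by (simp add: power2_eq_square mult_ac)
  then have "s \<le> R"
  proof (cases "s = 0")
    case True
    then show ?thesis using \<tau> \<kappa> by (simp add: R_def)
  next
    case False
    then have "\<kappa> / 4 * s \<le> p * \<tau>" using s0 \<open>s * (\<kappa> / 4 * s) \<le> s * (p * \<tau>)\<close> by simp
    then show ?thesis using \<kappa> by (simp add: R_def field_simps)
  qed
  have uR: "\<bar>u k\<bar> \<le> R"
    using member_le_sum[of k "{..<p}" "\<lambda>k. \<bar>u k\<bar>"] k \<open>s \<le> R\<close> by (simp add: s_def)
  show ?thesis
  proof (cases "\<beta> k = 0")
    case False
    have "lam < \<bar>\<beta> k\<bar>" using \<beta>min[OF k False] lam \<gamma>0 by (simp add: algebra_simps) (smt (verit) mult_pos_pos)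
    then have "b k \<noteq> 0" using uR R1 by (auto simp: u_def R_def)
    then show ?thesis using False by simp
  next
    case True
    have "b k = 0"
    proof (rule ccontr)
      assume bk: "b k \<noteq> 0"
      then have kP: "k \<in> P" using b k by auto
      define x where "x = b k"
      have xu: "x = u k" by (simp add: x_def u_def True)
      define b' where "b' = b(k := 0)"
      define d where "d = (\<lambda>a. unit j a - b' a)"
      have bd: "(\<lambda>a. unit j a - b a) = (\<lambda>a. d a - x * unit k a)"
        by (auto simp: d_def b'_def x_def unit_def)
      have "colobj p H lam \<gamma> j b \<le> colobj p H lam \<gamma> j b'" by (rule opt) (use b in \<open>auto simp: b'_def\<close>)
      moreover have "(\<Sum>l<p. mcp lam \<gamma> \<bar>b l\<bar>) = mcp lam \<gamma> \<bar>x\<bar> + (\<Sum>l<p. mcp lam \<gamma> \<bar>b' l\<bar>)"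
      proof -
        have "(\<Sum>l<p. mcp lam \<gamma> \<bar>b l\<bar>) = mcp lam \<gamma> \<bar>b k\<bar> + (\<Sum>l\<in>{..<p} - {k}. mcp lam \<gamma> \<bar>b l\<bar>)"
          using k by (intro sum.remove) auto
        moreover have "(\<Sum>l<p. mcp lam \<gamma> \<bar>b' l\<bar>) = mcp lam \<gamma> \<bar>b' k\<bar> + (\<Sum>l\<in>{..<p} - {k}. mcp lam \<gamma> \<bar>b' l\<bar>)"
          using k by (intro sum.remove) auto
        moreover have "(\<Sum>l\<in>{..<p} - {k}. mcp lam \<gamma> \<bar>b' l\<bar>) = (\<Sum>l\<in>{..<p} - {k}. mcp lam \<gamma> \<bar>b l\<bar>)"
          by (intro sum.cong refl) (auto simp: b'_def)
        ultimately show ?thesis using mcp_zero[OF lam \<gamma>0] by (simp add: b'_def x_def)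
      qed
      ultimately have "- ip p H d (\<lambda>a. x * unit k a) + ip p H (\<lambda>a. x * unit k a) (\<lambda>a. x * unit k a) / 2 + mcp lam \<gamma> \<bar>x\<bar> \<le> 0"
        unfolding colobj_def bd d_def[symmetric] using ip_square_diff[of p H d "\<lambda>a. x * unit k a"] sym
        by (simp add: add_divide_distrib diff_divide_distrib)
      moreover have "ip p H (\<lambda>a. x * unit k a) (\<lambda>a. x * unit k a) \<ge> 0"
        using coer[of "\<lambda>a. x * unit k a"] \<kappa> by (smt (verit) mult_nonneg_nonneg sum_nonneg zero_le_power2)
      ultimately have main: "mcp lam \<gamma> \<bar>x\<bar> \<le> x * cv p H d k"
        using k by (simp add: ip_scale_right ip_unit)
      have "\<bar>cv p H d k\<bar> \<le> \<tau> + G * R"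
      proof -
        \<comment> \<open>The covariance is taken at the point where entry k is already deleted, so
          the k-th coordinate of u drops out.\<close>
        define u' where "u' = u(k := 0)"
        have "d = (\<lambda>a. e a - u' a)" using True by (auto simp: d_def e_def u'_def u_def b'_def)
        then have "cv p H d k = cv p H e k - cv p H u' k" by (simp add: cv_diff)
        moreover have "\<bar>cv p H e k\<bar> \<le> \<tau>" using noise[OF kP] by (simp add: e_def)
        moreover have "\<bar>cv p H u' k\<bar> \<le> G * R"
        proof -
          have "\<bar>cv p H u' k\<bar> \<le> (\<Sum>l<p. \<bar>u' l * H l k\<bar>)" unfolding cv_def by (rule sum_abs)
          also have "\<dots> \<le> (\<Sum>l<p. \<bar>u l\<bar> * G)"
            using G k G0 by (intro sum_mono) (auto simp: abs_mult u'_def intro!: mult_left_mono)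
          also have "\<dots> = G * s" by (simp add: s_def sum_distrib_left mult.commute)
          also have "\<dots> \<le> G * R" using \<open>s \<le> R\<close> G0 by (rule mult_left_mono)
          finally show ?thesis .
        qed
        ultimately show ?thesis by linarith
      qed
      then have "\<bar>cv p H d k\<bar> < lam / 2" using R2 by (simp add: R_def)
      then have "\<bar>x\<bar> * \<bar>cv p H d k\<bar> < \<bar>x\<bar> * (lam / 2)" using bk by (intro mult_strict_left_mono) (auto simp: x_def)
      moreover have "x * cv p H d k \<le> \<bar>x\<bar> * \<bar>cv p H d k\<bar>" by (metis abs_ge_self abs_mult)
      moreover have "\<bar>x\<bar> * (lam / 2) = lam * \<bar>x\<bar> / 2" by simp
      ultimately have "x * cv p H d k < lam * \<bar>x\<bar> / 2" by linarith
      moreover have "lam * \<bar>x\<bar> / 2 \<le> mcp lam \<gamma> \<bar>x\<bar>"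
      proof (rule mcp_ge_linear[OF lam \<gamma>0])
        have "\<bar>x\<bar> \<le> lam * 1" using uR R1 by (simp add: xu R_def)
        also have "\<dots> \<le> lam * \<gamma>" using lam \<gamma> by (intro mult_left_mono) auto
        finally show "\<bar>x\<bar> \<le> lam * \<gamma>" .
      qed simp
      ultimately show False using main by linarith
    qed
    then show ?thesis using True by simp
  qed
qed

text \<open>A semidefinite H is enough. The cost of b is at most that of 0, which is below the
  saturation level, so no entry exceeds lambda gamma. The penalty is then at least lambda / 2 times
  the l1 norm, while the linear part of the loss gains at most lambda / 4 times it.\<close>

lemma minimizer_zero:
  assumes sym: "\<And>i j. i < p \<Longrightarrow> j < p \<Longrightarrow> H i j = H j i"
    and psd: "\<And>u. ip p H u u \<ge> 0"
    and b: "\<And>k. k < p \<Longrightarrow> k \<notin> P \<Longrightarrow> b k = 0"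
    and noise: "\<And>k. k \<in> P \<Longrightarrow> \<bar>cv p H (unit j) k\<bar> \<le> lam / 4"
    and lam: "lam > 0" and \<gamma>: "\<gamma> > 0" and diag: "ip p H (unit j) (unit j) < lam\<^sup>2 * \<gamma>"
    and opt: "colobj p H lam \<gamma> j b \<le> colobj p H lam \<gamma> j (\<lambda>_. 0)"
    and k: "k < p"
  shows "b k = 0"
proof -
  define e where "e = (\<lambda>a. unit j a - b a)"
  have sq: "ip p H e e = ip p H (unit j) (unit j) - 2 * ip p H (unit j) b + ip p H b b"
    unfolding e_def by (rule ip_square_diff[OF sym])
  have opt': "ip p H e e / 2 + (\<Sum>k<p. mcp lam \<gamma> \<bar>b k\<bar>) \<le> ip p H (unit j) (unit j) / 2"
    using opt by (simp add: colobj_def e_def[symmetric] mcp_zero[OF lam \<gamma>])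
  have small: "\<bar>b k\<bar> \<le> lam * \<gamma>" if "k < p" for k
  proof (rule ccontr)
    assume "\<not> \<bar>b k\<bar> \<le> lam * \<gamma>"
    then have "lam\<^sup>2 * \<gamma> / 2 = mcp lam \<gamma> \<bar>b k\<bar>" by (intro mcp_large[symmetric]) simp
    also have "\<dots> \<le> (\<Sum>k<p. mcp lam \<gamma> \<bar>b k\<bar>)"
      using that by (intro member_le_sum) (auto intro: mcp_nonneg[OF lam \<gamma>])
    finally show False using opt' psd[of e] diag by linarith
  qed
  have "ip p H (unit j) b \<le> (\<Sum>k<p. lam / 4 * \<bar>b k\<bar>)"
    unfolding ip_cv
  proof (intro sum_mono)
    fix k assume k: "k \<in> {..<p}"
    show "cv p H (unit j) k * b k \<le> lam / 4 * \<bar>b k\<bar>"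
    proof (cases "k \<in> P")
      case True
      have "cv p H (unit j) k * b k \<le> \<bar>cv p H (unit j) k\<bar> * \<bar>b k\<bar>" by (metis abs_ge_self abs_mult)
      also have "\<dots> \<le> lam / 4 * \<bar>b k\<bar>" using noise[OF True] by (intro mult_right_mono) auto
      finally show ?thesis .
    qed (use b k in simp)
  qed
  moreover have "(\<Sum>k<p. lam * \<bar>b k\<bar> / 2) \<le> (\<Sum>k<p. mcp lam \<gamma> \<bar>b k\<bar>)"
    using small by (intro sum_mono mcp_ge_linear[OF lam \<gamma>]) auto
  moreover have "(\<Sum>k<p. lam * \<bar>b k\<bar> / 2) = 2 * (\<Sum>k<p. lam / 4 * \<bar>b k\<bar>)"
    by (simp add: sum_distrib_left)
  \<comment> \<open>I is the linear term, s the bound with lambda / 4, r the penalty, c the diagonal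
    value and v the quadratic term.\<close>
  moreover have "2 * s - s \<le> 0" if "I \<le> s" "2 * s \<le> r" "(c - 2 * I + v) / 2 + r \<le> c / 2" "0 \<le> v" for I s r c v :: real
    using that by (simp add: add_divide_distrib diff_divide_distrib)
  ultimately have "(\<Sum>k<p. lam / 4 * \<bar>b k\<bar>) \<le> 0" using opt' psd[of b] unfolding sq by fastforce
  moreover have "lam / 4 * \<bar>b k\<bar> \<le> (\<Sum>k<p. lam / 4 * \<bar>b k\<bar>)"
    using k lam by (intro member_le_sum) auto
  ultimately have "lam / 4 * \<bar>b k\<bar> \<le> 0" by linarith
  then show ?thesis using lam by (simp add: mult_le_0_iff)
qed

section \<open>Splitting the objective into columns\<close>

definition gram :: "nat \<Rightarrow> (nat \<Rightarrow> nat \<Rightarrow> real) \<Rightarrow> nat \<Rightarrow> nat \<Rightarrow> real" where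
  "gram n Xd k l = (\<Sum>i<n. Xd i k * Xd i l) / n"

lemma gram_sym: "gram n Xd k l = gram n Xd l k"
  by (simp add: gram_def mult.commute)

lemma emp_eq_ip: "emp n p Xd a b = ip p (gram n Xd) a b"
proof -
  have "(\<Sum>i<n. dotp p a (Xd i) * dotp p b (Xd i)) = (\<Sum>i<n. \<Sum>k<p. \<Sum>l<p. a k * (Xd i k * Xd i l) * b l)"
    by (simp add: dotp_def sum_product mult_ac)
  also have "\<dots> = (\<Sum>k<p. \<Sum>i<n. \<Sum>l<p. a k * (Xd i k * Xd i l) * b l)" by (rule sum.swap)
  also have "\<dots> = (\<Sum>k<p. \<Sum>l<p. \<Sum>i<n. a k * (Xd i k * Xd i l) * b l)"
    by (intro sum.cong refl sum.swap)
  finally show ?thesis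
    unfolding emp_def ip_def gram_def
    by (simp add: sum_divide_distrib sum_distrib_left sum_distrib_right)
qed

lemma gram_psd: "ip p (gram n Xd) u u \<ge> 0"
  unfolding emp_eq_ip[symmetric] emp_def by (intro divide_nonneg_nonneg sum_nonneg) auto

lemma Qobj_columns:
  "Qobj n p Xd lam \<gamma> B = (\<Sum>j<p. colobj p (gram n Xd) lam \<gamma> j (\<lambda>a. B a j))"
proof -
  have r: "Xd i j - (\<Sum>k<p. Xd i k * B k j) = dotp p (\<lambda>a. unit j a - B a j) (Xd i)" if "j < p" for i j
    using that unfolding dotp_def left_diff_distrib sum_subtractf by (simp add: mult.commute)
  have "(\<Sum>i<n. \<Sum>j<p. (Xd i j - (\<Sum>k<p. Xd i k * B k j))\<^sup>2) = (\<Sum>i<n. \<Sum>j<p. (dotp p (\<lambda>a. unit j a - B a j) (Xd i))\<^sup>2)"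
    by (intro sum.cong refl) (simp add: r)
  also have "\<dots> = (\<Sum>j<p. \<Sum>i<n. (dotp p (\<lambda>a. unit j a - B a j) (Xd i))\<^sup>2)" by (rule sum.swap)
  finally have "1 / (2 * real n) * (\<Sum>i<n. \<Sum>j<p. (Xd i j - (\<Sum>k<p. Xd i k * B k j))\<^sup>2)
      = (\<Sum>j<p. emp n p Xd (\<lambda>a. unit j a - B a j) (\<lambda>a. unit j a - B a j) / 2)"
    by (simp add: emp_def sum_divide_distrib sum_distrib_left power2_eq_square mult_ac)
  moreover have "(\<Sum>i<p. \<Sum>j<p. mcp lam \<gamma> \<bar>B i j\<bar>) = (\<Sum>j<p. \<Sum>i<p. mcp lam \<gamma> \<bar>B i j\<bar>)" by (rule sum.swap)
  ultimately show ?thesis by (simp add: Qobj_def colobj_def emp_eq_ip sum.distrib)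
qed

text \<open>Lower triangularity leaves the diagonal free, and acyclicity excludes loops, which makes
  the order strict. Conversely a strict order implies acyclicity, so the columns are constrained
  independently.\<close>

lemma dag_mats_pi_iff:
  assumes pi: "\<pi> permutes {..<p}"
  shows "B \<in> dag_mats_pi p \<pi> \<longleftrightarrow> supported p B \<and> (\<forall>a b. B a b \<noteq> 0 \<longrightarrow> inv \<pi> b < inv \<pi> a)"
proof
  have r_pi [simp]: "inv \<pi> (\<pi> a) = a" "\<pi> (inv \<pi> a) = a" for a
    using permutes_inverses[OF pi] by auto
  have r_lt: "inv \<pi> a < p \<longleftrightarrow> a < p" for a using permutes_in_image[OF permutes_inv[OF pi], of a] by simp
  assume B: "B \<in> dag_mats_pi p \<pi>"
  then have sup: "supported p B" and acyc: "acyclic (graph_of p B)" and lt: "lower_triangular p (permute_mat \<pi> B)"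
    by (auto simp: dag_mats_pi_def dag_mats_def)
  have "inv \<pi> b < inv \<pi> a" if "B a b \<noteq> 0" for a b
  proof (rule ccontr)
    assume "\<not> inv \<pi> b < inv \<pi> a"
    have ab: "a < p" "b < p" using sup that unfolding supported_def by (meson not_le)+
    consider "inv \<pi> a < inv \<pi> b" | "inv \<pi> a = inv \<pi> b" using \<open>\<not> inv \<pi> b < inv \<pi> a\<close> by linarith
    then show False
    proof cases
      case 1
      then have "permute_mat \<pi> B (inv \<pi> a) (inv \<pi> b) = 0"
        using lt ab r_lt unfolding lower_triangular_def by blast
      then show False using that by (simp add: permute_mat_def)
    next
      case 2
      then have "a = b" by (metis r_pi(2))
      then have "(a, a) \<in> graph_of p B" using that ab by (simp add: graph_of_def)
      then show False using acyc by (auto simp: acyclic_def)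
    qed
  qed
  then show "supported p B \<and> (\<forall>a b. B a b \<noteq> 0 \<longrightarrow> inv \<pi> b < inv \<pi> a)" using sup by blast
next
  have r_pi [simp]: "inv \<pi> (\<pi> a) = a" for a
    using permutes_inverses[OF pi] by auto
  assume *: "supported p B \<and> (\<forall>a b. B a b \<noteq> 0 \<longrightarrow> inv \<pi> b < inv \<pi> a)"
  have "acyclic (graph_of p B)"
    by (rule acyclicI_order[of _ "inv \<pi>"]) (use * in \<open>auto simp: graph_of_def\<close>)
  moreover have "lower_triangular p (permute_mat \<pi> B)"
    unfolding lower_triangular_def permute_mat_def using * by (metis not_less_iff_gr_or_eq r_pi)
  ultimately show "B \<in> dag_mats_pi p \<pi>" using * by (simp add: dag_mats_pi_def dag_mats_def)
qed

text \<open>Exchanging column j alone keeps the matrix feasible and the other summands of the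
  objective fixed. B' truncates b' to the index range to stay \<open>supported\<close>.\<close>

lemma restricted_minimizer_column:
  assumes pi: "\<pi> permutes {..<p}" and rm: "restricted_minimizer n p Xd lam \<gamma> \<pi> B" and j: "j < p"
    and b': "\<And>k. k < p \<Longrightarrow> \<not> inv \<pi> j < inv \<pi> k \<Longrightarrow> b' k = 0"
  shows "colobj p (gram n Xd) lam \<gamma> j (\<lambda>a. B a j) \<le> colobj p (gram n Xd) lam \<gamma> j b'"
proof -
  define B' where "B' = (\<lambda>a c. if c = j then (if a < p then b' a else 0) else B a c)"
  have B: "supported p B" "\<And>a b. B a b \<noteq> 0 \<Longrightarrow> inv \<pi> b < inv \<pi> a"
    using rm dag_mats_pi_iff[OF pi] by (auto simp: restricted_minimizer_def)
  have "B' \<in> dag_mats_pi p \<pi>"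
    unfolding dag_mats_pi_iff[OF pi]
  proof (intro conjI allI impI)
    show "supported p B'" using B(1) j unfolding supported_def B'_def by auto
    show "inv \<pi> b < inv \<pi> a" if "B' a b \<noteq> 0" for a b
      using that B(2)[of a b] b'[of a] by (auto simp: B'_def split: if_splits)
  qed
  then have "Qobj n p Xd lam \<gamma> B \<le> Qobj n p Xd lam \<gamma> B'"
    using rm by (simp add: restricted_minimizer_def)
  moreover have "Qobj n p Xd lam \<gamma> C = colobj p (gram n Xd) lam \<gamma> j (\<lambda>a. C a j)
      + (\<Sum>c\<in>{..<p} - {j}. colobj p (gram n Xd) lam \<gamma> c (\<lambda>a. C a c))" for C
    unfolding Qobj_columns using j by (intro sum.remove) auto
  moreover have "(\<Sum>c\<in>{..<p} - {j}. colobj p (gram n Xd) lam \<gamma> c (\<lambda>a. B' a c))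
      = (\<Sum>c\<in>{..<p} - {j}. colobj p (gram n Xd) lam \<gamma> c (\<lambda>a. B a c))"
    by (intro sum.cong refl) (auto simp: B'_def)
  moreover have "colobj p (gram n Xd) lam \<gamma> j (\<lambda>a. B' a j) = colobj p (gram n Xd) lam \<gamma> j b'"
    unfolding colobj_def by (intro arg_cong2[where f = "(+)"] arg_cong2[where f = "(/)"] ip_cong sum.cong refl) (auto simp: B'_def)
  ultimately show ?thesis by simp
qed

section \<open>Minimal I-maps\<close>

text \<open>List the indices sorted by key; \<open>inv \<pi> a\<close> is the position of a in the
  list.\<close>

lemma permutation_by_key:
  fixes key :: "nat \<Rightarrow> nat"
  shows "\<exists>\<pi>. \<pi> permutes {..<p} \<and> (\<forall>a<p. \<forall>b<p. key a < key b \<longrightarrow> inv \<pi> a < inv \<pi> b)"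
proof -
  define xs where "xs = sort_key key [0..<p]"
  define \<pi> where "\<pi> k = (if k < p then xs ! k else k)" for k
  have xs: "distinct xs" "set xs = {..<p}" "length xs = p" "sorted (map key xs)"
    by (auto simp: xs_def)
  have "bij_betw ((!) xs) {..<p} {..<p}"
    by (rule bij_betw_nth) (use xs in auto)
  then have bij: "bij_betw \<pi> {..<p} {..<p}"
    by (subst bij_betw_cong[of _ _ "(!) xs"]) (auto simp: \<pi>_def)
  have pi: "\<pi> permutes {..<p}" by (rule bij_imp_permutes[OF bij]) (simp add: \<pi>_def)
  have "inv \<pi> a < inv \<pi> b" if ab: "a < p" "b < p" "key a < key b" for a b
  proof (rule ccontr)
    assume "\<not> inv \<pi> a < inv \<pi> b"
    then have le: "inv \<pi> b \<le> inv \<pi> a" by simp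
    have lt: "inv \<pi> a < p" "inv \<pi> b < p"
      using permutes_in_image[OF permutes_inv[OF pi]] ab by auto
    have val: "xs ! inv \<pi> a = a" "xs ! inv \<pi> b = b"
      using permutes_inverses(1)[OF pi, of a] permutes_inverses(1)[OF pi, of b] lt by (auto simp: \<pi>_def)
    have "map key xs ! inv \<pi> b \<le> map key xs ! inv \<pi> a"
      using xs le lt by (intro sorted_nth_mono) auto
    then show False using ab val lt xs by simp
  qed
  then show ?thesis using pi by blast
qed

context pd_mat
begin

text \<open>On T together with k, column j of B and the regression b solve the same normal
  equations, so they coincide; but b has no entry at k.\<close>

lemma partial_uncorr_edge:
  assumes sem: "sem r B D" and kj: "k < p" "j < p" and T: "T \<subseteq> {..<p}"
    and above: "r j < r k" "\<And>a. a \<in> T \<Longrightarrow> r j < r a"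
    and par: "\<And>a. a < p \<Longrightarrow> B a j \<noteq> 0 \<Longrightarrow> a \<in> insert k T" and pu: "partial_uncorr j k T" and kT: "k \<notin> T"
  shows "B k j = 0"
proof -
  obtain b where b: "\<And>l. l \<notin> T \<Longrightarrow> b l = 0" "\<And>l. l \<in> insert k T \<Longrightarrow> cv p S (\<lambda>a. unit j a - b a) l = 0"
    using pu unfolding partial_uncorr_def by blast
  have "b k - B k j = 0"
  proof (rule regression_unique[of "insert k T" "\<lambda>a. b a - B a j"])
    fix l assume "l < p" "l \<notin> insert k T"
    then show "b l - B l j = 0" using b(1) par by force
  next
    fix l assume l: "l \<in> insert k T" "l < p"
    then have "cv p S (resid B j) l = 0" using above by (intro semD(4)[OF sem kj(2)]) auto
    then show "cv p S (\<lambda>a. b a - B a j) l = 0" using b(2)[OF l(1)] by (simp add: resid_def cv_diff)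
  qed (use kj in simp)
  then show ?thesis using b(1) kT by simp
qed

text \<open>For minimality, delete k -> j. The remaining parents T of j then separate j from k, so
  an I-map would force the coefficient of the deleted edge to be zero.\<close>

lemma Btilde_minimal_I_map:
  assumes pi: "\<pi> permutes {..<p}" and M: "prob_space M" "mvn M p S Y"
  shows "minimal_I_map M p S (graph_of p (Btilde p S \<pi>))"
proof -
  define r where "r = inv \<pi>"
  define B where "B = Btilde p S \<pi>"
  define G where "G = graph_of p B"
  obtain D where sem: "sem r B D" using Btilde_sem[OF pi] unfolding r_def B_def by blast
  have r_lt: "r a < p" if "a < p" for a using permutes_in_image[OF permutes_inv[OF pi], of a] that by (simp add: r_def)
  have acyc: "acyclic G" unfolding G_def by (rule sem_acyclic[OF sem])
  note gauss_eq = indep_model_gauss_eq[OF M(1) pd M(2)]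
  have "I_map M p S G"
    unfolding I_map_def gauss_eq indep_model_graph_def G_def
    using d_separated_imp_partial_uncorr[OF sem r_lt] by auto
  moreover have "\<not> I_map M p S (G - {e})" if e: "e \<in> G" for e
  proof
    assume im: "I_map M p S (G - {e})"
    obtain k j where ekj: "e = (k, j)" by (cases e)
    then have kj: "k < p" "j < p" "B k j \<noteq> 0" using e by (auto simp: G_def graph_of_def)
    have rkj: "r j < r k" using semD(2)[OF sem kj(3)] .
    define T where "T = {a. (a, j) \<in> G} - {k}"
    define G' where "G' = G - {e}"
    have T: "a < p" "B a j \<noteq> 0" "r j < r a" if "a \<in> T" for a
      using that semD(2)[OF sem] by (auto simp: T_def G_def graph_of_def)
    have G'G: "G'\<^sup>* \<subseteq> G\<^sup>*" unfolding G'_def by (intro rtrancl_mono) auto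
    have nocyc: "(j, a) \<notin> G'\<^sup>*" if "(a, j) \<in> G" for a
    proof
      assume "(j, a) \<in> G'\<^sup>*"
      then have "(j, j) \<in> G\<^sup>+" using G'G that by (meson rtrancl_into_trancl1 subsetD)
      then show False using acyc by (simp add: acyclic_def)
    qed
    have "d_separated G' j k T"
    proof (rule d_separated_by_parents)
      show "acyclic G'" using acyc unfolding G'_def by (rule acyclic_subset) auto
      show "a \<in> T" if "(a, j) \<in> G'" for a using that by (auto simp: T_def G'_def ekj)
      show "G'\<^sup>* `` {j} \<inter> T = {}" using nocyc by (auto simp: T_def)
      show "(j, k) \<notin> G'\<^sup>*" using nocyc e ekj by auto
      show "k \<notin> T" by (simp add: T_def)
    qed
    moreover have "T \<subseteq> {..<p} - {j, k}" "j \<noteq> k" using T rkj by (auto simp: T_def) 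
    ultimately have "(j, k, T) \<in> indep_model_graph p G'" using kj by (simp add: indep_model_graph_def)
    then have pu: "partial_uncorr j k T" using im unfolding I_map_def G'_def gauss_eq by auto
    have "B k j = 0"
    proof (rule partial_uncorr_edge[OF sem kj(1,2) _ rkj _ _ pu])
      show "T \<subseteq> {..<p}" using T(1) by auto
      show "r j < r a" if "a \<in> T" for a using that by (rule T(3))
      show "a \<in> insert k T" if "a < p" "B a j \<noteq> 0" for a
        using that kj(2) by (simp add: T_def G_def graph_of_def)
      show "k \<notin> T" by (simp add: T_def)
    qed
    then show False using kj by simp
  qed
  ultimately show ?thesis unfolding minimal_I_map_def G_def B_def by blast
qed

lemma indep_model_gauss_union:
  assumes M: "prob_space M" "mvn M p S Y"
  shows "(\<Union>\<pi> \<in> {\<pi>. \<pi> permutes {..<p}}. indep_model_graph p (graph_of p (Btilde p S \<pi>))) = indep_model_gauss M p S" (is "?U = _")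
proof
  show "?U \<subseteq> indep_model_gauss M p S"
    using Btilde_minimal_I_map[OF _ M] unfolding minimal_I_map_def I_map_def by blast
  show "indep_model_gauss M p S \<subseteq> ?U"
  proof
    fix x assume x: "x \<in> indep_model_gauss M p S"
    obtain i j T where xe: "x = (i, j, T)" by (cases x)
    from x have ij: "i < p" "j < p" "i \<noteq> j" and T: "T \<subseteq> {..<p} - {i, j}" and pu: "partial_uncorr i j T"
      unfolding indep_model_gauss_eq[OF M(1) pd M(2)] xe by auto
    \<comment> \<open>High keys are early, as parents have the larger rank. Hence the parents of i
      lie in T or equal j, and the given independence rules out j; descendants of i rank below T and
      j.\<close>
    define key where "key a = (if a \<in> T then 3 else if a = j then 2 else if a = i then 1 else (0::nat))" for a
    have nT: "i \<notin> T" "j \<notin> T" and Tp: "\<And>a. a \<in> T \<Longrightarrow> a < p" using T by auto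
    obtain \<pi> where pi: "\<pi> permutes {..<p}" and mono: "\<And>a b. a < p \<Longrightarrow> b < p \<Longrightarrow> key a < key b \<Longrightarrow> inv \<pi> a < inv \<pi> b"
      using permutation_by_key[of p key] by blast
    define r where "r = inv \<pi>"
    define B where "B = Btilde p S \<pi>"
    define G where "G = graph_of p B"
    obtain D where sem: "sem r B D" using Btilde_sem[OF pi] unfolding r_def B_def by blast
    have rT: "r i < r a" if "a \<in> T" for a
      using mono[of i a] that nT Tp[OF that] ij by (simp add: key_def r_def)
    have rj: "r i < r j" using mono[of i j] nT ij by (simp add: key_def r_def)
    have par: "a \<in> insert j T" if "a < p" "B a i \<noteq> 0" for a
    proof (rule ccontr)
      assume a: "a \<notin> insert j T"
      have "r i < r a" using semD(2)[OF sem that(2)] .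
      moreover have "a \<noteq> i" using calculation by auto
      then have "r a < r i" using mono[of a i] a nT ij that(1) by (simp add: key_def r_def)
      ultimately show False by simp
    qed
    have Bji: "B j i = 0"
      by (rule partial_uncorr_edge[OF sem ij(2,1) _ rj rT par pu]) (use T in auto)
    have desc: "r a \<le> r i" if "(i, a) \<in> G\<^sup>*" for a
      using that
    proof (induction rule: rtrancl_induct)
      case (step b c)
      then have "r c < r b" using semD(2)[OF sem, of b c] by (auto simp: G_def graph_of_def)
      then show ?case using step by simp
    qed simp
    have "d_separated G i j T"
    proof (rule d_separated_by_parents)
      show "acyclic G" unfolding G_def by (rule sem_acyclic[OF sem])
      show "a \<in> T" if "(a, i) \<in> G" for a using that par[of a] Bji by (auto simp: G_def graph_of_def)
      show "G\<^sup>* `` {i} \<inter> T = {}" using desc rT by fastforce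
      show "(i, j) \<notin> G\<^sup>*" using desc[of j] rj by auto
      show "j \<notin> T" using T by auto
    qed
    then have "x \<in> indep_model_graph p (graph_of p (Btilde p S \<pi>))"
      using ij T by (simp add: indep_model_graph_def xe G_def B_def)
    then show "x \<in> ?U"
      using pi by blast
  qed
qed

end

section \<open>Recovery of the graphs\<close>

context pd_mat
begin

lemma d_Sigma_zero:
  assumes "d_Sigma p S = 0" "\<pi> permutes {..<p}" "i < p" "j < p"
  shows "Btilde p S \<pi> i j = 0"
proof (rule ccontr)
  assume nz: "Btilde p S \<pi> i j \<noteq> 0"
  let ?C = "{col_l0 p (Btilde p S \<pi>) j | \<pi> j. \<pi> permutes {..<p} \<and> j < p}"
  have "?C \<subseteq> (\<lambda>(\<pi>, j). col_l0 p (Btilde p S \<pi>) j) ` ({\<pi>. \<pi> permutes {..<p}} \<times> {..<p})" by auto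
  then have fin: "finite ?C" by (rule finite_subset) (simp add: finite_permutations)
  have "i \<in> {i. i < p \<and> Btilde p S \<pi> i j \<noteq> 0}" using nz assms by simp
  then have "col_l0 p (Btilde p S \<pi>) j > 0" unfolding col_l0_def by (subst card_gt_0_iff) auto
  moreover have "col_l0 p (Btilde p S \<pi>) j \<le> d_Sigma p S"
    unfolding d_Sigma_def using fin assms by (intro Max_ge) auto
  ultimately show False using assms by simp
qed

lemma beta_min_Sigma_le:
  assumes "\<pi> permutes {..<p}" "i < p" "j < p" "Btilde p S \<pi> i j \<noteq> 0"
  shows "beta_min_Sigma p S \<le> ereal \<bar>Btilde p S \<pi> i j\<bar>"
  unfolding beta_min_Sigma_def col_beta_min_def
  by (rule INF_lower2[of \<pi>], use assms in simp, rule INF_lower2[of j], use assms in simp, rule INF_lower2[of i])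
     (use assms in auto)

text \<open>An entrywise error delta costs at most delta times the squared l1 norm of v, hence delta
  p times its squared l2 norm.\<close>

lemma gram_coercive:
  fixes \<delta> :: real
  assumes \<kappa>: "\<And>v. ip p S v v \<ge> \<kappa> * (\<Sum>i<p. (v i)\<^sup>2)"
    and dev: "\<And>k l. k < p \<Longrightarrow> l < p \<Longrightarrow> \<bar>H k l - S k l\<bar> \<le> \<delta>" and \<delta>: "\<delta> * p \<le> \<kappa> / 2" "\<delta> \<ge> 0"
  shows "ip p H v v \<ge> \<kappa> / 2 * (\<Sum>i<p. (v i)\<^sup>2)"
proof -
  have "ip p S v v - ip p H v v = (\<Sum>i<p. \<Sum>j<p. v i * (S i j - H i j) * v j)"
    by (simp add: ip_def sum_subtractf algebra_simps)
  also have "\<dots> \<le> (\<Sum>i<p. \<Sum>j<p. \<delta> * (\<bar>v i\<bar> * \<bar>v j\<bar>))"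
  proof (intro sum_mono)
    fix i j assume ij: "i \<in> {..<p}" "j \<in> {..<p}"
    have "v i * (S i j - H i j) * v j \<le> \<bar>S i j - H i j\<bar> * (\<bar>v i\<bar> * \<bar>v j\<bar>)"
      using abs_ge_self[of "v i * (S i j - H i j) * v j"] by (simp add: abs_mult mult_ac)
    also have "\<dots> \<le> \<delta> * (\<bar>v i\<bar> * \<bar>v j\<bar>)"
      using dev[of i j] ij by (intro mult_right_mono) (auto simp: abs_minus_commute)
    finally show "v i * (S i j - H i j) * v j \<le> \<delta> * (\<bar>v i\<bar> * \<bar>v j\<bar>)" .
  qed
  also have "\<dots> = \<delta> * (\<Sum>i<p. \<bar>v i\<bar>)\<^sup>2"
    unfolding power2_eq_square sum_product by (simp only: sum_distrib_left)
  also have "\<dots> \<le> \<delta> * (p * (\<Sum>i<p. (v i)\<^sup>2))"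
    using sum_squared_le_sum_of_squares[of "\<lambda>k. \<bar>v k\<bar>" "{..<p}"] \<delta>
    by (intro mult_left_mono) (auto simp: mult.commute)
  also have "\<dots> \<le> \<kappa> / 2 * (\<Sum>i<p. (v i)\<^sup>2)"
    unfolding mult.assoc[symmetric] using \<delta> by (intro mult_right_mono) (auto intro: sum_nonneg)
  finally show ?thesis using \<kappa>[of v] by (simp add: algebra_simps)
qed

text \<open>In the population, residual j is uncorrelated with its admissible predictors, so
  \<open>dev2\<close> alone bounds the noise. \<open>cases\<close> selects between curvature, of
  which kappa / 2 survives sampling, and saturation of the penalty.\<close>

lemma graph_recovery_column:
  fixes \<tau> :: real
  assumes pi: "\<pi> permutes {..<p}" and n: "n > 0"
    and rm: "restricted_minimizer n p Xd lam \<gamma> \<pi> Bh"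
    and \<kappa>: "\<kappa> > 0" "\<And>v. ip p S v v \<ge> \<kappa> * (\<Sum>i<p. (v i)\<^sup>2)"
    and \<tau>: "\<tau> \<ge> 0" and lam: "lam > 0" and \<gamma>: "\<gamma> \<ge> 1" "\<gamma> * (\<kappa> / 2) \<ge> 2"
    and G: "\<And>k l. k < p \<Longrightarrow> l < p \<Longrightarrow> \<bar>S k l\<bar> \<le> G"
    and dev1: "\<And>k l. k < p \<Longrightarrow> l < p \<Longrightarrow> \<bar>gram n Xd k l - S k l\<bar> \<le> \<tau>"
    and dev2: "\<And>k l. k < p \<Longrightarrow> l < p \<Longrightarrow> \<bar>cv p (gram n Xd) (resid (Btilde p S \<pi>) l) k - cv p S (resid (Btilde p S \<pi>) l) k\<bar> \<le> \<tau>"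
    and R1: "4 * p * \<tau> / (\<kappa> / 2) \<le> lam" and R2: "\<tau> + (G + \<tau>) * (4 * p * \<tau> / (\<kappa> / 2)) < lam / 2"
    and R3: "\<tau> \<le> lam / 4"
    and \<beta>min: "beta_min_Sigma p S > ereal ((1 + \<gamma>) * lam)"
    and cases: "\<tau> * p \<le> \<kappa> / 2 \<or> d_Sigma p S = 0 \<and> G + \<tau> < lam\<^sup>2 * \<gamma>"
    and ij: "i < p" "j < p"
  shows "Bh i j \<noteq> 0 \<longleftrightarrow> Btilde p S \<pi> i j \<noteq> 0"
proof -
  define B where "B = Btilde p S \<pi>"
  define H where "H = gram n Xd"
  define P where "P = {k. k < p \<and> inv \<pi> j < inv \<pi> k}"
  obtain D where sem: "sem (inv \<pi>) B D" using Btilde_sem[OF pi] unfolding B_def by blast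
  have Bh: "Bh k j = 0" if "k < p" "k \<notin> P" for k
    using that rm dag_mats_pi_iff[OF pi] by (auto simp: restricted_minimizer_def P_def)
  have BP: "B k j = 0" if "k < p" "k \<notin> P" for k
    using that semD(2)[OF sem] by (auto simp: P_def)
  have noise: "\<bar>cv p H (resid B j) k\<bar> \<le> \<tau>" if "k \<in> P" for k
    using dev2[of k j] semD(4)[OF sem, of j k] that ij by (simp add: P_def B_def H_def)
  have opt: "colobj p H lam \<gamma> j (\<lambda>a. Bh a j) \<le> colobj p H lam \<gamma> j b'" if "\<And>k. k < p \<Longrightarrow> k \<notin> P \<Longrightarrow> b' k = 0" for b'
    unfolding H_def by (rule restricted_minimizer_column[OF pi rm ij(2)]) (use that in \<open>auto simp: P_def\<close>)
  have sym: "H k l = H l k" for k l unfolding H_def by (rule gram_sym)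
  from cases show ?thesis
  proof
    assume d: "\<tau> * p \<le> \<kappa> / 2"
    have "Bh i j \<noteq> 0 \<longleftrightarrow> B i j \<noteq> 0"
    proof (rule minimizer_support[of p H "\<kappa> / 2" "G + \<tau>" P "\<lambda>a. B a j" "\<lambda>a. Bh a j" j \<tau> lam \<gamma> i])
      show "H k l = H l k" for k l by (rule sym)
      show "\<kappa> / 2 * (\<Sum>k<p. (u k)\<^sup>2) \<le> ip p H u u" for u
        unfolding H_def by (rule gram_coercive[OF \<kappa>(2) dev1 d \<tau>])
      show "\<bar>H k l\<bar> \<le> G + \<tau>" if "k < p" "l < p" for k l
        using dev1[OF that] G[OF that] unfolding H_def by linarith
      show "\<bar>cv p H (\<lambda>a. unit j a - B a j) k\<bar> \<le> \<tau>" if "k \<in> P" for k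
        using noise[OF that] by (simp add: resid_def)
      show "(1 + \<gamma>) * lam < \<bar>B k j\<bar>" if "k < p" "B k j \<noteq> 0" for k
      proof -
        have "ereal ((1 + \<gamma>) * lam) < ereal \<bar>B k j\<bar>"
          using \<beta>min beta_min_Sigma_le[OF pi that(1) ij(2)] that(2) unfolding B_def by (metis order_less_le_trans)
        then show ?thesis by simp
      qed
      show "colobj p H lam \<gamma> j (\<lambda>a. Bh a j) \<le> colobj p H lam \<gamma> j b'" if "\<And>k. k < p \<Longrightarrow> k \<notin> P \<Longrightarrow> b' k = 0" for b'
        using that by (rule opt)
    qed (use \<kappa> \<tau> lam \<gamma> R1 R2 ij Bh BP in auto)
    then show ?thesis by (simp add: B_def)
  next
    assume d: "d_Sigma p S = 0 \<and> G + \<tau> < lam\<^sup>2 * \<gamma>"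
    have B0: "B k j = 0" if "k < p" for k
      using d_Sigma_zero[OF _ pi that ij(2)] d by (simp add: B_def)
    have r: "cv p H (resid B j) k = cv p H (unit j) k" for k
      by (rule cv_cong) (simp add: resid_def B0)
    have "Bh i j = 0"
    proof (rule minimizer_zero[of p H P "\<lambda>a. Bh a j" j lam \<gamma> i])
      show "H k l = H l k" for k l by (rule sym)
      show "0 \<le> ip p H u u" for u unfolding H_def by (rule gram_psd)
      show "\<bar>cv p H (unit j) k\<bar> \<le> lam / 4" if "k \<in> P" for k
        using noise[OF that] R3 unfolding r by linarith
      have "ip p H (unit j) (unit j) = H j j" using ij by (simp add: ip_unit cv_unit)
      also have "\<dots> \<le> G + \<tau>" using dev1[OF ij(2,2)] G[OF ij(2,2)] unfolding H_def by linarith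
      also have "\<dots> < lam\<^sup>2 * \<gamma>" using d by blast
      finally show "ip p H (unit j) (unit j) < lam\<^sup>2 * \<gamma>" .
      show "colobj p H lam \<gamma> j (\<lambda>a. Bh a j) \<le> colobj p H lam \<gamma> j (\<lambda>_. 0)" by (rule opt) simp
    qed (use lam \<gamma> ij Bh in auto)
    then show ?thesis using B0[OF ij(1)] by (simp add: B_def)
  qed
qed


text \<open>A measurable A inside the good event is asked for, since that event quantifies over all
  minimizers and its own measurability is left open.\<close>

definition recovered :: "real \<Rightarrow> nat \<Rightarrow> real \<Rightarrow> real \<Rightarrow> 'a measure \<Rightarrow> ('a \<Rightarrow> nat \<Rightarrow> nat \<Rightarrow> real) \<Rightarrow> bool" where
  "recovered \<epsilon> n lam \<gamma> M X \<longleftrightarrow> (\<exists>A\<in>sets M. measure M A \<ge> 1 - \<epsilon> \<and> A \<subseteq> space M \<and>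
         (\<forall>w\<in>A. \<forall>\<pi> B. \<pi> permutes {..<p} \<longrightarrow> restricted_minimizer n p (X w) lam \<gamma> \<pi> B \<longrightarrow>
            graph_of p B = graph_of p (Btilde p S \<pi>)))"

lemma graph_recovery:
  assumes p: "p \<ge> 2" and \<epsilon>: "\<epsilon> > 0"
  shows "\<exists>C1 C2 C3 :: real. C1 > 0 \<and> C2 > 0 \<and> C3 > 0 \<and>
    (\<forall>n lam \<gamma> (M :: 'a measure) X. sample M p S n X \<longrightarrow> real n > C1 * real (d_Sigma p S) * ln (real p) \<longrightarrow>
       lam \<ge> C2 * sqrt ((real (d_Sigma p S) + 1) * ln p / n) \<longrightarrow> \<gamma> > C3 \<longrightarrow>
       beta_min_Sigma p S > ereal ((1 + \<gamma>) * lam) \<longrightarrow>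
       n > 0 \<and> recovered \<epsilon> n lam \<gamma> M X)"
proof -
  obtain \<kappa> where \<kappa>: "\<kappa> > 0" "\<And>v. ip p S v v \<ge> \<kappa> * (\<Sum>i<p. (v i)\<^sup>2)" using coercive by blast
  \<comment> \<open>All covariances to be compared are fixed beforehand: those of the coordinates,
    and those of coordinates with every population residual under every permutation.\<close>
  define Pairs where "Pairs = (\<lambda>(k, l). (unit k, unit l)) ` ({..<p} \<times> {..<p}) \<union>
    (\<lambda>(\<pi>, k, l). (unit k, resid (Btilde p S \<pi>) l)) ` ({\<pi>. \<pi> permutes {..<p}} \<times> {..<p} \<times> {..<p})"
  have "finite Pairs" unfolding Pairs_def by (simp add: finite_permutations)
  from uniform_deviation[OF pd this \<epsilon>] obtain t where t: "t > 0" and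
    dev: "\<And>n (M :: 'a measure) X. n > 0 \<Longrightarrow> sample M p S n X \<Longrightarrow>
      \<exists>A\<in>sets M. measure M A \<ge> 1 - \<epsilon> \<and>
       A \<subseteq> {w \<in> space M. \<forall>(a, b)\<in>Pairs. \<bar>emp n p (X w) a b - ip p S a b\<bar> \<le> t / sqrt n}"
    by blast
  define G where "G = (\<Sum>i<p. \<Sum>j<p. \<bar>S i j\<bar>)"
  have G: "\<bar>S k l\<bar> \<le> G" if "k < p" "l < p" for k l
  proof -
    have "\<bar>S k l\<bar> \<le> (\<Sum>j<p. \<bar>S k j\<bar>)" using that by (intro member_le_sum) auto
    also have "\<dots> \<le> G" unfolding G_def
      using that by (intro member_le_sum[of k _ "\<lambda>i. \<Sum>j<p. \<bar>S i j\<bar>"]) (auto intro: sum_nonneg)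
    finally show ?thesis .
  qed
  have G0: "G \<ge> 0" unfolding G_def by (intro sum_nonneg) auto
  \<comment> \<open>The curvature kappa / 2 turns the l1 radius into q tau, and h tau dominates it
    and the error terms because tau \<le> t.\<close>
  define q where "q = 8 * real p / \<kappa>"
  define h where "h = 1 + q * (G + t + 1)"
  \<comment> \<open>From N0 on, tau p \<le> kappa / 2. Below N0, lambda \<ge> s / sqrt n gives
    lambda^2 \<ge> (G + t + 1) N0 / n > G + tau.\<close>
  define N0 where "N0 = (2 * t * p / \<kappa>)\<^sup>2 + 1"
  define s where "s = sqrt ((G + t + 1) * N0)"
  \<comment> \<open>The number ln 2 is the least value of ln p: for d \<ge> 1 the bound on n forces
    n > N0, and lambda is at least (4 h t + s) / sqrt n in any case. C3 gives gamma \<ge> 1 and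
    gamma kappa / 2 \<ge> 2.\<close>
  define C1 where "C1 = N0 / ln 2"
  define C2 where "C2 = (4 * h * t + s) / sqrt (ln 2)"
  define C3 where "C3 = 1 + 4 / \<kappa>"
  have q0: "q \<ge> 0" using \<kappa> by (simp add: q_def)
  have h1: "h \<ge> 1" using q0 G0 t by (simp add: h_def)
  have hq: "q \<le> h" using q0 G0 t by (simp add: h_def algebra_simps)
  have N0: "N0 > 0" by (simp add: N0_def add_nonneg_pos)
  have s: "s > 0" using N0 G0 t by (simp add: s_def)
  have ln2: "ln 2 > (0::real)" "ln 2 \<le> ln (real p)" using p by auto
  have C: "C1 > 0" "C2 > 0" "C3 > 0"
    using N0 s h1 t \<kappa> by (auto simp: C1_def C2_def C3_def intro!: divide_pos_pos add_nonneg_pos add_pos_nonneg)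
  have main: "n > 0 \<and> recovered \<epsilon> n lam \<gamma> M X"
    if sam: "sample M p S n X" and nC: "real n > C1 * real (d_Sigma p S) * ln (real p)"
      and lamC: "lam \<ge> C2 * sqrt ((real (d_Sigma p S) + 1) * ln p / n)" and \<gamma>C: "\<gamma> > C3"
      and \<beta>: "beta_min_Sigma p S > ereal ((1 + \<gamma>) * lam)"
    for n lam \<gamma> and M :: "'a measure" and X
  proof -
    have "ln (real p) \<ge> 0" using ln2 by linarith
    then have "0 \<le> C1 * d_Sigma p S * ln p" using C by simp
    then have n: "n > 0" using nC by (metis le_less_trans of_nat_0_less_iff)
    define \<tau> where "\<tau> = t / sqrt n"
    have \<tau>0: "\<tau> \<ge> 0" using t by (simp add: \<tau>_def)
    have "sqrt (real n) \<ge> 1" using n by simp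
    then have \<tau>t: "\<tau> \<le> t" unfolding \<tau>_def using t by (simp add: divide_le_eq mult_left_le)
    have lam_ge: "lam \<ge> (4 * h * t + s) / sqrt n"
    proof -
      have "ln 2 \<le> (real (d_Sigma p S) + 1) * ln p"
        using ln2 mult_mono[of 1 "real (d_Sigma p S) + 1" "ln 2" "ln p"] by simp
      then have "sqrt (ln 2 / n) \<le> sqrt ((real (d_Sigma p S) + 1) * ln p / n)"
        by (intro real_sqrt_le_mono divide_right_mono) auto
      then have "C2 * sqrt (ln 2 / n) \<le> lam" using C lamC by (meson less_imp_le mult_left_mono order_trans)
      moreover have "C2 * sqrt (ln 2 / n) = (4 * h * t + s) / sqrt n"
        using ln2 by (simp add: C2_def real_sqrt_divide)
      ultimately show ?thesis by simp
    qed
    have lam1: "4 * h * \<tau> \<le> lam"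
    proof -
      have "4 * h * \<tau> \<le> (4 * h * t + s) / sqrt n"
        unfolding \<tau>_def times_divide_eq_right using s by (intro divide_right_mono) auto
      then show ?thesis using lam_ge by simp
    qed
    have lam2: "s / sqrt n \<le> lam"
    proof -
      have "s / sqrt n \<le> (4 * h * t + s) / sqrt n"
        using h1 t by (intro divide_right_mono) auto
      then show ?thesis using lam_ge by simp
    qed
    have "s / sqrt n > 0" using s n by simp
    then have lam: "lam > 0" using lam2 by linarith
    have \<gamma>: "\<gamma> \<ge> 1" "\<gamma> * (\<kappa> / 2) \<ge> 2"
    proof -
      have "4 / \<kappa> > 0" using \<kappa> by simp
      then show "\<gamma> \<ge> 1" using \<gamma>C unfolding C3_def by linarith
      have "4 / \<kappa> \<le> \<gamma>" using \<gamma>C unfolding C3_def by linarith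
      then have "4 / \<kappa> * (\<kappa> / 2) \<le> \<gamma> * (\<kappa> / 2)" using \<kappa> by (intro mult_right_mono) auto
      then show "\<gamma> * (\<kappa> / 2) \<ge> 2" using \<kappa> by simp
    qed
    have q\<tau>: "4 * p * \<tau> / (\<kappa> / 2) = q * \<tau>" by (simp add: q_def)
    have h\<tau>: "\<tau> \<le> h * \<tau>" "q * \<tau> \<le> h * \<tau>" using h1 hq \<tau>0 by (auto simp: mult_le_cancel_right1 intro: mult_right_mono)
    have R1: "4 * p * \<tau> / (\<kappa> / 2) \<le> lam" unfolding q\<tau> using h\<tau> lam1 h1 \<tau>0 by linarith
    have R3: "\<tau> \<le> lam / 4" using h\<tau> lam1 by linarith
    have R2: "\<tau> + (G + \<tau>) * (4 * p * \<tau> / (\<kappa> / 2)) < lam / 2"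
    proof -
      have "(G + \<tau>) * (q * \<tau>) \<le> (G + t + 1) * (q * \<tau>)"
        using \<tau>t q0 \<tau>0 by (intro mult_right_mono) auto
      then have "\<tau> + (G + \<tau>) * (q * \<tau>) \<le> h * \<tau>" by (simp add: h_def algebra_simps)
      also have "\<dots> < lam / 2" using lam1 lam by linarith
      finally show ?thesis unfolding q\<tau> .
    qed
    have cases: "\<tau> * p \<le> \<kappa> / 2 \<or> d_Sigma p S = 0 \<and> G + \<tau> < lam\<^sup>2 * \<gamma>"
    proof (cases "real n \<ge> N0")
      case True
      then have "(2 * t * p / \<kappa>)\<^sup>2 \<le> n" by (simp add: N0_def)
      then have "2 * t * p / \<kappa> \<le> sqrt n" by (rule real_le_rsqrt)
      then have "\<tau> * p \<le> \<kappa> / 2" using \<kappa> n by (simp add: \<tau>_def field_simps)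
      then show ?thesis ..
    next
      case False
      have "d_Sigma p S = 0"
      proof (rule ccontr)
        assume "d_Sigma p S \<noteq> 0"
        then have "1 * ln 2 \<le> d_Sigma p S * ln p" using ln2 by (intro mult_mono) auto
        then have "C1 * ln 2 \<le> C1 * (d_Sigma p S * ln p)" using C by (intro mult_left_mono) auto
        then show False using nC False ln2 by (simp add: C1_def mult.assoc)
      qed
      moreover have "G + \<tau> < lam\<^sup>2 * \<gamma>"
      proof -
        have "G + \<tau> < (G + t + 1) * 1" using \<tau>t by simp
        also have "\<dots> \<le> (G + t + 1) * (N0 / n)"
          using False n G0 t by (intro mult_left_mono) auto
        also have "\<dots> = (s / sqrt n)\<^sup>2"
          using N0 G0 t by (simp add: power_divide s_def)
        also have "\<dots> \<le> lam\<^sup>2 * 1"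
          using power_mono[OF lam2, of 2] \<open>s / sqrt n > 0\<close> by simp
        also have "\<dots> \<le> lam\<^sup>2 * \<gamma>" using \<gamma> by (intro mult_left_mono) auto
        finally show ?thesis .
      qed
      ultimately show ?thesis by blast
    qed
    obtain A where A: "A \<in> sets M" "measure M A \<ge> 1 - \<epsilon>"
      and AD: "A \<subseteq> {w \<in> space M. \<forall>(a, b)\<in>Pairs. \<bar>emp n p (X w) a b - ip p S a b\<bar> \<le> t / sqrt n}"
      using dev[OF n sam] by blast
    have "graph_of p B = graph_of p (Btilde p S \<pi>)"
      if w: "w \<in> A" and pi: "\<pi> permutes {..<p}" and rm: "restricted_minimizer n p (X w) lam \<gamma> \<pi> B" for w \<pi> B
    proof -
      have D: "\<bar>cv p (gram n (X w)) b k - cv p S b k\<bar> \<le> \<tau>" if "(unit k, b) \<in> Pairs" "k < p" for k b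
      proof -
        have "\<bar>emp n p (X w) (unit k) b - ip p S (unit k) b\<bar> \<le> \<tau>" using AD w that by (auto simp: \<tau>_def)
        then show ?thesis
          unfolding emp_eq_ip ip_sym[of p "gram n (X w)" "unit k" b, OF gram_sym] ip_commute[of "unit k" b]
          using that by (simp add: ip_unit)
      qed
      have D1: "\<bar>gram n (X w) k l - S k l\<bar> \<le> \<tau>" if "k < p" "l < p" for k l
      proof -
        have "(unit l, unit k) \<in> Pairs"
          unfolding Pairs_def using that by (intro UnI1 image_eqI[of _ _ "(l, k)"]) auto
        from D[OF this that(2)] show ?thesis using that by (simp add: cv_unit)
      qed
      have D2: "\<bar>cv p (gram n (X w)) (resid (Btilde p S \<pi>) l) k - cv p S (resid (Btilde p S \<pi>) l) k\<bar> \<le> \<tau>"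
        if "k < p" "l < p" for k l
      proof (rule D)
        show "(unit k, resid (Btilde p S \<pi>) l) \<in> Pairs"
          unfolding Pairs_def using that pi by (intro UnI2 image_eqI[of _ _ "(\<pi>, k, l)"]) auto
      qed (use that in simp)
      have "B i j \<noteq> 0 \<longleftrightarrow> Btilde p S \<pi> i j \<noteq> 0" if "i < p" "j < p" for i j
        by (rule graph_recovery_column[OF pi n rm \<kappa> \<tau>0 lam \<gamma> G D1 D2 R1 R2 R3 \<beta> cases that])
      then show ?thesis by (auto simp: graph_of_def)
    qed
    then show ?thesis unfolding recovered_def using n A AD by blast
  qed
  show ?thesis
    by (rule exI[of _ C1], rule exI[of _ C2], rule exI[of _ C3], intro conjI C allI impI)
      (rule main[THEN conjunct1] main[THEN conjunct2]; assumption)+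
qed

end

section \<open>The probability statement\<close>

theorem theorem7:
  "\<exists>c1 c2 :: real. c1 > 0 \<and> c2 > 0 \<and>
   (\<forall>(p :: nat) (\<Sigma> :: nat \<Rightarrow> nat \<Rightarrow> real). pos_def p \<Sigma> \<longrightarrow>
     (\<exists>C1 C2 C3 :: real. C1 > 0 \<and> C2 > 0 \<and> C3 > 0 \<and>
       (\<forall>(n :: nat) (lam :: real) (\<gamma> :: real) (M :: 'a measure) (X :: 'a \<Rightarrow> nat \<Rightarrow> nat \<Rightarrow> real).
          prob_space M
          \<and> (\<forall>i<n. mvn M p \<Sigma> (\<lambda>w. X w i))
          \<and> prob_space.indep_vars M (\<lambda>_. PiM {..<p} (\<lambda>_. borel)) (\<lambda>i w. restrict (X w i) {..<p}) {..<n}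
          \<and> real n > C1 * real (d_Sigma p \<Sigma>) * ln (real p)
          \<and> lam \<ge> C2 * sqrt ((real (d_Sigma p \<Sigma>) + 1) * ln (real p) / real n)
          \<and> \<gamma> > C3
          \<and> beta_min_Sigma p \<Sigma> > ereal ((1 + \<gamma>) * lam)
          \<longrightarrow>
          (\<exists>A \<in> sets M.
             A \<subseteq> {w \<in> space M. \<forall>Bhat :: (nat \<Rightarrow> nat) \<Rightarrow> nat \<Rightarrow> nat \<Rightarrow> real.
                    (\<forall>\<pi>. \<pi> permutes {..<p} \<longrightarrow> restricted_minimizer n p (X w) lam \<gamma> \<pi> (Bhat \<pi>)) \<longrightarrow>
                    (\<forall>\<pi>. \<pi> permutes {..<p} \<longrightarrow> minimal_I_map M p \<Sigma> (graph_of p (Bhat \<pi>)))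
                    \<and> (\<Union>\<pi> \<in> {\<pi>. \<pi> permutes {..<p}}. indep_model_graph p (graph_of p (Bhat \<pi>)))
                        = indep_model_gauss M p \<Sigma>}
             \<and> measure M A \<ge> 1 - c1 * exp (- c2 * min (real n) ((real (d_Sigma p \<Sigma>) + 1) * ln (real p)))))))"
proof (rule exI[of _ 1], rule exI[of _ 1], intro conjI zero_less_one allI impI, goal_cases)
  case (1 p \<Sigma>)
  then interpret pd_mat p \<Sigma> by unfold_locales
  show ?case
  proof (cases "p \<ge> 2")
    \<comment> \<open>For p at most 1 the logarithm is zero (for p = 0 by the convention ln 0 = 0),
      the claimed probability is 1 - 1 = 0, and the empty event suffices.\<close>
    case False
    then have "ln (real p) = 0" by (cases "p = 0") (auto simp: not_le less_2_cases_iff)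
    then have "1 - 1 * exp (- 1 * min (real n) ((real (d_Sigma p \<Sigma>) + 1) * ln (real p))) = 0" for n by simp
    then show ?thesis
      by (intro exI[of _ 1] conjI zero_less_one allI impI bexI[of _ "{}"]) auto
  next
    case True
    define \<epsilon> where "\<epsilon> = exp (- ((real (d_Sigma p \<Sigma>) + 1) * ln (real p)))"
    have "\<epsilon> > 0" by (simp add: \<epsilon>_def)
    from graph_recovery[OF True this, where 'a = 'a] show ?thesis
    proof (elim exE conjE, goal_cases)
      case C: (1 C1 C2 C3)
      note rec = C(4)[rule_format]
      show ?case
      proof (rule exI[of _ C1], rule exI[of _ C2], rule exI[of _ C3], intro conjI C(1,2,3) allI impI, elim conjE, goal_cases)
        case (1 n lam \<gamma> M X)
        have sam: "sample M p \<Sigma> n X"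
          using 1 pd_mat_axioms by (simp add: sample_def sample_axioms_def)
        note R = rec[OF sam 1(4,5,6,7)]
        have n: "n > 0" using R by (rule conjunct1)
        from conjunct2[OF R, unfolded recovered_def] obtain A where A: "A \<in> sets M" "measure M A \<ge> 1 - \<epsilon>" "A \<subseteq> space M"
          and "\<forall>w\<in>A. \<forall>\<pi> B. \<pi> permutes {..<p} \<longrightarrow> restricted_minimizer n p (X w) lam \<gamma> \<pi> B \<longrightarrow>
              graph_of p B = graph_of p (Btilde p \<Sigma> \<pi>)"
          by blast
        note gr = this(4)[rule_format]
        \<comment> \<open>Row 0 exists because n > 0; it supplies the Gaussian vector on M that
          makes the independence model meaningful.\<close>
        have Y: "mvn M p \<Sigma> (\<lambda>w. X w 0)" using 1 n by blast
        have "\<epsilon> \<le> 1 * exp (- 1 * min (real n) ((real (d_Sigma p \<Sigma>) + 1) * ln (real p)))"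
          by (simp add: \<epsilon>_def)
        then have "measure M A \<ge> 1 - 1 * exp (- 1 * min (real n) ((real (d_Sigma p \<Sigma>) + 1) * ln (real p)))"
          using A(2) by linarith
        moreover have "minimal_I_map M p \<Sigma> (graph_of p (Bhat \<pi>))"
          if "w \<in> A" "\<forall>\<pi>. \<pi> permutes {..<p} \<longrightarrow> restricted_minimizer n p (X w) lam \<gamma> \<pi> (Bhat \<pi>)" "\<pi> permutes {..<p}"
          for w Bhat \<pi>
          using gr[OF that(1,3)] that Btilde_minimal_I_map[OF that(3) 1(1) Y] by simp
        moreover have "(\<Union>\<pi> \<in> {\<pi>. \<pi> permutes {..<p}}. indep_model_graph p (graph_of p (Bhat \<pi>))) = indep_model_gauss M p \<Sigma>"
          if "w \<in> A" "\<forall>\<pi>. \<pi> permutes {..<p} \<longrightarrow> restricted_minimizer n p (X w) lam \<gamma> \<pi> (Bhat \<pi>)"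
          for w Bhat
          using gr[OF that(1)] that indep_model_gauss_union[OF 1(1) Y] by simp
        ultimately show ?case using A(1,3) by (intro bexI[of _ A]) blast+
      qed
    qed
  qed
qed

end
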